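(* Consider the queueing system alternating between a vacation mode and a working mode described in the context: in the working mode it runs as an $M^X/G/1$ queue with batch arrival rate $\lambda>0$, generic batch size $B$ and generic service time $S$; each working mode starts with a random number of customers distributed as $Y\ge 1$ and ends when the number of customers first drops to $0$; and the vacation mode is arbitrary. Assume that the expected length of a vacation period is finite, that $E[Y]<\infty$, and that $\rho=\lambda E[S]E[B]<1$. Let $\widetilde{G}_1(z)$ be the conditional steady-state probability generating function (PGF) of the number of customers in the system, given that the system is in the working mode. Let $\widetilde{P}_1(z)$ be the conditional steady-state PGF of the number of customers in the regular $M^X/G/1$ queue (same $\lambda$, $B$, $S$; no vacations; every batch distributed as $B$), given that its server is busy. Let $B^e(z)$ and $\Psi^e(z)$ be the PGFs of the equilibrium distributions associated with $B$ and $Y$, respectively. Then, for $|z|<1$, $$\widetilde{G}_1(z)=\widetilde{P}_1(z)\,\bigl(B^e(z)\bigr)^{-1}\,\Psi^e(z).$$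
   Context: **The model.** A queueing system alternates between two modes, called vacation mode and working mode. - *Vacation mode.* The system evolves as an arbitrary queueing system (possibly with services, batch arrivals, several servers, abandonments, disasters, etc.). It may be empty during this mode. The vacation mode ends according to some stopping rule, at a moment when at least one customer is present. At that moment all customers present are transferred to the working mode. Any service in progress is lost, and the customers concerned restart service from scratch in the working mode. The number of transferred customers is distributed as a random variable $Y$ with values in $\{1,2,\dots\}$, probabilities $\psi_i=P(Y=i)$ and PGF $\Psi(z)=\sum_{i\ge1}\psi_i z^i$. - *Working mode.* The system starts with $Y$ customers and runs as a single-server $M^X/G/1$ queue. Batches arrive according to a Poisson process of rate $\lambda$. Batch sizes are i.i.d. copies of a random variable $B$ with values in $\{1,2,\dots\}$, $b_i=P(B=i)$ and PGF $B(z)=\sum_{i\ge1} b_i z^i$. Customers are served one at a time, without interruption, with i.i.d. service times distributed as $S$, with distribution function $F_S$. The arrival process, batch sizes and service times in the working mode are independent of each other, of $Y$ and of the preceding vacation mode. When the number of customers drops to $0$, the working mode ends and a new vacation mode begins. A cycle is a vacation mode followed by the next working mode; $T$ denotes its length. The system is regenerative, with successive cycles i.i.d., and it is considered in steady state. **Steady-state quantities.** For $j\ge1$, $p_{(1,j)}$ is the steady-state probability that the system is in the working mode with $j$ customers present. By renewal theory, this is the expected time during a cycle spent in the working mode with $j$ customers, divided by $E[T]$. Put $G_1(z)=\sum_{j\ge1}p_{(1,j)}z^j$ and $p_{1.}=\sum_{j\ge1}p_{(1,j)}$, and define $$\widetilde{G}_1(z)=\frac{G_1(z)}{p_{1.}}.$$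 **Equilibrium distribution.** For a non-negative integer-valued random variable $U$ with finite positive expectation and PGF $U(z)$, the equilibrium random variable $U^e$ has probabilities $P(U^e=i)=P(U>i)/E[U]$, $i=0,1,2,\dots$, and PGF $$U^e(z)=\frac{1-U(z)}{E[U](1-z)}.$$ $B^e(z)$ is this PGF for $U=B$, and $\Psi^e(z)$ is this PGF for $U=Y$. **The regular $M^X/G/1$ queue.** This is the stable single-server queue with the same $\lambda$, $B$, $S$ and no vacations, in which all batches (including those that find the system empty) are distributed as $B$. Let $P(z)$ be the steady-state PGF of its number of customers. The server is busy with probability $\rho=\lambda E[S]E[B]$, and $$\widetilde{P}_1(z)=\frac{P(z)-(1-\rho)}{\rho}.$$ It is known that $$P(z)=(1-\rho)\frac{1-\lambda\alpha(z)(1-B(z))}{1-\lambda\alpha(z)\frac{1-B(z)}{1-z}},\qquad \alpha(z)=\int_0^\infty e^{-\lambda(1-B(z))t}(1-F_S(t))\,dt,$$ so that $$\widetilde{P}_1(z)=\frac{1-\rho}{\lambda E[S]}\cdot\frac{\lambda z\,\alpha(z)\,B^e(z)}{1-\lambda\alpha(z)\frac{1-B(z)}{1-z}}.$$ *)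

theory Defs
  imports "HOL-Probability.Probability"
begin

section \<open>Generating functions\<close>

definition pgf :: "(nat \<Rightarrow> real) \<Rightarrow> complex \<Rightarrow> complex" where
  "pgf p z = (\<Sum>n. of_real (p n) * z ^ n)"

definition equilibrium_prob :: "nat pmf \<Rightarrow> nat \<Rightarrow> real" where
  "equilibrium_prob u i = measure_pmf.prob u {i<..} / measure_pmf.expectation u real"

definition equilibrium_pgf :: "nat pmf \<Rightarrow> complex \<Rightarrow> complex" where
  "equilibrium_pgf u = pgf (equilibrium_prob u)"


section \<open>Steady state of a regenerative process\<close>

text \<open>
  A regenerative process is described by its first cycle: \<open>T\<close> is the (possibly infinite) length of
  the cycle and \<open>Z t\<close> the state at time \<open>t < T\<close>. The steady-state probability of a state is the
  expected time spent in it during a cycle, divided by the expected length of a cycle.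
\<close>

definition expected_time :: "'a measure \<Rightarrow> ('a \<Rightarrow> ennreal) \<Rightarrow> (real \<Rightarrow> 'a \<Rightarrow> 's) \<Rightarrow> 's \<Rightarrow> ennreal" where
  "expected_time M T Z s =
     (\<integral>\<^sup>+\<omega>. emeasure lborel {t. 0 \<le> t \<and> ennreal t < T \<omega> \<and> Z t \<omega> = s} \<partial>M)"

definition steady_state_prob :: "'a measure \<Rightarrow> ('a \<Rightarrow> ennreal) \<Rightarrow> (real \<Rightarrow> 'a \<Rightarrow> 's) \<Rightarrow> 's \<Rightarrow> real" where
  "steady_state_prob M T Z s = enn2real (expected_time M T Z s / (\<integral>\<^sup>+\<omega>. T \<omega> \<partial>M))"


section \<open>Sample paths of the single-server queue with batch arrivals\<close>

text \<open>
  \<open>x\<close>, \<open>b\<close> and \<open>s\<close> are the sequences of times between batch arrivals, of batch sizes, and of service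
  times. At time \<open>0\<close> there are \<open>n\<close> customers, none of whom has received any service; batch \<open>k\<close>
  (counted from \<open>0\<close>) arrives at time \<open>x 0 + \<dots> + x k\<close>. Customers are numbered in their order of
  arrival, the initial ones first, and served in that order; \<open>s i\<close> is the length of service \<open>i\<close>.
\<close>

definition batch_epoch :: "(nat \<Rightarrow> real) \<Rightarrow> nat \<Rightarrow> real" where
  "batch_epoch x k = (\<Sum>l\<le>k. x l)"

definition arrival :: "nat \<Rightarrow> (nat \<Rightarrow> real) \<Rightarrow> (nat \<Rightarrow> nat) \<Rightarrow> nat \<Rightarrow> real" where
  "arrival n x b i =
     (if i < n then 0 else batch_epoch x (LEAST k. i < n + (\<Sum>l\<le>k. b l)))"

primrec departure :: "nat \<Rightarrow> (nat \<Rightarrow> real) \<Rightarrow> (nat \<Rightarrow> nat) \<Rightarrow> (nat \<Rightarrow> real) \<Rightarrow> nat \<Rightarrow> real" where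
  "departure n x b s 0 = arrival n x b 0 + s 0"
| "departure n x b s (Suc i) =
     max (arrival n x b (Suc i)) (departure n x b s i) + s (Suc i)"

definition customers ::
    "nat \<Rightarrow> (nat \<Rightarrow> real) \<Rightarrow> (nat \<Rightarrow> nat) \<Rightarrow> (nat \<Rightarrow> real) \<Rightarrow> real \<Rightarrow> nat" where
  "customers n x b s t = card {i. arrival n x b i \<le> t \<and> t < departure n x b s i}"

text \<open>First time at or after \<open>t0\<close> at which the queue is empty (infinite if there is none).\<close>

definition empty_time ::
    "nat \<Rightarrow> (nat \<Rightarrow> real) \<Rightarrow> (nat \<Rightarrow> nat) \<Rightarrow> (nat \<Rightarrow> real) \<Rightarrow> real \<Rightarrow> ennreal" where
  "empty_time n x b s t0 = (INF t\<in>{t. t0 \<le> t \<and> customers n x b s t = 0}. ennreal t)"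


section \<open>Random input of an \<open>M\<^sup>X/G/1\<close> queue\<close>

datatype source = Gap nat | Batch nat | Service nat

primrec input ::
    "(nat \<Rightarrow> 'a \<Rightarrow> real) \<Rightarrow> (nat \<Rightarrow> 'a \<Rightarrow> nat) \<Rightarrow> (nat \<Rightarrow> 'a \<Rightarrow> real) \<Rightarrow> source \<Rightarrow> 'a \<Rightarrow> real" where
  "input X B S (Gap k) = X k"
| "input X B S (Batch k) = (\<lambda>\<omega>. real (B k \<omega>))"
| "input X B S (Service k) = S k"

text \<open>
  \<open>b\<close> is the law of the batch sizes and \<open>F\<close> the law of the service times. The Poisson process of
  rate \<open>r\<close> is given by its independent exponential interarrival times.
\<close>

locale MXG1_input = prob_space M
  for M :: "'a measure" and r :: real and b :: "nat pmf" and F :: "real measure"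
    and X :: "nat \<Rightarrow> 'a \<Rightarrow> real" and B :: "nat \<Rightarrow> 'a \<Rightarrow> nat" and S :: "nat \<Rightarrow> 'a \<Rightarrow> real" +
  assumes rate_pos: "0 < r"
    and batch_pos: "0 \<notin> set_pmf b"
    and service_nonneg: "AE s in F. 0 \<le> s"
    and gap_law: "\<And>k. distributed M lborel (X k) (exponential_density r)"
    and batch_measurable: "\<And>k. B k \<in> measurable M (count_space UNIV)"
    and batch_law: "\<And>k. distr M (count_space UNIV) (B k) = measure_pmf b"
    and service_measurable: "\<And>k. S k \<in> borel_measurable M"
    and service_law: "\<And>k. distr M borel (S k) = F"
    and input_indep: "indep_vars (\<lambda>_. borel) (input X B S) UNIV"

definition traffic_intensity :: "real \<Rightarrow> nat pmf \<Rightarrow> real measure \<Rightarrow> real" where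
  "traffic_intensity r b F = r * (\<integral>s. s \<partial>F) * measure_pmf.expectation b real"


section \<open>The regular \<open>M\<^sup>X/G/1\<close> queue\<close>

text \<open>
  The queue starts empty. A cycle is an idle period followed by a busy period: it ends when the queue
  is empty again, at or after the arrival of the first batch.
\<close>

definition regular_customers ::
    "(nat \<Rightarrow> 'a \<Rightarrow> real) \<Rightarrow> (nat \<Rightarrow> 'a \<Rightarrow> nat) \<Rightarrow> (nat \<Rightarrow> 'a \<Rightarrow> real) \<Rightarrow> real \<Rightarrow> 'a \<Rightarrow> nat" where
  "regular_customers X B S t \<omega> = customers 0 (\<lambda>k. X k \<omega>) (\<lambda>k. B k \<omega>) (\<lambda>k. S k \<omega>) t"

definition regular_cycle ::
    "(nat \<Rightarrow> 'a \<Rightarrow> real) \<Rightarrow> (nat \<Rightarrow> 'a \<Rightarrow> nat) \<Rightarrow> (nat \<Rightarrow> 'a \<Rightarrow> real) \<Rightarrow> 'a \<Rightarrow> ennreal" where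
  "regular_cycle X B S \<omega> = empty_time 0 (\<lambda>k. X k \<omega>) (\<lambda>k. B k \<omega>) (\<lambda>k. S k \<omega>) (X 0 \<omega>)"

definition regular_pgf ::
    "'a measure \<Rightarrow> (nat \<Rightarrow> 'a \<Rightarrow> real) \<Rightarrow> (nat \<Rightarrow> 'a \<Rightarrow> nat) \<Rightarrow> (nat \<Rightarrow> 'a \<Rightarrow> real) \<Rightarrow>
      complex \<Rightarrow> complex" where
  "regular_pgf M X B S =
     pgf (steady_state_prob M (regular_cycle X B S) (regular_customers X B S))"

text \<open>The server is busy, i.e. the queue is not empty, with probability \<open>\<rho>\<close>.\<close>

definition regular_busy_pgf ::
    "'a measure \<Rightarrow> real \<Rightarrow> nat pmf \<Rightarrow> real measure \<Rightarrow>
      (nat \<Rightarrow> 'a \<Rightarrow> real) \<Rightarrow> (nat \<Rightarrow> 'a \<Rightarrow> nat) \<Rightarrow> (nat \<Rightarrow> 'a \<Rightarrow> real) \<Rightarrow> complex \<Rightarrow> complex" where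
  "regular_busy_pgf M r b F X B S z =
     (let \<rho> = traffic_intensity r b F
      in (regular_pgf M X B S z - of_real (1 - \<rho>)) / of_real \<rho>)"


section \<open>The queue alternating between vacation and working mode\<close>

text \<open>
  \<open>H\<close> is the information on the vacation mode. This mode has length \<open>V\<close>, with \<open>L t\<close> customers present
  at time \<open>t\<close>; the \<open>L V\<close> customers present at its end are transferred to the working mode. Time in
  \<open>X\<close>, \<open>B\<close> and \<open>S\<close>, the input of the working mode, is counted from the beginning of that mode.
\<close>

locale vacation_queue = MXG1_input M r b F X B S
  for M :: "'a measure" and r :: real and b :: "nat pmf" and F :: "real measure"
    and X :: "nat \<Rightarrow> 'a \<Rightarrow> real" and B :: "nat \<Rightarrow> 'a \<Rightarrow> nat" and S :: "nat \<Rightarrow> 'a \<Rightarrow> real" +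
  fixes H :: "'a measure" and V :: "'a \<Rightarrow> real" and L :: "real \<Rightarrow> 'a \<Rightarrow> nat" and \<psi> :: "nat pmf"
  assumes vacation_info: "subalgebra M H"
    and vacation_length_measurable: "V \<in> borel_measurable H"
    and vacation_length_nonneg: "AE \<omega> in M. 0 \<le> V \<omega>"
    and vacation_customers_measurable:
      "\<And>t. 0 \<le> t \<Longrightarrow> L t \<in> measurable H (count_space UNIV)"
    and transfer_measurable: "(\<lambda>\<omega>. L (V \<omega>) \<omega>) \<in> measurable H (count_space UNIV)"
    and transfer_law: "distr M (count_space UNIV) (\<lambda>\<omega>. L (V \<omega>) \<omega>) = measure_pmf \<psi>"
    and transfer_pos: "0 \<notin> set_pmf \<psi>"
    and vacation_indep:
      "indep_set (sets H)
         (sets (vimage_algebra (space M) (\<lambda>\<omega> i. input X B S i \<omega>) (\<Pi>\<^sub>M i\<in>UNIV. borel)))"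

datatype mode = Vacation | Working

definition vacation_state ::
    "(nat \<Rightarrow> 'a \<Rightarrow> real) \<Rightarrow> (nat \<Rightarrow> 'a \<Rightarrow> nat) \<Rightarrow> (nat \<Rightarrow> 'a \<Rightarrow> real) \<Rightarrow>
      ('a \<Rightarrow> real) \<Rightarrow> (real \<Rightarrow> 'a \<Rightarrow> nat) \<Rightarrow> real \<Rightarrow> 'a \<Rightarrow> mode \<times> nat" where
  "vacation_state X B S V L t \<omega> =
     (if t < V \<omega> then (Vacation, L t \<omega>)
      else (Working, customers (L (V \<omega>) \<omega>) (\<lambda>k. X k \<omega>) (\<lambda>k. B k \<omega>) (\<lambda>k. S k \<omega>) (t - V \<omega>)))"

definition vacation_cycle ::
    "(nat \<Rightarrow> 'a \<Rightarrow> real) \<Rightarrow> (nat \<Rightarrow> 'a \<Rightarrow> nat) \<Rightarrow> (nat \<Rightarrow> 'a \<Rightarrow> real) \<Rightarrow>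
      ('a \<Rightarrow> real) \<Rightarrow> (real \<Rightarrow> 'a \<Rightarrow> nat) \<Rightarrow> 'a \<Rightarrow> ennreal" where
  "vacation_cycle X B S V L \<omega> =
     ennreal (V \<omega>) + empty_time (L (V \<omega>) \<omega>) (\<lambda>k. X k \<omega>) (\<lambda>k. B k \<omega>) (\<lambda>k. S k \<omega>) 0"

definition working_prob ::
    "'a measure \<Rightarrow> (nat \<Rightarrow> 'a \<Rightarrow> real) \<Rightarrow> (nat \<Rightarrow> 'a \<Rightarrow> nat) \<Rightarrow> (nat \<Rightarrow> 'a \<Rightarrow> real) \<Rightarrow>
      ('a \<Rightarrow> real) \<Rightarrow> (real \<Rightarrow> 'a \<Rightarrow> nat) \<Rightarrow> nat \<Rightarrow> real" where
  "working_prob M X B S V L j =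
     steady_state_prob M (vacation_cycle X B S V L) (vacation_state X B S V L) (Working, j)"

definition working_pgf ::
    "'a measure \<Rightarrow> (nat \<Rightarrow> 'a \<Rightarrow> real) \<Rightarrow> (nat \<Rightarrow> 'a \<Rightarrow> nat) \<Rightarrow> (nat \<Rightarrow> 'a \<Rightarrow> real) \<Rightarrow>
      ('a \<Rightarrow> real) \<Rightarrow> (real \<Rightarrow> 'a \<Rightarrow> nat) \<Rightarrow> complex \<Rightarrow> complex" where
  "working_pgf M X B S V L = pgf (\<lambda>j. if j = 0 then 0 else working_prob M X B S V L j)"

definition conditional_working_pgf ::
    "'a measure \<Rightarrow> (nat \<Rightarrow> 'a \<Rightarrow> real) \<Rightarrow> (nat \<Rightarrow> 'a \<Rightarrow> nat) \<Rightarrow> (nat \<Rightarrow> 'a \<Rightarrow> real) \<Rightarrow>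
      ('a \<Rightarrow> real) \<Rightarrow> (real \<Rightarrow> 'a \<Rightarrow> nat) \<Rightarrow> complex \<Rightarrow> complex" where
  "conditional_working_pgf M X B S V L z =
     working_pgf M X B S V L z / of_real (\<Sum>j. working_prob M X B S V L (Suc j))"

end

theory Submission
  imports Defs
begin

text \<open>
  Observe the working mode at service completions. As long as the system is not empty, the number of
  customers is the number at the beginning of the current service plus the arrivals since then, and
  at a completion the remaining gaps, batches and services form, by the memoryless property, a
  fresh copy of the input. Hence the expected time with \<open>j\<close> customers is the convolution of the
  expected number \<open>g\<^sub>n\<close> of services started with \<open>n\<close> customers present and of the expected time
  during one service with \<open>j - n\<close> arrivals. Counting the services that cross a level upwards or
  downwards gives \<open>g(z) (1 - T(z)) = z E[Y] \<Psi>\<^sup>e(z)\<close>, where \<open>T\<close> is the generating function of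
  the tail probabilities of the number of arrivals during a service. The initial number of customers
  thus enters only through \<open>E[Y] \<Psi>\<^sup>e(z)\<close>. A busy period of the regular queue is the same process
  with \<open>Y\<close> replaced by \<open>B\<close>, and the quotient of both expressions is the claim.
\<close>


section \<open>Sample paths and the walk embedded at service completions\<close>

text \<open>A sample path is a triple of initial number, marked arrival sequence and service
  sequence, so the state after one service is again such a triple and every path functional obeys a
  one-step recursion. Expectations are first taken in \<open>ennreal\<close>, where nonnegative sums
  and integrals interchange freely. Finiteness enters through the drift: a service removes one
  customer and brings \<open>\<rho>\<close> new ones on average, so at most
  \<open>E[Y] / (1 - \<rho>)\<close> services are expected. Hence the system almost surely empties
  after finitely many services, and on such paths \<open>emptying\<close> and the measure of
  \<open>occupation\<close> are series of measurable terms.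

  With \<open>A(z)\<close> the generating function of the arrivals during a service, the renewal
  equation alone leads to the factor \<open>z - A(z)\<close>, which vanishes at \<open>z = 1\<close>
  and calls for an argument on its zeros. Counting level crossings amounts to dividing by
  \<open>1 - z\<close> beforehand: the new factor is \<open>1 - T(z)\<close>, and
  \<open>|T(z)| <= T(1) = \<rho> < 1\<close> keeps it away from \<open>0\<close>. The part
  contributed by a single service stays symbolic, as it cancels in the quotient.\<close>

definition epoch :: "(nat \<Rightarrow> real \<times> nat) \<Rightarrow> nat \<Rightarrow> real" where
  "epoch e m = (\<Sum>l<m. fst (e l))"

text \<open>The index of the gap that contains \<open>t\<close>. For \<open>t >= 0\<close> on a
  \<open>proper\<close> path it is the number of batches that have arrived by \<open>t\<close>, a
  batch at time \<open>t\<close> itself included.\<close>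

definition batches :: "(nat \<Rightarrow> real \<times> nat) \<Rightarrow> real \<Rightarrow> nat" where
  "batches e t = (LEAST m. t < epoch e (Suc m))"

definition arrivals :: "(nat \<Rightarrow> real \<times> nat) \<Rightarrow> real \<Rightarrow> nat" where
  "arrivals e t = (\<Sum>l<batches e t. snd (e l))"

text \<open>
  The input seen from time \<open>t\<close>, provided that \<open>m\<close> batches have arrived by then: only the current
  gap is shortened.
\<close>

definition rest_at :: "nat \<Rightarrow> (nat \<Rightarrow> real \<times> nat) \<Rightarrow> real \<Rightarrow> nat \<Rightarrow> real \<times> nat" where
  "rest_at m e t = case_nat (epoch e (Suc m) - t, snd (e m)) (\<lambda>k. e (Suc m + k))"

definition rest :: "(nat \<Rightarrow> real \<times> nat) \<Rightarrow> real \<Rightarrow> nat \<Rightarrow> real \<times> nat" where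
  "rest e t = rest_at (batches e t) e t"

text \<open>The almost sure properties of the input: epochs increase strictly from a positive first
  one, nonempty batches make the \<open>LEAST\<close> in \<open>arrival\<close> attained, and
  unbounded epochs do the same for the \<open>LEAST\<close> in \<open>batches\<close>.\<close>

definition proper :: "(nat \<Rightarrow> real \<times> nat) \<Rightarrow> bool" where
  "proper e \<longleftrightarrow> (\<forall>k. 0 < fst (e k)) \<and> (\<forall>k. 0 < snd (e k)) \<and> (\<forall>t. \<exists>m. t < epoch e m)"

type_synonym state = "nat \<times> (nat \<Rightarrow> real \<times> nat) \<times> (nat \<Rightarrow> real)"

definition advance :: "state \<Rightarrow> state" where
  "advance = (\<lambda>(n, e, s). (n - Suc 0 + arrivals e (s 0), rest e (s 0), \<lambda>k. s (Suc k)))"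

text \<open>The \<open>k\<close>-th iterate evaluates \<open>f\<close> at the state after
  \<open>k\<close> services, with value \<open>0\<close> if the system was empty before one of them
  began.\<close>

definition killed :: "(state \<Rightarrow> ennreal) \<Rightarrow> state \<Rightarrow> ennreal" where
  "killed f z = (if fst z = 0 then 0 else f (advance z))"

definition present :: "state \<Rightarrow> real \<Rightarrow> nat" where
  "present = (\<lambda>(n, e, s). customers n (\<lambda>k. fst (e k)) (\<lambda>k. snd (e k)) s)"

definition emptying :: "state \<Rightarrow> ennreal" where
  "emptying = (\<lambda>(n, e, s). empty_time n (\<lambda>k. fst (e k)) (\<lambda>k. snd (e k)) s 0)"

definition regular_path :: "state \<Rightarrow> bool" where
  "regular_path = (\<lambda>(n, e, s). proper e \<and> (\<forall>k. 0 \<le> s k))"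

definition first_service_time :: "nat \<Rightarrow> state \<Rightarrow> ennreal" where
  "first_service_time j = (\<lambda>(n, e, s). if n = 0 then 0 else
     emeasure lborel {t. 0 \<le> t \<and> t < s 0 \<and> n + arrivals e t = j})"

definition first_service :: "state \<Rightarrow> ennreal" where
  "first_service = (\<lambda>(n, e, s). if n = 0 then 0 else ennreal (s 0))"

lemma epoch_0 [simp]: "epoch e 0 = 0"
  by (simp add: epoch_def)

lemma epoch_Suc: "epoch e (Suc m) = epoch e m + fst (e m)"
  by (simp add: epoch_def)

lemma batch_epoch_eq: "batch_epoch (\<lambda>k. fst (e k)) k = epoch e (Suc k)"
  by (simp add: batch_epoch_def epoch_def lessThan_Suc_atMost)

lemma epoch_mono: "proper e \<Longrightarrow> k \<le> m \<Longrightarrow> epoch e k \<le> epoch e m"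
  by (rule lift_Suc_mono_le[of "epoch e"]) (auto simp: epoch_Suc proper_def less_imp_le)

lemma epoch_nonneg: "proper e \<Longrightarrow> 0 \<le> epoch e m"
  using epoch_mono[of e 0 m] by simp

lemma epoch_Suc_pos: "proper e \<Longrightarrow> 0 < epoch e (Suc m)"
  using epoch_nonneg[of e m] by (auto simp: epoch_Suc proper_def intro: add_nonneg_pos)

lemma less_epoch_batches:
  assumes "proper e"
  shows "t < epoch e (Suc (batches e t))"
proof -
  obtain m where "t < epoch e m"
    using assms unfolding proper_def by blast
  also have "\<dots> \<le> epoch e (Suc m)"
    using assms by (intro epoch_mono) auto
  finally show ?thesis
    unfolding batches_def by (rule LeastI)
qed

lemma epoch_batches_le:
  assumes "0 \<le> t"
  shows "epoch e (batches e t) \<le> t"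
proof (cases "batches e t")
  case (Suc m)
  then have "\<not> t < epoch e (Suc m)"
    unfolding batches_def by (intro not_less_Least) simp
  with Suc show ?thesis by simp
qed (use assms in simp)

lemma batches_eqI:
  assumes "proper e" "epoch e m \<le> t" "t < epoch e (Suc m)"
  shows "batches e t = m"
  unfolding batches_def
proof (rule Least_equality)
  fix k assume "t < epoch e (Suc k)"
  then have "epoch e m < epoch e (Suc k)"
    using assms by simp
  then have "\<not> Suc k \<le> m"
    using epoch_mono[OF assms(1), of "Suc k" m] by linarith
  then show "m \<le> k" by simp
qed (use assms in simp)

lemma epoch_le_iff:
  assumes "proper e" "0 \<le> t"
  shows "epoch e m \<le> t \<longleftrightarrow> m \<le> batches e t"
proof
  assume "epoch e m \<le> t"
  then have "\<not> Suc (batches e t) \<le> m"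
    using epoch_mono[OF assms(1), of "Suc (batches e t)" m] less_epoch_batches[OF assms(1), of t]
    by linarith
  then show "m \<le> batches e t" by simp
next
  assume "m \<le> batches e t"
  then show "epoch e m \<le> t"
    using epoch_mono[OF assms(1)] epoch_batches_le[OF assms(2)] by (meson order_trans)
qed

text \<open>Translates the arrival times of numbered customers into the counting process; all later
  statements on sample paths go through this equivalence.\<close>

lemma arrival_le_iff:
  assumes e: "proper e" and t: "0 \<le> t"
  shows "arrival n (\<lambda>k. fst (e k)) (\<lambda>k. snd (e k)) i \<le> t \<longleftrightarrow> i < n + arrivals e t"
proof (cases "i < n")
  case False
  define P where "P k \<longleftrightarrow> i < n + (\<Sum>l\<le>k. snd (e l))" for k
  \<comment> \<open>Each batch has at least one customer, so the first \<open>k + 1\<close> batches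
    bring more than \<open>k\<close>; hence batch \<open>i\<close> is late enough for customer
    \<open>i\<close>, and the \<open>LEAST\<close> is attained.\<close>
  have ge: "k < (\<Sum>l\<le>k. snd (e l))" for k
  proof -
    have "k < (\<Sum>l\<le>k. (1::nat))" by simp
    also have "\<dots> \<le> (\<Sum>l\<le>k. snd (e l))"
      using e by (intro sum_mono) (auto simp: proper_def Suc_le_eq)
    finally show ?thesis .
  qed
  have "P i"
    using ge[of i] by (simp add: P_def)
  then have PL: "P (LEAST k. P k)"
    by (rule LeastI)
  have "Suc (LEAST k. P k) \<le> batches e t \<longleftrightarrow> i < n + arrivals e t"
  proof
    assume a: "Suc (LEAST k. P k) \<le> batches e t"
    have "(\<Sum>l\<le>(LEAST k. P k). snd (e l)) \<le> arrivals e t"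
      unfolding arrivals_def using a by (intro sum_mono2) auto
    with PL show "i < n + arrivals e t"
      by (simp add: P_def)
  next
    assume a: "i < n + arrivals e t"
    then obtain m where m: "batches e t = Suc m"
      using False by (cases "batches e t") (auto simp: arrivals_def)
    with a have "P m"
      by (simp add: P_def arrivals_def lessThan_Suc_atMost)
    then show "Suc (LEAST k. P k) \<le> batches e t"
      unfolding m by (simp add: Least_le)
  qed
  then show ?thesis
    using False epoch_le_iff[OF e t, of "Suc (LEAST k. P k)"]
    by (simp add: arrival_def batch_epoch_eq P_def)
qed (use t in \<open>simp add: arrival_def\<close>)

lemma arrival_nonneg:
  assumes "proper e"
  shows "0 \<le> arrival n (\<lambda>k. fst (e k)) (\<lambda>k. snd (e k)) i"
  using epoch_nonneg[OF assms] by (simp add: arrival_def batch_epoch_eq)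

lemma epoch_rest_at: "epoch (rest_at m e t) (Suc k) = epoch e (Suc m + k) - t"
  by (induction k) (simp_all add: epoch_Suc rest_at_def)

lemma proper_rest:
  assumes "proper e"
  shows "proper (rest e t)"
  unfolding proper_def
proof (intro conjI allI)
  fix k
  show "0 < fst (rest e t k)" "0 < snd (rest e t k)"
    using assms less_epoch_batches[OF assms, of t]
    by (auto simp: rest_def rest_at_def proper_def split: nat.split)
next
  fix u
  obtain m where m: "t + u < epoch e m"
    using assms unfolding proper_def by blast
  also have "\<dots> \<le> epoch e (Suc (batches e t) + m)"
    using assms by (intro epoch_mono) auto
  finally have "u < epoch (rest e t) (Suc m)"
    unfolding rest_def epoch_rest_at by simp
  then show "\<exists>m. u < epoch (rest e t) m" ..
qed

text \<open>Flow property of the arrivals: shortening the current gap in \<open>rest\<close> is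
  exactly what makes the batch counts before and after \<open>t\<close> add up.\<close>

lemma arrivals_add:
  assumes e: "proper e" and t: "0 \<le> t" "0 \<le> u"
  shows "arrivals e (t + u) = arrivals e t + arrivals (rest e t) u"
proof -
  define N M where "N = batches e t" and "M = batches (rest e t) u"
  have M1: "epoch (rest e t) M \<le> u" "u < epoch (rest e t) (Suc M)"
    using epoch_batches_le[OF t(2)] less_epoch_batches[OF proper_rest[OF e]] by (auto simp: M_def)
  have "batches e (t + u) = N + M"
  proof (rule batches_eqI[OF e])
    show "epoch e (N + M) \<le> t + u"
    proof (cases M)
      case 0
      then show ?thesis using epoch_batches_le[OF t(1), of e] t by (simp add: N_def)
    next
      case (Suc m)
      then show ?thesis
        using M1(1) unfolding rest_def N_def[symmetric] by (simp add: epoch_rest_at)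
    qed
    show "t + u < epoch e (Suc (N + M))"
      using M1(2) unfolding rest_def N_def[symmetric] epoch_rest_at by simp
  qed
  moreover have "(\<Sum>l<N + m. snd (e l)) = (\<Sum>l<N. snd (e l)) + (\<Sum>l<m. snd (rest e t l))" for m
    by (induction m) (auto simp: rest_def N_def[symmetric] rest_at_def split: nat.split)
  ultimately show ?thesis
    by (simp add: arrivals_def N_def[symmetric] M_def[symmetric])
qed

text \<open>After the first service the numbering drops by one. Customers already waiting become
  initial ones and get arrival time \<open>0\<close>, whence the truncation. The two sides are equal
  because they are nonnegative and have the same nonnegative upper bounds.\<close>

lemma arrival_advance:
  assumes e: "proper e" and s: "0 \<le> u" and n: "0 < n"
  shows "arrival (n - Suc 0 + arrivals e u) (\<lambda>k. fst (rest e u k)) (\<lambda>k. snd (rest e u k)) i =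
         max 0 (arrival n (\<lambda>k. fst (e k)) (\<lambda>k. snd (e k)) (Suc i) - u)"
    (is "?a = max 0 (?b - u)")
proof -
  have eq: "?a \<le> t \<longleftrightarrow> max 0 (?b - u) \<le> t" if "0 \<le> t" for t
  proof -
    have "?a \<le> t \<longleftrightarrow> i < n - Suc 0 + arrivals e u + arrivals (rest e u) t"
      using arrival_le_iff[OF proper_rest[OF e] that] by simp
    also have "\<dots> \<longleftrightarrow> Suc i < n + arrivals e (u + t)"
      using n arrivals_add[OF e s that] by auto
    also have "\<dots> \<longleftrightarrow> ?b \<le> u + t"
      using arrival_le_iff[OF e, of "u + t"] s that by simp
    finally show ?thesis using that by auto
  qed
  have "0 \<le> ?a"
    by (rule arrival_nonneg[OF proper_rest[OF e]])
  with eq[of ?a] eq[of "max 0 (?b - u)"] show ?thesis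
    by (intro order_antisym) auto
qed

lemma departure_ge:
  assumes "proper e" "\<forall>k. 0 \<le> s k"
  shows "s 0 \<le> departure n (\<lambda>k. fst (e k)) (\<lambda>k. snd (e k)) s i"
proof (induction i)
  case 0
  show ?case using arrival_nonneg[OF assms(1)] by simp
next
  case (Suc i)
  then show ?case using assms(2) by (simp add: add_increasing2 le_max_iff_disj max.coboundedI2)
qed

text \<open>The recursion for departures commutes with the shift. Truncating arrivals at
  \<open>0\<close> is harmless, since by \<open>departure_ge\<close> the previous departure already
  dominates \<open>s 0\<close>.\<close>

lemma departure_advance:
  assumes e: "proper e" and s: "\<forall>k. 0 \<le> s k" and n: "0 < n"
  shows "s 0 + departure (n - Suc 0 + arrivals e (s 0)) (\<lambda>k. fst (rest e (s 0) k))
           (\<lambda>k. snd (rest e (s 0) k)) (\<lambda>k. s (Suc k)) i =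
         departure n (\<lambda>k. fst (e k)) (\<lambda>k. snd (e k)) s (Suc i)"
proof -
  have s0: "0 \<le> s 0" using s by simp
  show ?thesis
  proof (induction i)
    case 0
    have "arrival n (\<lambda>k. fst (e k)) (\<lambda>k. snd (e k)) 0 = 0"
      using n by (simp add: arrival_def)
    then show ?case
      using s0 by (simp add: arrival_advance[OF e s0 n] max_def)
  next
    case (Suc i)
    then show ?case
      using departure_ge[OF e s, of n "Suc i"]
      by (simp add: arrival_advance[OF e s0 n])
  qed
qed

lemma customers_advance:
  assumes e: "proper e" and s: "\<forall>k. 0 \<le> s k" and n: "0 < n" and t: "0 \<le> t"
  shows "present (n, e, s) (s 0 + t) = present (advance (n, e, s)) t"
proof -
  have s0: "0 \<le> s 0" using s by simp
  define a d where "a = arrival n (\<lambda>k. fst (e k)) (\<lambda>k. snd (e k))"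
    and "d = departure n (\<lambda>k. fst (e k)) (\<lambda>k. snd (e k)) s"
  have d0: "d 0 = s 0"
    using n by (simp add: d_def arrival_def)
  have "{i. a i \<le> s 0 + t \<and> s 0 + t < d i} = Suc ` {i. a (Suc i) \<le> s 0 + t \<and> s 0 + t < d (Suc i)}"
    (is "?A = Suc ` ?B")
  proof (intro equalityI subsetI)
    fix i assume i: "i \<in> ?A"
    with d0 t obtain k where "i = Suc k" by (cases i) auto
    with i show "i \<in> Suc ` ?B" by auto
  qed auto
  then have "card ?A = card ?B"
    by (simp add: card_image)
  also have "?B = {i. max 0 (a (Suc i) - s 0) \<le> t \<and> t < d (Suc i) - s 0}"
    using t by auto
  finally show ?thesis
    using departure_advance[OF e s n, symmetric]
    by (simp add: present_def advance_def customers_def a_def d_def arrival_advance[OF e s0 n])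
qed

text \<open>No departure occurs before \<open>s 0\<close>, so everybody who has arrived is still
  present.\<close>

lemma customers_first_service:
  assumes e: "proper e" and s: "\<forall>k. 0 \<le> s k" and t: "0 \<le> t" "t < s 0"
  shows "present (n, e, s) t = n + arrivals e t"
proof -
  have "{i. arrival n (\<lambda>k. fst (e k)) (\<lambda>k. snd (e k)) i \<le> t \<and>
            t < departure n (\<lambda>k. fst (e k)) (\<lambda>k. snd (e k)) s i} = {..<n + arrivals e t}"
    using arrival_le_iff[OF e t(1)] departure_ge[OF e s] t by (fastforce intro: less_le_trans)
  then show ?thesis
    by (simp add: present_def customers_def)
qed

lemma emptying_eq: "emptying z = (INF t\<in>{t. 0 \<le> t \<and> present z t = 0}. ennreal t)"
  by (simp add: emptying_def present_def empty_time_def split: prod.split)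

lemma emptying_0:
  assumes "proper e"
  shows "emptying (0, e, s) = 0"
proof -
  have "batches e 0 = 0"
    using assms by (intro batches_eqI) (auto simp: epoch_Suc_pos)
  then have "present (0, e, s) 0 = 0"
    using arrival_le_iff[OF assms, of 0 0] by (simp add: present_def customers_def arrivals_def)
  then have "emptying (0, e, s) \<le> ennreal 0"
    unfolding emptying_eq by (intro INF_lower) auto
  then show ?thesis by simp
qed

lemma empty_times_advance:
  assumes e: "proper e" and s: "\<forall>k. 0 \<le> s k" and n: "0 < n"
  shows "{t. 0 \<le> t \<and> present (n, e, s) t = 0} =
         (\<lambda>t. s 0 + t) ` {t. 0 \<le> t \<and> present (advance (n, e, s)) t = 0}"
    (is "?A = (\<lambda>t. s 0 + t) ` ?B")
proof -
  have s0: "0 \<le> s 0" using s by simp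
  show ?thesis
  proof (intro equalityI subsetI)
    fix t assume t: "t \<in> ?A"
    then have "s 0 \<le> t"
      using customers_first_service[OF e s, of t n] n by (cases "t < s 0") auto
    then have "t - s 0 \<in> ?B" "t = s 0 + (t - s 0)"
      using t customers_advance[OF e s n, of "t - s 0"] by auto
    then show "t \<in> (\<lambda>t. s 0 + t) ` ?B" by blast
  qed (use s0 customers_advance[OF e s n] in auto)
qed

text \<open>Addition is monotone and continuous, hence commutes with the infimum of a nonempty set;
  on the empty set both sides are \<open>top\<close>.\<close>

lemma INF_add_left_ennreal:
  fixes f :: "'a \<Rightarrow> ennreal"
  shows "(INF x\<in>A. c + f x) = c + (INF x\<in>A. f x)"
proof (cases "A = {}")
  case False
  then show ?thesis
    using continuous_at_Inf_mono[of "\<lambda>x. c + x" "f ` A"]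
      continuous_add[of "at_right (Inf (f ` A))" "\<lambda>x. c" "\<lambda>x. x"]
    by (auto simp: mono_def image_comp)
qed (simp add: top_add)

lemma emptying_advance:
  assumes e: "proper e" and s: "\<forall>k. 0 \<le> s k" and n: "0 < n"
  shows "emptying (n, e, s) = ennreal (s 0) + emptying (advance (n, e, s))"
proof -
  define B where "B = {t. 0 \<le> t \<and> present (advance (n, e, s)) t = 0}"
  have "emptying (n, e, s) = (INF t\<in>B. ennreal (s 0 + t))"
    unfolding emptying_eq empty_times_advance[OF e s n] image_image B_def ..
  also have "\<dots> = (INF t\<in>B. ennreal (s 0) + ennreal t)"
    using s by (intro INF_cong) (auto simp: B_def ennreal_plus)
  also have "\<dots> = ennreal (s 0) + (INF t\<in>B. ennreal t)"
    by (rule INF_add_left_ennreal)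
  finally show ?thesis
    by (simp add: emptying_eq B_def)
qed

text \<open>During the first service the system cannot be empty, so the bound by
  \<open>emptying\<close> is automatic there; afterwards the path is that of \<open>advance\<close>,
  delayed by \<open>s 0\<close>.\<close>

lemma occupation_advance:
  assumes e: "proper e" and s: "\<forall>k. 0 \<le> s k" and n: "0 < n"
  shows "{t. 0 \<le> t \<and> ennreal t < emptying (n, e, s) \<and> present (n, e, s) t = j} =
         {t. 0 \<le> t \<and> t < s 0 \<and> n + arrivals e t = j} \<union>
         (\<lambda>t. s 0 + t) ` {t. 0 \<le> t \<and> ennreal t < emptying (advance (n, e, s)) \<and> present (advance (n, e, s)) t = j}"
    (is "?A = ?C \<union> (\<lambda>t. s 0 + t) ` ?B")
proof -
  have s0: "0 \<le> s 0" using s by simp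
  show ?thesis
  proof (intro equalityI subsetI)
    fix t assume t: "t \<in> ?A"
    show "t \<in> ?C \<union> (\<lambda>t. s 0 + t) ` ?B"
    proof (cases "t < s 0")
      case True
      then show ?thesis using t customers_first_service[OF e s, of t n] by auto
    next
      case False
      define u where "u = t - s 0"
      have u: "0 \<le> u" "t = s 0 + u"
        using False by (auto simp: u_def)
      have "ennreal (s 0) + ennreal u < ennreal (s 0) + emptying (advance (n, e, s))"
        using t u s0 by (simp add: emptying_advance[OF e s n])
      then have "u \<in> ?B"
        using t u customers_advance[OF e s n u(1)] by (auto simp: ennreal_add_left_cancel_less)
      then show ?thesis using u by blast
    qed
  next
    fix t assume "t \<in> ?C \<union> (\<lambda>t. s 0 + t) ` ?B"
    then show "t \<in> ?A"
    proof
      assume t: "t \<in> ?C"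
      then have "ennreal t < ennreal (s 0)"
        by (simp add: ennreal_lessI)
      also have "\<dots> \<le> emptying (n, e, s)"
        by (simp add: emptying_advance[OF e s n])
      finally show ?thesis
        using t customers_first_service[OF e s, of t n] by simp
    next
      assume "t \<in> (\<lambda>t. s 0 + t) ` ?B"
      then obtain u where u: "t = s 0 + u" "u \<in> ?B" by blast
      then have "ennreal t < emptying (n, e, s)"
        using s0 by (simp add: emptying_advance[OF e s n] ennreal_add_left_cancel_less)
      then show ?thesis
        using u s0 customers_advance[OF e s n, of u] by simp
    qed
  qed
qed

section \<open>Path functionals as finite sums over services\<close>

definition alive :: "state \<Rightarrow> ennreal" where
  "alive z = (if fst z = 0 then 0 else 1)"

definition occupation :: "nat \<Rightarrow> state \<Rightarrow> real set" where
  "occupation j z = {t. 0 \<le> t \<and> ennreal t < emptying z \<and> present z t = j}"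

text \<open>The hypothesis \<open>(killed ^^ k) alive z = 0\<close> expresses that the walk from
  \<open>z\<close> meets an empty state within \<open>k\<close> services. It is inherited by
  \<open>advance z\<close> with \<open>k - 1\<close>, which drives the inductions below.\<close>

lemma killed_pow_dead:
  assumes "(killed ^^ k) alive z = 0" and f: "\<And>z. fst z = 0 \<Longrightarrow> f z = 0"
  shows "(killed ^^ (k + m)) f z = 0"
  using assms(1)
proof (induction k arbitrary: z)
  case 0
  then show ?case
    using f by (cases m) (auto simp: alive_def killed_def split: if_splits)
next
  case (Suc k)
  then show ?case by (auto simp: killed_def split: if_splits)
qed

lemma suminf_killed_dead:
  assumes "(killed ^^ k) alive z = 0" and f: "\<And>z. fst z = 0 \<Longrightarrow> f z = 0"
  shows "(\<Sum>i. (killed ^^ i) f z) = (\<Sum>i<k. (killed ^^ i) f z)"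
proof (rule suminf_finite)
  fix i assume "i \<notin> {..<k}"
  then obtain m where "i = k + m" by (auto simp: not_less le_iff_add)
  then show "(killed ^^ i) f z = 0" using killed_pow_dead[OF assms] by simp
qed simp

lemma regular_path_advance: "regular_path z \<Longrightarrow> regular_path (advance z)"
  by (auto simp: regular_path_def advance_def proper_rest split: prod.splits)

lemma sum_killed_Suc:
  "(\<Sum>i<Suc k. (killed ^^ i) f z) =
     f z + (if fst z = 0 then 0 else \<Sum>i<k. (killed ^^ i) f (advance z))"
  by (simp add: sum.lessThan_Suc_shift killed_def del: sum.lessThan_Suc)

text \<open>Unrolling \<open>emptying_advance\<close> stops after at most \<open>k\<close> steps at
  an empty state, where \<open>emptying_0\<close> closes the sum.\<close>

lemma emptying_eq_sum:
  assumes "regular_path z" "(killed ^^ k) alive z = 0"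
  shows "emptying z = (\<Sum>i<k. (killed ^^ i) first_service z)"
  using assms
proof (induction k arbitrary: z)
  case 0
  then show ?case
    by (cases z) (auto simp: alive_def regular_path_def emptying_0 split: if_splits)
next
  case (Suc k)
  obtain n e s where z: "z = (n, e, s)" by (cases z)
  show ?case
  proof (cases "n = 0")
    case True
    then show ?thesis
      using Suc.prems by (simp add: z sum_killed_Suc regular_path_def emptying_0 first_service_def
        del: sum.lessThan_Suc)
  next
    case False
    then have "(killed ^^ k) alive (advance z) = 0"
      using Suc.prems by (simp add: killed_def[of "(killed ^^ k) alive"] z)
    note IH = Suc.IH[OF regular_path_advance[OF Suc.prems(1)] this]
    show ?thesis
      using False IH Suc.prems(1)
      by (simp add: z sum_killed_Suc regular_path_def emptying_advance first_service_def
        del: sum.lessThan_Suc)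
  qed
qed

section \<open>Measurability of the path functionals and measures of occupation sets\<close>

abbreviation env_space :: "(nat \<Rightarrow> real \<times> nat) measure" where
  "env_space \<equiv> \<Pi>\<^sub>M i\<in>UNIV. borel \<Otimes>\<^sub>M count_space UNIV"

lemma measurable_batches [measurable]:
  assumes [measurable]: "E \<in> N \<rightarrow>\<^sub>M env_space" "T \<in> borel_measurable N"
  shows "(\<lambda>\<omega>. batches (E \<omega>) (T \<omega>)) \<in> N \<rightarrow>\<^sub>M count_space UNIV"
  unfolding batches_def epoch_def by measurable

lemma measurable_arrivals [measurable]:
  assumes [measurable]: "E \<in> N \<rightarrow>\<^sub>M env_space" "T \<in> borel_measurable N"
  shows "(\<lambda>\<omega>. arrivals (E \<omega>) (T \<omega>)) \<in> N \<rightarrow>\<^sub>M count_space UNIV"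
  unfolding arrivals_def
  by (rule measurable_compose_countable[OF _ measurable_batches[OF assms]]) measurable

lemma measurable_arrivals_time [measurable]: "(\<lambda>t. arrivals e t) \<in> borel \<rightarrow>\<^sub>M count_space UNIV"
proof -
  have e: "(\<lambda>_. e) \<in> borel \<rightarrow>\<^sub>M env_space"
    by (auto simp: space_PiM space_pair_measure)
  show ?thesis
    by (rule measurable_arrivals[OF e]) simp
qed

lemma sets_first_service: "{t. 0 \<le> t \<and> t < u \<and> n + arrivals e t = j} \<in> sets lborel"
  by simp

lemma image_plus_measurable:
  fixes A :: "real set"
  assumes "A \<in> sets lborel"
  shows "(\<lambda>t. c + t) ` A \<in> sets lborel" "emeasure lborel ((\<lambda>t. c + t) ` A) = emeasure lborel A"
proof -
  have A: "(\<lambda>t. c + t) ` A = ((+) (- c)) -` A"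
    by force
  show "(\<lambda>t. c + t) ` A \<in> sets lborel"
    unfolding A using measurable_sets[of "(+) (- c)" lborel lborel A] assms by simp
  have "emeasure lborel A = emeasure (distr lborel borel ((+) (- c))) A"
    by (simp add: lborel_distr_plus)
  also have "\<dots> = emeasure lborel ((\<lambda>t. c + t) ` A)"
    unfolding A using assms by (subst emeasure_distr) auto
  finally show "emeasure lborel ((\<lambda>t. c + t) ` A) = emeasure lborel A" ..
qed

text \<open>Measurability and measure are proved together: \<open>emptying\<close> is an infimum
  over uncountably many times, and it is the decomposition into finitely many pieces, one per
  service, that exhibits the set as Borel.\<close>

lemma occupation_eq_sum:
  assumes "regular_path z" "(killed ^^ k) alive z = 0"
  shows "occupation j z \<in> sets lborel \<and>
    emeasure lborel (occupation j z) = (\<Sum>i<k. (killed ^^ i) (first_service_time j) z)"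
  using assms
proof (induction k arbitrary: z)
  case 0
  then have "occupation j z = {}"
    by (cases z) (auto simp: alive_def regular_path_def emptying_0 occupation_def split: if_splits)
  then show ?case by simp
next
  case (Suc k)
  obtain n e s where z: "z = (n, e, s)" by (cases z)
  show ?case
  proof (cases "n = 0")
    case True
    then have "occupation j z = {}"
      using Suc.prems by (auto simp: z regular_path_def emptying_0 occupation_def)
    then show ?thesis
      using True by (simp add: z sum_killed_Suc first_service_time_def del: sum.lessThan_Suc)
  next
    case False
    define C where "C = {t. 0 \<le> t \<and> t < s 0 \<and> n + arrivals e t = j}"
    define O' where "O' = occupation j (advance z)"
    have "(killed ^^ k) alive (advance z) = 0"
      using Suc.prems False by (simp add: killed_def[of "(killed ^^ k) alive"] z)
    note IH = Suc.IH[OF regular_path_advance[OF Suc.prems(1)] this, folded O'_def]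
    have eq: "occupation j z = C \<union> (\<lambda>t. s 0 + t) ` O'"
      using Suc.prems(1) False occupation_advance[of e s n j]
      by (simp add: z occupation_def C_def O'_def regular_path_def)
    have C: "C \<in> sets lborel"
      unfolding C_def by (rule sets_first_service)
    have disj: "C \<inter> (\<lambda>t. s 0 + t) ` O' = {}"
      by (auto simp: C_def O'_def occupation_def)
    have "emeasure lborel (occupation j z) = emeasure lborel C + emeasure lborel O'"
      unfolding eq using C IH image_plus_measurable[of O' "s 0"] disj
      by (subst plus_emeasure[symmetric]) auto
    also have "emeasure lborel C = first_service_time j z"
      using False by (simp add: first_service_time_def z C_def)
    finally show ?thesis
      using IH C False image_plus_measurable[of O' "s 0"] unfolding eq
      by (auto simp add: sum_killed_Suc z simp del: sum.lessThan_Suc)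
  qed
qed

lemma emptying_eq_suminf:
  assumes "regular_path z" "(killed ^^ k) alive z = 0"
  shows "emptying z = (\<Sum>i. (killed ^^ i) first_service z)"
  using emptying_eq_sum[OF assms]
  by (subst suminf_killed_dead[OF assms(2)]) (auto simp: first_service_def)

lemma occupation_eq_suminf:
  assumes "regular_path z" "(killed ^^ k) alive z = 0"
  shows "emeasure lborel (occupation j z) = (\<Sum>i. (killed ^^ i) (first_service_time j) z)"
  using occupation_eq_sum[OF assms]
  by (subst suminf_killed_dead[OF assms(2)]) (auto simp: first_service_time_def)


section \<open>Generating functions and the renewal equation\<close>

text \<open>Read \<open>\<gamma> v\<close> as the expected number of services started with
  \<open>v + 1\<close> customers. Steps down from \<open>w + 1\<close> to \<open>w\<close> number
  \<open>\<gamma> w * \<beta> 0\<close>; they balance the starts above \<open>w\<close> and the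
  services with \<open>v < w\<close> that jump above \<open>w\<close>. Adding
  \<open>\<gamma> w * (1 - \<beta> 0)\<close>, the term \<open>v = w\<close>, to both sides gives
  the claim. Formally, the renewal equation is the difference of two consecutive cut
  equations.\<close>

lemma renewal_cut_equation:
  fixes a \<beta> \<gamma> :: "nat \<Rightarrow> real"
  assumes "a 0 = 0" "\<gamma> 0 * \<beta> 0 = 1"
    and \<gamma>: "\<And>w. \<gamma> w = a (Suc w) + (\<Sum>v\<le>Suc w. \<gamma> v * \<beta> (Suc w - v))"
  shows "\<gamma> w = (1 - (\<Sum>i\<le>w. a i)) + (\<Sum>v\<le>w. \<gamma> v * (1 - (\<Sum>l\<le>w - v. \<beta> l)))"
proof (induction w)
  case 0
  show ?case using assms(1,2) by (simp add: algebra_simps)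
next
  case (Suc w)
  have "(\<Sum>v\<le>Suc w. \<gamma> v * (1 - (\<Sum>l\<le>Suc w - v. \<beta> l))) =
      (\<Sum>v\<le>w. \<gamma> v * (1 - (\<Sum>l\<le>Suc w - v. \<beta> l))) + \<gamma> (Suc w) * (1 - \<beta> 0)"
    by simp
  also have "(\<Sum>v\<le>w. \<gamma> v * (1 - (\<Sum>l\<le>Suc w - v. \<beta> l))) =
      (\<Sum>v\<le>w. \<gamma> v * (1 - (\<Sum>l\<le>w - v. \<beta> l)) - \<gamma> v * \<beta> (Suc w - v))"
    by (intro sum.cong) (auto simp: Suc_diff_le algebra_simps)
  also have "\<dots> = (\<Sum>v\<le>w. \<gamma> v * (1 - (\<Sum>l\<le>w - v. \<beta> l))) - (\<Sum>v\<le>w. \<gamma> v * \<beta> (Suc w - v))"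
    by (simp add: sum_subtractf)
  also have "(\<Sum>v\<le>w. \<gamma> v * \<beta> (Suc w - v)) = \<gamma> w - a (Suc w) - \<gamma> (Suc w) * \<beta> 0"
    using \<gamma>[of w] by simp
  finally show ?case
    using Suc.IH by (simp add: algebra_simps)
qed

text \<open>For a probability sequence this is the probability of exceeding \<open>i\<close>.
  Written with a finite sum, it allows the cut equation to be proved without any
  convergence.\<close>

definition tail :: "(nat \<Rightarrow> real) \<Rightarrow> nat \<Rightarrow> real" where
  "tail q i = 1 - (\<Sum>l\<le>i. q l)"

lemma tail_nonneg:
  assumes "\<And>i. 0 \<le> q i" "q sums 1"
  shows "0 \<le> tail q i"
  using sum_le_suminf[of q "{..i}"] assms by (auto simp: tail_def sums_iff)

text \<open>The mean is the sum of the tails: in the double sum over \<open>i < l\<close> each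
  \<open>q l\<close> occurs \<open>l\<close> times, and in \<open>ennreal\<close> the order of
  summation is free.\<close>

lemma tail_sums:
  assumes q: "\<And>i. 0 \<le> q i" "q sums 1" and m: "(\<lambda>l. real l * q l) sums m"
  shows "tail q sums m"
proof -
  have t: "ennreal (tail q i) = (\<Sum>l. if i < l then ennreal (q l) else 0)" for i
  proof -
    have s: "(\<lambda>l. q (l + Suc i)) sums tail q i"
      using q(2) sums_iff_shift[of q "Suc i" "tail q i"] by (simp add: tail_def lessThan_Suc_atMost)
    have "(\<Sum>l. if i < l then ennreal (q l) else 0) = (\<Sum>l. ennreal (q (l + Suc i)))"
      by (subst suminf_offset[of _ "Suc i"]) auto
    also have "\<dots> = ennreal (tail q i)"
      using q(1) s by (intro suminf_ennreal_eq) auto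
    finally show ?thesis ..
  qed
  have "(\<Sum>i. ennreal (tail q i)) = (\<Sum>l. \<Sum>i. if i < l then ennreal (q l) else 0)"
    unfolding t using nn_integral_suminf[of "\<lambda>l i. if i < l then ennreal (q l) else 0" "count_space UNIV"]
    by (simp add: nn_integral_count_space_nat)
  also have "\<dots> = (\<Sum>l. ennreal (real l * q l))"
  proof (intro suminf_cong)
    fix l
    have "(\<Sum>i. if i < l then ennreal (q l) else 0) = (\<Sum>i<l. ennreal (q l))"
      by (subst suminf_finite[of "{..<l}"]) auto
    also have "\<dots> = ennreal (real l * q l)"
      using q(1) by (simp add: ennreal_mult ennreal_of_nat_eq_real_of_nat)
    finally show "(\<Sum>i. if i < l then ennreal (q l) else 0) = ennreal (real l * q l)" .
  qed
  also have "\<dots> = ennreal m"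
    using q(1) m by (intro suminf_ennreal_eq) auto
  finally have eq: "(\<Sum>i. ennreal (tail q i)) = ennreal m" .
  have s: "summable (tail q)"
    using tail_nonneg[OF q] eq by (intro summable_suminf_not_top) auto
  have m0: "0 \<le> m"
    by (rule sums_le[OF _ sums_zero m]) (simp add: q(1))
  have "ennreal (\<Sum>i. tail q i) = ennreal m"
    using suminf_ennreal2[OF tail_nonneg[OF q] s] eq by simp
  then show ?thesis
    using s m0 suminf_nonneg[OF s] tail_nonneg[OF q] by (simp add: sums_iff)
qed

section \<open>Power series with nonnegative summable coefficients\<close>

lemma pgf_term_le:
  fixes z :: complex
  assumes "0 \<le> p n" "norm z \<le> 1"
  shows "norm (of_real (p n) * z ^ n) \<le> p n"
  using mult_left_le[OF power_le_one[of "norm z" n], of "p n"] assms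
  by (simp add: norm_mult norm_power)

lemma summable_norm_pgf:
  fixes z :: complex
  assumes "\<And>n. 0 \<le> p n" "summable p" "norm z \<le> 1"
  shows "summable (\<lambda>n. norm (of_real (p n) * z ^ n))"
  using pgf_term_le[of p _ z] assms by (intro summable_comparison_test'[OF assms(2)]) auto

lemma summable_pgf:
  fixes z :: complex
  assumes "\<And>n. 0 \<le> p n" "summable p" "norm z \<le> 1"
  shows "summable (\<lambda>n. of_real (p n) * z ^ n)"
  using summable_norm_pgf[OF assms] by (rule summable_norm_cancel)

lemma norm_pgf_le:
  assumes "\<And>n. 0 \<le> p n" "summable p" "norm z \<le> 1"
  shows "norm (pgf p z) \<le> suminf p"
proof -
  have "norm (pgf p z) \<le> (\<Sum>n. norm (of_real (p n) * z ^ n))"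
    unfolding pgf_def by (rule summable_norm[OF summable_norm_pgf[OF assms]])
  also have "\<dots> \<le> suminf p"
    using assms by (intro suminf_le summable_norm_pgf pgf_term_le) auto
  finally show ?thesis .
qed

lemma pgf_one: "summable p \<Longrightarrow> pgf p 1 = of_real (suminf p)"
  by (simp add: pgf_def suminf_of_real)

lemma pgf_mult:
  assumes "\<And>n. 0 \<le> p n" "summable p" "\<And>n. 0 \<le> q n" "summable q" "norm z \<le> 1"
  shows "pgf p z * pgf q z = pgf (\<lambda>n. \<Sum>i\<le>n. p i * q (n - i)) z"
proof -
  have "pgf p z * pgf q z = (\<Sum>n. \<Sum>i\<le>n. (of_real (p i) * z ^ i) * (of_real (q (n - i)) * z ^ (n - i)))"
    unfolding pgf_def using assms by (intro Cauchy_product summable_norm_pgf)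
  also have "\<dots> = pgf (\<lambda>n. \<Sum>i\<le>n. p i * q (n - i)) z"
    unfolding pgf_def of_real_sum sum_distrib_right
    by (intro suminf_cong sum.cong refl) (simp add: mult.assoc mult.left_commute power_add[symmetric])
  finally show ?thesis .
qed

lemma pgf_cmult:
  fixes z :: complex
  assumes "\<And>n. 0 \<le> p n" "summable p" "norm z \<le> 1"
  shows "pgf (\<lambda>n. c * p n) z = of_real c * pgf p z"
  using suminf_mult[OF summable_pgf[OF assms], of "of_real c"] by (simp add: pgf_def mult.assoc)

lemma pgf_shift:
  fixes z :: complex
  assumes "\<And>n. 0 \<le> p n" "summable p" "norm z \<le> 1"
  shows "pgf p z = of_real (p 0) + z * pgf (\<lambda>n. p (Suc n)) z"
proof -
  have "summable (\<lambda>n. p (Suc n))"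
    using assms(2) by (simp add: summable_Suc_iff)
  from suminf_mult[OF summable_pgf[OF _ this assms(3)], of z]
  have "z * pgf (\<lambda>n. p (Suc n)) z = (\<Sum>n. of_real (p (Suc n)) * z ^ Suc n)"
    using assms(1) by (simp add: pgf_def mult.left_commute)
  then show ?thesis
    using suminf_split_head[OF summable_pgf[OF assms]] by (simp add: pgf_def)
qed

text \<open>Here \<open>a\<close> is the law of the initial number and \<open>\<beta>\<close> that
  of the arrivals during a service. The sum in the cut equation is a convolution, so it becomes a
  product of generating functions; finite means make the tails summable.\<close>

lemma pgf_renewal:
  fixes a \<beta> \<gamma> :: "nat \<Rightarrow> real"
  assumes a: "\<And>i. 0 \<le> a i" "a sums 1" "(\<lambda>l. real l * a l) sums m" "a 0 = 0"
    and \<beta>: "\<And>i. 0 \<le> \<beta> i" "\<beta> sums 1" "(\<lambda>l. real l * \<beta> l) sums \<rho>"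
    and \<gamma>: "\<And>i. 0 \<le> \<gamma> i" "summable \<gamma>" "\<gamma> 0 * \<beta> 0 = 1"
      "\<And>w. \<gamma> w = a (Suc w) + (\<Sum>v\<le>Suc w. \<gamma> v * \<beta> (Suc w - v))"
    and z: "norm z \<le> 1"
  shows "pgf \<gamma> z * (1 - pgf (tail \<beta>) z) = pgf (tail a) z"
proof -
  have ta: "tail a sums m" and tb: "tail \<beta> sums \<rho>"
    using tail_sums a \<beta> by blast+
  have "\<gamma> w = tail a w + (\<Sum>i\<le>w. \<gamma> i * tail \<beta> (w - i))" for w
    unfolding tail_def by (rule renewal_cut_equation[of a \<gamma> \<beta> w, OF a(4) \<gamma>(3) \<gamma>(4)])
  then have conv: "(\<Sum>i\<le>w. \<gamma> i * tail \<beta> (w - i)) = \<gamma> w - tail a w" for w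
    by (metis add_diff_cancel_left')
  have "pgf \<gamma> z * pgf (tail \<beta>) z = pgf (\<lambda>w. \<gamma> w - tail a w) z"
    using pgf_mult[of \<gamma> "tail \<beta>" z, OF \<gamma>(1,2) tail_nonneg[OF \<beta>(1,2)] _ z] tb
    unfolding conv by (simp add: sums_iff)
  also have "\<dots> = pgf \<gamma> z - pgf (tail a) z"
    using suminf_diff[OF summable_pgf[OF \<gamma>(1,2) z] summable_pgf[of "tail a" z]]
      tail_nonneg[OF a(1,2)] ta z by (simp add: pgf_def sums_iff algebra_simps)
  finally show ?thesis by (simp add: algebra_simps)
qed

text \<open>Consecutive tails differ by one coefficient,
  \<open>tail q n - tail q (Suc n) = q (Suc n)\<close>.\<close>

lemma pgf_tail:
  assumes q: "\<And>i. 0 \<le> q i" "q sums 1" "(\<lambda>l. real l * q l) sums m" and z: "norm z \<le> 1"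
  shows "(1 - z) * pgf (tail q) z = 1 - pgf q z"
proof -
  note t = tail_nonneg[OF q(1,2)] tail_sums[OF q]
  have st: "summable (tail q)" and sq: "summable q"
    using t q by (auto simp: sums_iff)
  have S: "summable (\<lambda>n. q (Suc n))" "summable (\<lambda>n. tail q (Suc n))"
    using st sq by (simp_all add: summable_Suc_iff)
  have "pgf (tail q) z = of_real (tail q 0) + z * pgf (\<lambda>n. tail q (Suc n)) z"
    by (rule pgf_shift[OF t(1) st z])
  also have "(\<lambda>n. tail q (Suc n)) = (\<lambda>n. tail q n - q (Suc n))"
    by (simp add: tail_def algebra_simps)
  also have "pgf (\<lambda>n. tail q n - q (Suc n)) z = pgf (tail q) z - pgf (\<lambda>n. q (Suc n)) z"
    using suminf_diff[OF summable_pgf[OF t(1) st z] summable_pgf[OF q(1) S(1) z]]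
    by (simp add: pgf_def algebra_simps)
  finally show ?thesis
    using pgf_shift[OF q(1) sq z] by (simp add: tail_def[of q 0] algebra_simps)
qed

text \<open>A zero would force \<open>pgf q z = 1\<close>, whereas \<open>q 0 = 0\<close> lets a
  factor \<open>z\<close> be taken out and bounds the norm by \<open>norm z < 1\<close>. This
  justifies dividing by \<open>equilibrium_pgf b z\<close>.\<close>

lemma pgf_tail_nonzero:
  assumes q: "\<And>i. 0 \<le> q i" "q sums 1" "(\<lambda>l. real l * q l) sums m" "q 0 = 0" and z: "norm z < 1"
  shows "pgf (tail q) z \<noteq> 0"
proof
  assume 0: "pgf (tail q) z = 0"
  have sq: "summable q" "summable (\<lambda>n. q (Suc n))"
    using q by (auto simp: sums_iff summable_Suc_iff)
  have "1 = pgf q z"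
    using pgf_tail[OF q(1-3), of z] z 0 by simp
  also have "\<dots> = z * pgf (\<lambda>n. q (Suc n)) z"
    using pgf_shift[OF q(1) sq(1), of z] z q(4) by simp
  finally have "1 = norm z * norm (pgf (\<lambda>n. q (Suc n)) z)"
    by (metis norm_mult norm_one)
  also have "\<dots> \<le> norm z * 1"
    using norm_pgf_le[OF q(1) sq(2), of z] z suminf_split_head[OF sq(1)] q(2,4)
    by (intro mult_left_mono) (auto simp: sums_iff)
  finally show False using z by simp
qed

section \<open>Mass functions and equilibrium distributions\<close>

lemma pmf_sums: "pmf (p :: nat pmf) sums 1"
proof -
  have "(\<Sum>n. ennreal (pmf p n)) = (\<integral>\<^sup>+n. 1 \<partial>measure_pmf p)"
    by (simp add: nn_integral_measure_pmf nn_integral_count_space_nat del: nn_integral_const)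
  then have 1: "(\<Sum>n. ennreal (pmf p n)) = 1"
    by (simp add: measure_pmf.emeasure_space_1)
  then have s: "summable (pmf p)"
    by (intro summable_suminf_not_top) auto
  have "ennreal (\<Sum>n. pmf p n) = 1"
    using 1 suminf_ennreal2[OF pmf_nonneg s] by simp
  with s show ?thesis
    by (simp add: sums_iff)
qed

lemma pmf_expectation_sums:
  assumes "integrable (measure_pmf p) real"
  shows "(\<lambda>n. real n * pmf p n) sums measure_pmf.expectation p real"
proof -
  have "ennreal (measure_pmf.expectation p real) = (\<integral>\<^sup>+n. ennreal (real n) \<partial>measure_pmf p)"
    using assms by (simp add: nn_integral_eq_integral)
  also have "\<dots> = (\<Sum>n. ennreal (real n * pmf p n))"
    by (simp add: nn_integral_measure_pmf nn_integral_count_space_nat ennreal_mult mult.commute)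
  finally have eq: "(\<Sum>n. ennreal (real n * pmf p n)) = ennreal (measure_pmf.expectation p real)" ..
  have s: "summable (\<lambda>n. real n * pmf p n)"
    using eq by (intro summable_suminf_not_top) auto
  have "ennreal (\<Sum>n. real n * pmf p n) = ennreal (measure_pmf.expectation p real)"
    using suminf_ennreal2[OF _ s] eq by simp
  then show ?thesis
    using s suminf_nonneg[OF s] by (simp add: sums_iff)
qed

lemma tail_pmf: "measure_pmf.prob p {i<..} = tail (pmf p) i" for p :: "nat pmf"
proof -
  have "{i<..} = UNIV - {..i}" by auto
  then have "measure_pmf.prob p {i<..} = 1 - measure_pmf.prob p {..i}"
    using measure_pmf.prob_compl[of "{..i}" p] by simp
  then show ?thesis
    by (simp add: measure_measure_pmf_finite tail_def)
qed

lemma expectation_pos: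
  assumes "0 \<notin> set_pmf p" "integrable (measure_pmf p) real"
  shows "1 \<le> measure_pmf.expectation p real"
proof -
  have "measure_pmf.expectation p (\<lambda>_. 1) \<le> measure_pmf.expectation p real"
    using assms by (intro integral_mono_AE) (auto simp: AE_measure_pmf_iff Suc_le_eq intro!: gr0I)
  then show ?thesis by simp
qed

text \<open>Origin of the factor \<open>E[Y] \<Psi>^e(z)\<close>: the tail produced by the cut
  equation is the equilibrium distribution without its normalisation.\<close>

lemma pgf_tail_pmf:
  assumes "0 \<notin> set_pmf p" "integrable (measure_pmf p) real" "norm z \<le> 1"
  shows "pgf (tail (pmf p)) z = of_real (measure_pmf.expectation p real) * equilibrium_pgf p z"
proof -
  define m where "m = measure_pmf.expectation p real"
  have m: "m > 0" using expectation_pos[OF assms(1,2)] by (simp add: m_def)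
  have eq: "tail (pmf p) = (\<lambda>n. m * equilibrium_prob p n)"
    using m by (auto simp: equilibrium_prob_def tail_pmf m_def)
  have "summable (tail (pmf p))"
    using tail_sums[OF _ pmf_sums pmf_expectation_sums[OF assms(2)]] by (simp add: sums_iff)
  then have "summable (equilibrium_prob p)"
    unfolding equilibrium_prob_def tail_pmf by (rule summable_divide)
  moreover have "0 \<le> equilibrium_prob p n" for n
    using m by (simp add: equilibrium_prob_def m_def)
  ultimately show ?thesis
    unfolding eq equilibrium_pgf_def m_def[symmetric] using assms(3) by (subst pgf_cmult) auto
qed


section \<open>Restarting the arrival process\<close>

abbreviation service_space :: "(nat \<Rightarrow> real) measure" where
  "service_space \<equiv> \<Pi>\<^sub>M i\<in>UNIV. borel"

lemma measurable_epoch [measurable]: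
  assumes [measurable]: "E \<in> N \<rightarrow>\<^sub>M env_space"
  shows "(\<lambda>\<omega>. epoch (E \<omega>) m) \<in> borel_measurable N"
  unfolding epoch_def by measurable

lemma measurable_rest_at [measurable]:
  assumes [measurable]: "E \<in> N \<rightarrow>\<^sub>M env_space" "T \<in> borel_measurable N"
  shows "(\<lambda>\<omega>. rest_at m (E \<omega>) (T \<omega>)) \<in> N \<rightarrow>\<^sub>M env_space"
proof (rule measurable_PiM_single')
  fix i
  show "(\<lambda>\<omega>. rest_at m (E \<omega>) (T \<omega>) i) \<in> N \<rightarrow>\<^sub>M borel \<Otimes>\<^sub>M count_space UNIV"
    unfolding rest_at_def by (cases i) simp_all
qed (auto simp: space_pair_measure)

lemma measurable_rest [measurable]:
  assumes [measurable]: "E \<in> N \<rightarrow>\<^sub>M env_space" "T \<in> borel_measurable N"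
  shows "(\<lambda>\<omega>. rest (E \<omega>) (T \<omega>)) \<in> N \<rightarrow>\<^sub>M env_space"
  unfolding rest_def
  by (rule measurable_compose_countable[OF _ measurable_batches[OF assms]]) measurable

lemma epoch_case_nat: "epoch (case_nat a e) (Suc m) = fst a + epoch e m"
  by (induction m) (simp_all add: epoch_Suc)

text \<open>Deleting the first batch lowers the count by one and advances the clock by the first
  gap; this is the recursion for inductions on the number of batches.\<close>

lemma rest_at_case_nat: "rest_at (Suc m) (case_nat a e) t = rest_at m e (t - fst a)"
  by (rule ext) (auto simp: rest_at_def epoch_case_nat split: nat.split)

locale queue_law =
  fixes r :: real and b :: "nat pmf" and F :: "real measure"
  assumes rate_pos: "0 < r" and batch_pos: "0 \<notin> set_pmf b"
    and prob_F: "prob_space F" and sets_F [measurable_cong]: "sets F = sets borel"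
    and service_nonneg: "AE s in F. 0 \<le> s"
begin

definition gap :: "real measure" where
  "gap = density lborel (exponential_density r)"

definition gap_batch :: "(real \<times> nat) measure" where
  "gap_batch = gap \<Otimes>\<^sub>M measure_pmf b"

definition env :: "(nat \<Rightarrow> real \<times> nat) measure" where
  "env = (\<Pi>\<^sub>M i\<in>UNIV. gap_batch)"

definition services :: "(nat \<Rightarrow> real) measure" where
  "services = (\<Pi>\<^sub>M i\<in>UNIV. F)"

lemma sets_gap [measurable_cong]: "sets gap = sets borel"
  by (simp add: gap_def)

lemma sets_gap_batch [measurable_cong]: "sets gap_batch = sets (borel \<Otimes>\<^sub>M count_space UNIV)"
  unfolding gap_batch_def by (intro sets_pair_measure_cong sets_gap) simp

lemma sets_env [measurable_cong]: "sets env = sets env_space"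
  unfolding env_def by (intro sets_PiM_cong sets_gap_batch refl)

lemma sets_services [measurable_cong]: "sets services = sets service_space"
  unfolding services_def by (intro sets_PiM_cong sets_F refl)

lemma prob_gap: "prob_space gap"
  unfolding gap_def using rate_pos by (rule prob_space_exponential_density)

lemma prob_gap_batch: "prob_space gap_batch"
  unfolding gap_batch_def by (intro prob_space_pair prob_gap measure_pmf.prob_space_axioms)

lemma prob_env: "prob_space env"
  unfolding env_def by (intro prob_space_PiM prob_gap_batch)

lemma prob_services: "prob_space services"
  unfolding services_def by (intro prob_space_PiM prob_F)

lemma sequence_space_prob: "prob_space M \<Longrightarrow> sequence_space M"
  unfolding sequence_space_def product_prob_space_def product_prob_space_axioms_def product_sigma_finite_def
  by (auto intro: prob_space_imp_sigma_finite)

text \<open>An i.i.d. sequence is a first term followed by an independent copy of the whole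
  sequence.\<close>

lemma nn_integral_env_iter:
  assumes [measurable]: "f \<in> borel_measurable env"
  shows "(\<integral>\<^sup>+e. f e \<partial>env) = (\<integral>\<^sup>+x. \<integral>\<^sup>+k. \<integral>\<^sup>+e. f (case_nat (x, k) e) \<partial>env \<partial>measure_pmf b \<partial>gap)"
proof -
  interpret E: prob_space env by (rule prob_env)
  have "(\<integral>\<^sup>+e. f e \<partial>env) = (\<integral>\<^sup>+e. f e \<partial>distr (gap_batch \<Otimes>\<^sub>M env) env (\<lambda>(a, e). case_nat a e))"
    using sequence_space.PiM_iter[OF sequence_space_prob[OF prob_gap_batch]] by (simp add: env_def)
  also have "\<dots> = (\<integral>\<^sup>+(a, e). f (case_nat a e) \<partial>(gap_batch \<Otimes>\<^sub>M env))"
    by (subst nn_integral_distr) (auto simp: split_beta')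
  also have "\<dots> = (\<integral>\<^sup>+a. \<integral>\<^sup>+e. f (case_nat a e) \<partial>env \<partial>gap_batch)"
    by (subst E.nn_integral_fst[symmetric]) auto
  also have "\<dots> = (\<integral>\<^sup>+x. \<integral>\<^sup>+k. \<integral>\<^sup>+e. f (case_nat (x, k) e) \<partial>env \<partial>measure_pmf b \<partial>gap)"
    unfolding gap_batch_def by (subst measure_pmf.nn_integral_fst[symmetric]) auto
  finally show ?thesis .
qed

lemma nn_integral_services_iter:
  assumes [measurable]: "f \<in> borel_measurable services"
  shows "(\<integral>\<^sup>+s. f s \<partial>services) = (\<integral>\<^sup>+x. \<integral>\<^sup>+s. f (case_nat x s) \<partial>services \<partial>F)"
proof -
  interpret S: prob_space services by (rule prob_services)
  have "(\<integral>\<^sup>+s. f s \<partial>services) = (\<integral>\<^sup>+s. f s \<partial>distr (F \<Otimes>\<^sub>M services) services (\<lambda>(a, e). case_nat a e))"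
    using sequence_space.PiM_iter[OF sequence_space_prob[OF prob_F]] by (simp add: services_def)
  also have "\<dots> = (\<integral>\<^sup>+(a, e). f (case_nat a e) \<partial>(F \<Otimes>\<^sub>M services))"
    by (subst nn_integral_distr) (auto simp: split_beta')
  also have "\<dots> = (\<integral>\<^sup>+a. \<integral>\<^sup>+e. f (case_nat a e) \<partial>services \<partial>F)"
    by (subst S.nn_integral_fst[symmetric]) auto
  finally show ?thesis .
qed

text \<open>Substituting \<open>t + x\<close> for the gap, the exponential density splits off the
  factor \<open>exp (- r * t)\<close>, the probability that the gap exceeds
  \<open>t\<close>.\<close>

lemma gap_memoryless:
  assumes [measurable]: "h \<in> borel_measurable borel" and t: "0 \<le> t"
  shows "(\<integral>\<^sup>+x. (if t < x then h (x - t) else 0) \<partial>gap) = ennreal (exp (- r * t)) * (\<integral>\<^sup>+x. h x \<partial>gap)"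
proof -
  have "(\<integral>\<^sup>+x. (if t < x then h (x - t) else 0) \<partial>gap) =
      (\<integral>\<^sup>+x. ennreal (exponential_density r x) * (if t < x then h (x - t) else 0) \<partial>lborel)"
    unfolding gap_def by (subst nn_integral_density) auto
  also have "\<dots> = (\<integral>\<^sup>+x. ennreal (exponential_density r (t + x)) * (if 0 < x then h x else 0) \<partial>lborel)"
    by (subst nn_integral_real_affine[where c = 1 and t = t]) (auto cong: if_cong)
  also have "\<dots> = (\<integral>\<^sup>+x. ennreal (exp (- r * t)) * (ennreal (exponential_density r x) * h x) \<partial>lborel)"
  proof (rule nn_integral_cong_AE)
    show "AE x in lborel. ennreal (exponential_density r (t + x)) * (if 0 < x then h x else 0) =
        ennreal (exp (- r * t)) * (ennreal (exponential_density r x) * h x)"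
      \<comment> \<open>At \<open>x = 0\<close> the density is \<open>r\<close> while the left-hand
        side is \<open>0\<close>; this single point is discarded.\<close>
      using AE_lborel_singleton[of 0]
    proof eventually_elim
      case (elim x)
      show ?case
      proof (cases "0 < x")
        case True
        have "exponential_density r (t + x) = exp (- r * t) * exponential_density r x"
          using True t by (simp add: exponential_density_def mult_exp_exp algebra_simps)
        then show ?thesis
          using True rate_pos by (simp add: ennreal_mult mult.assoc)
      qed (use elim in \<open>simp add: exponential_density_def\<close>)
    qed
  qed
  also have "\<dots> = ennreal (exp (- r * t)) * (\<integral>\<^sup>+x. h x \<partial>gap)"
    unfolding gap_def by (simp add: nn_integral_density nn_integral_cmult)
  finally show ?thesis .
qed

text \<open>The event that exactly \<open>m\<close> batches have arrived by \<open>t\<close>, in a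
  form that behaves well under shifts of \<open>t\<close>: it is also meaningful off
  \<open>proper\<close> paths, and for \<open>m = 0\<close> it fails at negative
  \<open>t\<close>.\<close>

definition in_batch :: "nat \<Rightarrow> (nat \<Rightarrow> real \<times> nat) \<Rightarrow> real \<Rightarrow> bool" where
  "in_batch m e t \<longleftrightarrow> epoch e m \<le> t \<and> t < epoch e (Suc m)"

lemma measurable_in_batch [measurable]:
  assumes [measurable]: "E \<in> N \<rightarrow>\<^sub>M env_space" "T \<in> borel_measurable N"
  shows "Measurable.pred N (\<lambda>\<omega>. in_batch m (E \<omega>) (T \<omega>))"
  unfolding in_batch_def by measurable

lemma in_batch_case_nat: "in_batch (Suc m) (case_nat a e) t \<longleftrightarrow> in_batch m e (t - fst a)"
  by (auto simp: in_batch_def epoch_case_nat)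

text \<open>Given that the first gap exceeds \<open>t\<close>, its remainder is exponential again,
  while its batch and all later terms are untouched. The constant \<open>c\<close> will be the value
  of \<open>\<phi>\<close> at zero arrivals.\<close>

lemma restart_in_batch_0:
  assumes [measurable]: "f \<in> borel_measurable env"
  shows "(\<integral>\<^sup>+e. (if in_batch 0 e t then c * f (rest_at 0 e t) else 0) \<partial>env) =
         (if 0 \<le> t then c * ennreal (exp (- r * t)) * (\<integral>\<^sup>+e. f e \<partial>env) else 0)"
proof (cases "0 \<le> t")
  case True
  interpret E: prob_space env by (rule prob_env)
  define h where "h x = (\<integral>\<^sup>+k. \<integral>\<^sup>+e. c * f (case_nat (x, k) e) \<partial>env \<partial>measure_pmf b)" for x
  have [measurable]: "h \<in> borel_measurable borel"
    unfolding h_def by measurable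
  have "(\<integral>\<^sup>+e. (if in_batch 0 e t then c * f (rest_at 0 e t) else 0) \<partial>env) =
      (\<integral>\<^sup>+x. \<integral>\<^sup>+k. \<integral>\<^sup>+e. (if t < x then c * f (case_nat (x - t, k) e) else 0) \<partial>env \<partial>measure_pmf b \<partial>gap)"
    using True by (subst nn_integral_env_iter)
      (auto simp: in_batch_def rest_at_def epoch_Suc intro!: nn_integral_cong)
  also have "\<dots> = (\<integral>\<^sup>+x. (if t < x then h (x - t) else 0) \<partial>gap)"
    by (intro nn_integral_cong) (simp add: h_def)
  also have "\<dots> = ennreal (exp (- r * t)) * (\<integral>\<^sup>+x. h x \<partial>gap)"
    using True by (intro gap_memoryless) auto
  also have "(\<integral>\<^sup>+x. h x \<partial>gap) = (\<integral>\<^sup>+e. c * f e \<partial>env)"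
    unfolding h_def by (subst nn_integral_env_iter) auto
  also have "\<dots> = c * (\<integral>\<^sup>+e. f e \<partial>env)"
    by (rule nn_integral_cmult) simp
  finally show ?thesis using True by (simp add: ac_simps)
qed (simp add: in_batch_def)

text \<open>
  The induction shifts \<open>t\<close> by the first gap; as \<open>t\<close> may become negative, the statement is made for
  all real \<open>t\<close>.
\<close>

lemma restart_in_batch:
  assumes f[measurable]: "f \<in> borel_measurable env"
  shows "(\<integral>\<^sup>+e. (if in_batch m e t then \<phi> (\<Sum>l<m. snd (e l)) * f (rest_at m e t) else 0) \<partial>env) =
         (\<integral>\<^sup>+e. (if in_batch m e t then \<phi> (\<Sum>l<m. snd (e l)) else 0) \<partial>env) * (\<integral>\<^sup>+e. f e \<partial>env)"
proof (induction m arbitrary: t \<phi>)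
  case 0
  interpret E: prob_space env by (rule prob_env)
  show ?case
    \<comment> \<open>The second instance, with the constant function \<open>1\<close>, evaluates
      the first factor on the right-hand side.\<close>
    using restart_in_batch_0[OF f, of t "\<phi> 0"] restart_in_batch_0[of "\<lambda>_. 1" t "\<phi> 0"]
    by (simp add: E.emeasure_space_1 cong: if_cong)
next
  case (Suc m)
  have [measurable]: "\<psi> \<in> borel_measurable (count_space UNIV)" for \<psi> :: "nat \<Rightarrow> ennreal"
    by simp
  interpret E: prob_space env by (rule prob_env)
  have shift: "(\<Sum>l<Suc m. snd (case_nat a e l)) = snd a + (\<Sum>l<m. snd (e l))" for a e
    by (simp add: sum.lessThan_Suc_shift del: sum.lessThan_Suc)
  have "(\<integral>\<^sup>+e. (if in_batch (Suc m) e t then \<phi> (\<Sum>l<Suc m. snd (e l)) * f (rest_at (Suc m) e t) else 0) \<partial>env) =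
      (\<integral>\<^sup>+x. \<integral>\<^sup>+k. \<integral>\<^sup>+e. (if in_batch m e (t - x)
         then \<phi> (k + (\<Sum>l<m. snd (e l))) * f (rest_at m e (t - x)) else 0) \<partial>env \<partial>measure_pmf b \<partial>gap)"
    by (subst nn_integral_env_iter)
      (auto simp: in_batch_case_nat rest_at_case_nat shift simp del: sum.lessThan_Suc intro!: nn_integral_cong)
  \<comment> \<open>The induction hypothesis is used with the weight \<open>\<phi>\<close> shifted
    by the size \<open>k\<close> of the removed batch, which is why \<open>\<phi>\<close> is kept
    arbitrary.\<close>
  also have "\<dots> = (\<integral>\<^sup>+x. \<integral>\<^sup>+k. (\<integral>\<^sup>+e. (if in_batch m e (t - x)
         then \<phi> (k + (\<Sum>l<m. snd (e l))) else 0) \<partial>env) * (\<integral>\<^sup>+e. f e \<partial>env) \<partial>measure_pmf b \<partial>gap)"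
    by (intro nn_integral_cong) (rule Suc.IH)
  also have "\<dots> = (\<integral>\<^sup>+x. \<integral>\<^sup>+k. \<integral>\<^sup>+e. (if in_batch m e (t - x)
         then \<phi> (k + (\<Sum>l<m. snd (e l))) else 0) \<partial>env \<partial>measure_pmf b \<partial>gap) * (\<integral>\<^sup>+e. f e \<partial>env)"
    by (simp add: nn_integral_multc)
  also have "(\<integral>\<^sup>+x. \<integral>\<^sup>+k. \<integral>\<^sup>+e. (if in_batch m e (t - x)
         then \<phi> (k + (\<Sum>l<m. snd (e l))) else 0) \<partial>env \<partial>measure_pmf b \<partial>gap) =
      (\<integral>\<^sup>+e. (if in_batch (Suc m) e t then \<phi> (\<Sum>l<Suc m. snd (e l)) else 0) \<partial>env)"
    by (subst nn_integral_env_iter)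
      (auto simp: in_batch_case_nat shift simp del: sum.lessThan_Suc intro!: nn_integral_cong)
  finally show ?case .
qed

section \<open>Law of the batch epochs and absence of accumulation\<close>

lemma indep_vars_env: "prob_space.indep_vars env (\<lambda>_. gap_batch) (\<lambda>k e. e k) UNIV"
proof -
  interpret E: prob_space env by (rule prob_env)
  have "distr env gap_batch (\<lambda>e. e k) = gap_batch" for k
    unfolding env_def using prob_gap_batch by (intro distr_PiM_component) auto
  moreover have "distr env (\<Pi>\<^sub>M i\<in>UNIV. gap_batch) (\<lambda>x. x) = env"
    by (simp add: env_def distr_id)
  ultimately show ?thesis
    by (subst E.indep_vars_iff_distr_eq_PiM') (auto simp: env_def restrict_def)
qed

lemma gap_distributed: "distributed env lborel (\<lambda>e. fst (e k)) (exponential_density r)"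
proof -
  have "distr env lborel (\<lambda>e. fst (e k)) = distr (distr env gap_batch (\<lambda>e. e k)) lborel fst"
    by (subst distr_distr) (auto simp: comp_def)
  also have "distr env gap_batch (\<lambda>e. e k) = gap_batch"
    unfolding env_def using prob_gap_batch by (intro distr_PiM_component) auto
  also have "distr gap_batch lborel fst = distr gap_batch gap fst"
    by (rule distr_cong) (auto simp: sets_gap)
  also have "\<dots> = gap"
    unfolding gap_batch_def by (rule prob_space.distr_pair_fst[OF measure_pmf.prob_space_axioms])
  finally show ?thesis
    by (simp add: distributed_def gap_def)
qed

lemma epoch_distributed: "distributed env lborel (\<lambda>e. epoch e (Suc m)) (erlang_density m r)"
proof -
  interpret E: prob_space env by (rule prob_env)
  have "E.indep_vars (\<lambda>_. borel) (\<lambda>k e. fst (e k)) {..<Suc m}"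
    by (rule E.indep_vars_subset[OF E.indep_vars_compose2[OF indep_vars_env]]) auto
  from E.exponential_distributed_sum[OF _ _ rate_pos gap_distributed this]
  show ?thesis by (simp add: epoch_def lessThan_empty_iff del: sum.lessThan_Suc)
qed

text \<open>The Erlang densities of all epochs add up to \<open>r * exp (- r * x)\<close> times the
  exponential series of \<open>r * x\<close>: the Poisson process has constant renewal
  density.\<close>

lemma suminf_erlang_density:
  "(\<Sum>m. ennreal (erlang_density m r x)) = (if x < 0 then 0 else ennreal r)"
proof (cases "x < 0")
  case False
  have "(\<lambda>m. (r * x) ^ m / fact m) sums exp (r * x)"
    using exp_converges[of "r * x"] by (simp add: divide_inverse_commute)
  then have "(\<lambda>m. r * exp (- r * x) * ((r * x) ^ m / fact m)) sums (r * exp (- r * x) * exp (r * x))"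
    by (rule sums_mult)
  moreover have "r * exp (- r * x) * exp (r * x) = r"
    by (simp add: mult.assoc mult_exp_exp)
  moreover have "erlang_density m r x = r * exp (- r * x) * ((r * x) ^ m / fact m)" for m
    using False by (simp add: erlang_density_def power_mult_distrib)
  ultimately have s: "(\<lambda>m. erlang_density m r x) sums r"
    by (simp only:)
  have "(\<Sum>m. ennreal (erlang_density m r x)) = ennreal r"
    using rate_pos by (intro suminf_ennreal_eq[OF _ s] erlang_density_nonneg) simp
  then show ?thesis
    using False by simp
qed (simp add: erlang_density_def)

text \<open>The sum is the expected number of batches up to \<open>t\<close>, obtained by
  integrating the constant renewal density.\<close>

lemma sum_epoch_le:
  assumes t: "0 \<le> t"
  shows "(\<Sum>m. \<integral>\<^sup>+e. of_bool (epoch e (Suc m) \<le> t) \<partial>env) = ennreal (r * t)"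
proof -
  have "(\<integral>\<^sup>+e. of_bool (epoch e (Suc m) \<le> t) \<partial>env) =
      (\<integral>\<^sup>+x. ennreal (erlang_density m r x) * indicator {..t} x \<partial>lborel)" for m
    by (subst distributed_nn_integral[OF epoch_distributed]) (auto simp: indicator_def of_bool_def)
  then have "(\<Sum>m. \<integral>\<^sup>+e. of_bool (epoch e (Suc m) \<le> t) \<partial>env) =
      (\<integral>\<^sup>+x. (\<Sum>m. ennreal (erlang_density m r x)) * indicator {..t} x \<partial>lborel)"
    by (simp add: nn_integral_suminf[symmetric])
  also have "\<dots> = (\<integral>\<^sup>+x. ennreal r * indicator {0..t} x \<partial>lborel)"
    by (intro nn_integral_cong) (auto simp: suminf_erlang_density indicator_def)
  also have "\<dots> = ennreal (r * t)"
    using t rate_pos by (simp add: nn_integral_cmult ennreal_mult)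
  finally show ?thesis .
qed

lemma AE_proper: "AE e in env. proper e"
proof -
  interpret E: prob_space env by (rule prob_env)
  interpret G: prob_space gap by (rule prob_gap)
  interpret GB: pair_sigma_finite gap "measure_pmf b" ..
  have comp: "AE e in env. P (e k)" if "AE a in gap_batch. P a" for P k
    unfolding env_def using prob_gap_batch that by (intro AE_PiM_component) auto
  have "AE x in gap. 0 < x"
    unfolding gap_def using AE_lborel_singleton[of 0] rate_pos
    by (subst AE_density) (auto simp: exponential_density_def)
  have "AE x in gap. 0 < x \<and> (AE k in measure_pmf b. 0 < k)"
    using \<open>AE x in gap. 0 < x\<close>
    by eventually_elim (use batch_pos in \<open>auto simp: AE_measure_pmf_iff intro!: gr0I\<close>)
  then have "AE x in gap. AE k in measure_pmf b. 0 < fst (x, k) \<and> 0 < snd (x, k)"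
    by eventually_elim auto
  moreover have [measurable]: "Measurable.pred (gap \<Otimes>\<^sub>M measure_pmf b) (\<lambda>a. 0 < snd a)"
    by (rule measurable_compose[OF measurable_snd]) simp
  ultimately have "AE a in gap_batch. 0 < fst a \<and> 0 < snd a"
    unfolding gap_batch_def by (intro GB.AE_pair_measure) measurable
  then have 1: "AE e in env. \<forall>k. 0 < fst (e k) \<and> 0 < snd (e k)"
    using comp[of "\<lambda>a. 0 < fst a \<and> 0 < snd a"] by (simp add: AE_all_countable)
  \<comment> \<open>If no epoch passed \<open>n\<close>, the number of epochs up to \<open>n\<close>
    would be infinite, but its expectation is \<open>r * real n\<close>. Integer bounds suffice and
    keep the exceptional sets countable in number.\<close>
  have 2: "AE e in env. \<exists>m. real n < epoch e m" for n
  proof -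
    have "(\<integral>\<^sup>+e. (\<Sum>m. of_bool (epoch e (Suc m) \<le> real n)) \<partial>env) = ennreal (r * real n)"
      by (subst nn_integral_suminf) (auto simp: sum_epoch_le)
    then have "AE e in env. (\<Sum>m. of_bool (epoch e (Suc m) \<le> real n) :: ennreal) \<noteq> \<infinity>"
      by (intro nn_integral_PInf_AE) auto
    then show ?thesis
    proof eventually_elim
      case (elim e)
      show ?case
      proof (rule ccontr)
        assume "\<nexists>m. real n < epoch e m"
        then have "(\<lambda>m. of_bool (epoch e (Suc m) \<le> real n) :: ennreal) = (\<lambda>_. 1)"
          by (auto simp: not_less)
        then show False
          using elim by (simp add: nn_integral_count_space_nat[symmetric])
      qed
    qed
  qed
  then have "AE e in env. \<forall>n::nat. \<exists>m. real n < epoch e m"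
    by (simp add: AE_all_countable)
  with 1 show ?thesis
  proof eventually_elim
    case (elim e)
    have "\<exists>m. t < epoch e m" for t
      using elim(2) reals_Archimedean2[of t] by (meson less_trans)
    with elim show ?case by (simp add: proper_def)
  qed
qed

section \<open>Markov property at a fixed time and mean number of arrivals\<close>

definition arrival_prob :: "real \<Rightarrow> nat \<Rightarrow> ennreal" where
  "arrival_prob t l = (\<integral>\<^sup>+e. of_bool (arrivals e t = l) \<partial>env)"

lemma arrivals_eq_in_batch:
  assumes "proper e" "0 \<le> t"
  shows "in_batch m e t \<longleftrightarrow> m = batches e t"
  using assms batches_eqI[of e m t] epoch_batches_le[of t e] less_epoch_batches[of e t]
  by (auto simp: in_batch_def)

lemma suminf_single:
  fixes f :: "nat \<Rightarrow> ennreal"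
  shows "(\<Sum>m. if m = k then f m else 0) = f k"
  by (subst suminf_finite[of "{k}"]) auto

text \<open>Almost surely exactly one event \<open>in_batch m e t\<close> occurs, so the product
  formula for a fixed number of batches can be summed over \<open>m\<close>.\<close>

lemma restart_product:
  assumes f[measurable]: "f \<in> borel_measurable env" and t: "0 \<le> t"
  shows "(\<integral>\<^sup>+e. of_bool (arrivals e t = l) * f (rest e t) \<partial>env) = arrival_prob t l * (\<integral>\<^sup>+e. f e \<partial>env)"
proof -
  define \<phi> :: "nat \<Rightarrow> ennreal" where "\<phi> n = of_bool (n = l)" for n
  have [measurable]: "\<phi> \<in> borel_measurable (count_space UNIV)" by simp
  have eq: "AE e in env. of_bool (arrivals e t = l) * g (rest e t) =
      (\<Sum>m. if in_batch m e t then \<phi> (\<Sum>l<m. snd (e l)) * g (rest_at m e t) else 0)" for g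
    using AE_proper
    by eventually_elim
      (simp add: arrivals_eq_in_batch t suminf_single rest_def arrivals_def \<phi>_def)
  have "(\<integral>\<^sup>+e. of_bool (arrivals e t = l) * f (rest e t) \<partial>env) =
      (\<Sum>m. \<integral>\<^sup>+e. (if in_batch m e t then \<phi> (\<Sum>l<m. snd (e l)) * f (rest_at m e t) else 0) \<partial>env)"
    by (subst nn_integral_cong_AE[OF eq]) (simp add: nn_integral_suminf)
  also have "\<dots> = (\<Sum>m. \<integral>\<^sup>+e. (if in_batch m e t then \<phi> (\<Sum>l<m. snd (e l)) else 0) \<partial>env) * (\<integral>\<^sup>+e. f e \<partial>env)"
    by (simp add: restart_in_batch)
  \<comment> \<open>The same decomposition for the constant function \<open>1\<close> identifies the
    remaining factor.\<close>
  also have "(\<Sum>m. \<integral>\<^sup>+e. (if in_batch m e t then \<phi> (\<Sum>l<m. snd (e l)) else 0) \<partial>env) = arrival_prob t l"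
    using nn_integral_cong_AE[OF eq[of "\<lambda>_. 1"]]
    by (simp add: nn_integral_suminf arrival_prob_def cong: if_cong)
  finally show ?thesis .
qed

text \<open>A deterministic \<open>t\<close> is enough for service completions: services are
  independent of the arrivals, so their lengths are integrated out afterwards.\<close>

lemma restart:
  assumes [measurable]: "\<And>l. g l \<in> borel_measurable env" and t: "0 \<le> t"
  shows "(\<integral>\<^sup>+e. g (arrivals e t) (rest e t) \<partial>env) = (\<Sum>l. arrival_prob t l * (\<integral>\<^sup>+e. g l e \<partial>env))"
proof -
  have "g (arrivals e t) (rest e t) = (\<Sum>l. of_bool (arrivals e t = l) * g l (rest e t))" for e
  proof -
    have "(\<Sum>l. of_bool (arrivals e t = l) * g l (rest e t)) =
        (\<Sum>l. if l = arrivals e t then g l (rest e t) else 0)"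
      by (intro suminf_cong) auto
    then show ?thesis by (simp add: suminf_single)
  qed
  then have "(\<integral>\<^sup>+e. g (arrivals e t) (rest e t) \<partial>env) =
      (\<Sum>l. \<integral>\<^sup>+e. of_bool (arrivals e t = l) * g l (rest e t) \<partial>env)"
    by (simp add: nn_integral_suminf)
  then show ?thesis
    by (simp add: restart_product t)
qed

text \<open>The epoch of batch \<open>m\<close> depends on gaps only, hence is independent of its
  size. The induction removes the first pair and shifts \<open>t\<close>.\<close>

lemma nn_integral_batch:
  "(\<integral>\<^sup>+e. of_bool (epoch e (Suc m) \<le> t) * of_nat (snd (e m)) \<partial>env) =
     (\<integral>\<^sup>+k. of_nat k \<partial>measure_pmf b) * (\<integral>\<^sup>+e. of_bool (epoch e (Suc m) \<le> t) \<partial>env)"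
proof (induction m arbitrary: t)
  case 0
  interpret E: prob_space env by (rule prob_env)
  show ?case
    by (subst (1 2) nn_integral_env_iter)
      (simp_all add: epoch_Suc nn_integral_cmult nn_integral_multc E.emeasure_space_1 mult.commute
        measure_pmf.emeasure_space_1)
next
  case (Suc m)
  interpret E: prob_space env by (rule prob_env)
  show ?case
    by (subst (1 2) nn_integral_env_iter)
      (simp_all add: epoch_case_nat le_diff_eq[symmetric] add.commute[of _ "epoch _ _"]
        Suc.IH nn_integral_cmult measure_pmf.emeasure_space_1)
qed

lemma arrivals_eq_suminf:
  assumes "proper e" "0 \<le> t"
  shows "of_nat (arrivals e t) = (\<Sum>m. of_bool (epoch e (Suc m) \<le> t) * of_nat (snd (e m)) :: ennreal)"
proof -
  have "(\<Sum>m. of_bool (epoch e (Suc m) \<le> t) * of_nat (snd (e m)) :: ennreal) =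
      (\<Sum>m<batches e t. of_bool (epoch e (Suc m) \<le> t) * of_nat (snd (e m)))"
    using epoch_le_iff[OF assms] by (intro suminf_finite) auto
  also have "\<dots> = of_nat (arrivals e t)"
    unfolding arrivals_def of_nat_sum
    using epoch_le_iff[OF assms] by (intro sum.cong) auto
  finally show ?thesis ..
qed

text \<open>Expected number of batches times mean batch size; this is where \<open>\<rho>\<close>
  comes from once \<open>t\<close> is integrated over a service.\<close>

lemma nn_integral_arrivals:
  assumes "0 \<le> t"
  shows "(\<integral>\<^sup>+e. of_nat (arrivals e t) \<partial>env) = ennreal (r * t) * (\<integral>\<^sup>+k. of_nat k \<partial>measure_pmf b)"
proof -
  have "(\<integral>\<^sup>+e. of_nat (arrivals e t) \<partial>env) =
      (\<integral>\<^sup>+e. (\<Sum>m. of_bool (epoch e (Suc m) \<le> t) * of_nat (snd (e m))) \<partial>env)"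
    using AE_proper arrivals_eq_suminf[OF _ assms] by (intro nn_integral_cong_AE) auto
  also have "\<dots> = (\<Sum>m. (\<integral>\<^sup>+k. of_nat k \<partial>measure_pmf b) * (\<integral>\<^sup>+e. of_bool (epoch e (Suc m) \<le> t) \<partial>env))"
    by (simp add: nn_integral_suminf nn_integral_batch)
  also have "\<dots> = ennreal (r * t) * (\<integral>\<^sup>+k. of_nat k \<partial>measure_pmf b)"
    by (simp add: sum_epoch_le[OF assms] mult.commute)
  finally show ?thesis .
qed

end


section \<open>One service in expectation\<close>

abbreviation state_space :: "state measure" where
  "state_space \<equiv> count_space UNIV \<Otimes>\<^sub>M (env_space \<Otimes>\<^sub>M service_space)"

lemma suminf_swap_ennreal: "(\<Sum>i. \<Sum>j. f i j) = (\<Sum>j. \<Sum>i. f i j :: ennreal)"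
  using nn_integral_suminf[of "\<lambda>j i. f i j" "count_space UNIV"]
  by (simp add: nn_integral_count_space_nat)

lemma suminf_diagonal_ennreal:
  fixes f :: "nat \<Rightarrow> nat \<Rightarrow> ennreal"
  shows "(\<Sum>n. \<Sum>l. f n l) = (\<Sum>w. \<Sum>v\<le>w. f v (w - v))"
proof -
  define g where "g n w = (if n \<le> w then f n (w - n) else 0)" for n w
  have "(\<Sum>l. f n l) = (\<Sum>w. g n w)" for n
    by (subst suminf_offset[of "g n" n]) (auto simp: g_def)
  moreover have "(\<Sum>n. g n w) = (\<Sum>v\<le>w. f v (w - v))" for w
    by (subst suminf_finite[of "{..w}"]) (auto simp: g_def)
  ultimately show ?thesis
    by (simp add: suminf_swap_ennreal[of g])
qed

lemma measurable_advance [measurable]: "advance \<in> state_space \<rightarrow>\<^sub>M state_space"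
proof -
  have [measurable]: "(\<lambda>z. \<lambda>k. snd (snd z) (Suc k)) \<in> state_space \<rightarrow>\<^sub>M service_space"
    by (rule measurable_PiM_single') auto
  show ?thesis
    unfolding advance_def split_beta' by measurable
qed

lemma measurable_killed [measurable]:
  assumes [measurable]: "f \<in> borel_measurable state_space"
  shows "killed f \<in> borel_measurable state_space"
  unfolding killed_def[abs_def] by measurable

lemma measurable_killed_pow [measurable]:
  "f \<in> borel_measurable state_space \<Longrightarrow> (killed ^^ k) f \<in> borel_measurable state_space"
  by (induction k) (auto intro: measurable_killed)

lemma measurable_alive [measurable]: "alive \<in> borel_measurable state_space"
  unfolding alive_def[abs_def] by measurable

lemma measurable_first_service [measurable]: "first_service \<in> borel_measurable state_space"
  unfolding first_service_def split_beta' by measurable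

lemma first_service_time_eq:
  "first_service_time j (n, e, s) =
    (if n = 0 then 0 else \<integral>\<^sup>+t. of_bool (0 \<le> t \<and> t < s 0 \<and> n + arrivals e t = j) \<partial>lborel)"
proof -
  have "emeasure lborel {t. 0 \<le> t \<and> t < s 0 \<and> n + arrivals e t = j} =
      (\<integral>\<^sup>+t. indicator {t. 0 \<le> t \<and> t < s 0 \<and> n + arrivals e t = j} t \<partial>lborel)"
    by (rule nn_integral_indicator[OF sets_first_service, symmetric])
  also have "\<dots> = (\<integral>\<^sup>+t. of_bool (0 \<le> t \<and> t < s 0 \<and> n + arrivals e t = j) \<partial>lborel)"
    by (intro nn_integral_cong) (auto simp: indicator_def)
  finally show ?thesis by (simp add: first_service_time_def)
qed

lemma measurable_first_service_time [measurable]: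
  "first_service_time j \<in> borel_measurable state_space"
proof -
  have "first_service_time j = (\<lambda>z. if fst z = 0 then 0 else
      \<integral>\<^sup>+t. of_bool (0 \<le> t \<and> t < snd (snd z) 0 \<and> fst z + arrivals (fst (snd z)) t = j) \<partial>lborel)"
    by (auto simp: fun_eq_iff first_service_time_eq)
  also have "\<dots> \<in> borel_measurable state_space"
    by measurable
  finally show ?thesis .
qed

lemma killed_pow_alive_01: "(killed ^^ k) alive z \<in> {0, 1}"
  by (induction k arbitrary: z) (auto simp: alive_def killed_def)

context queue_law
begin

definition service_arrival_prob :: "nat \<Rightarrow> ennreal" where
  "service_arrival_prob l = (\<integral>\<^sup>+x. arrival_prob x l \<partial>F)"

definition service_occupation :: "nat \<Rightarrow> ennreal" where
  "service_occupation l =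
     (\<integral>\<^sup>+x. \<integral>\<^sup>+e. \<integral>\<^sup>+t. of_bool (0 \<le> t \<and> t < x \<and> arrivals e t = l) \<partial>lborel \<partial>env \<partial>F)"

definition mean_service :: ennreal where
  "mean_service = (\<integral>\<^sup>+x. ennreal x \<partial>F)"

definition mean_batch :: ennreal where
  "mean_batch = (\<integral>\<^sup>+k. of_nat k \<partial>measure_pmf b)"

text \<open>Expectation of \<open>f\<close> for a fresh input and initial weights \<open>p\<close>.
  The weights need not have total mass one, since mass that reaches \<open>0\<close> is dropped
  later. The arrivals are integrated first, with the services fixed, so that \<open>restart\<close>
  applies.\<close>

definition weighted :: "(nat \<Rightarrow> ennreal) \<Rightarrow> (state \<Rightarrow> ennreal) \<Rightarrow> ennreal" where
  "weighted p f = (\<Sum>n. p n * (\<integral>\<^sup>+s. \<integral>\<^sup>+e. f (n, e, s) \<partial>env \<partial>services))"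

text \<open>The weight of \<open>0\<close> is dropped: the walk stops when the system is empty.\<close>

definition after_service :: "(nat \<Rightarrow> ennreal) \<Rightarrow> nat \<Rightarrow> ennreal" where
  "after_service p w = (\<Sum>v\<le>w. p (Suc v) * service_arrival_prob (w - v))"

definition busy_mass :: "(nat \<Rightarrow> ennreal) \<Rightarrow> ennreal" where
  "busy_mass p = (\<Sum>n. p (Suc n))"

definition weighted_mean :: "(nat \<Rightarrow> ennreal) \<Rightarrow> ennreal" where
  "weighted_mean p = (\<Sum>n. of_nat n * p n)"

lemma measurable_arrival_prob [measurable]: "(\<lambda>t. arrival_prob t l) \<in> borel_measurable borel"
proof -
  interpret E: prob_space env by (rule prob_env)
  show ?thesis unfolding arrival_prob_def by measurable
qed

lemma AE_service_nonneg: "AE s in services. \<forall>k. 0 \<le> s k"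
proof -
  have "AE s in services. 0 \<le> s k" for k
    unfolding services_def using prob_F service_nonneg by (intro AE_PiM_component) auto
  then show ?thesis by (simp add: AE_all_countable)
qed

lemma sum_arrival_prob: "(\<Sum>l. arrival_prob t l) = 1"
proof -
  interpret E: prob_space env by (rule prob_env)
  have "(\<Sum>l. arrival_prob t l) = (\<integral>\<^sup>+e. (\<Sum>l. if l = arrivals e t then 1 else 0) \<partial>env)"
    unfolding arrival_prob_def
    by (subst nn_integral_suminf[symmetric]) (auto intro!: nn_integral_cong suminf_cong)
  then show ?thesis
    by (simp add: suminf_single E.emeasure_space_1)
qed

lemma sum_service_arrival_prob: "(\<Sum>l. service_arrival_prob l) = 1"
proof -
  interpret F: prob_space F by (rule prob_F)
  show ?thesis
    unfolding service_arrival_prob_def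
    by (subst nn_integral_suminf[symmetric]) (auto simp: sum_arrival_prob F.emeasure_space_1)
qed

lemma mean_service_arrivals:
  "(\<Sum>l. of_nat l * service_arrival_prob l) = ennreal r * mean_service * mean_batch"
proof -
  interpret E: prob_space env by (rule prob_env)
  have 1: "(\<Sum>l. of_nat l * arrival_prob x l) = ennreal r * mean_batch * ennreal x" if "0 \<le> x" for x
  proof -
    have "(\<Sum>l. of_nat l * arrival_prob x l) =
        (\<integral>\<^sup>+e. (\<Sum>l. if l = arrivals e x then of_nat l else 0) \<partial>env)"
      unfolding arrival_prob_def
      by (subst nn_integral_cmult[symmetric], measurable, subst nn_integral_suminf[symmetric])
        (auto intro!: nn_integral_cong suminf_cong)
    also have "\<dots> = ennreal r * mean_batch * ennreal x"
      using that rate_pos by (simp add: suminf_single nn_integral_arrivals mean_batch_def ennreal_mult ac_simps)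
    finally show ?thesis .
  qed
  have "(\<Sum>l. of_nat l * service_arrival_prob l) = (\<integral>\<^sup>+x. (\<Sum>l. of_nat l * arrival_prob x l) \<partial>F)"
    unfolding service_arrival_prob_def
    by (subst nn_integral_cmult[symmetric], measurable, subst nn_integral_suminf[symmetric]) auto
  also have "\<dots> = (\<integral>\<^sup>+x. ennreal r * mean_batch * ennreal x \<partial>F)"
    using service_nonneg 1 by (intro nn_integral_cong_AE) auto
  also have "\<dots> = ennreal r * mean_service * mean_batch"
    by (subst nn_integral_cmult) (auto simp: mean_service_def ac_simps)
  finally show ?thesis .
qed

text \<open>At each time of the service interval \<open>[0, x)\<close> the number of arrivals has
  exactly one value, so the pieces add up to the length \<open>x\<close>.\<close>

lemma sum_service_occupation: "(\<Sum>l. service_occupation l) = mean_service"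
proof -
  interpret E: prob_space env by (rule prob_env)
  define H :: "nat \<Rightarrow> real \<Rightarrow> (nat \<Rightarrow> real \<times> nat) \<Rightarrow> ennreal"
    where "H l x e = (\<integral>\<^sup>+t. of_bool (0 \<le> t \<and> t < x \<and> arrivals e t = l) \<partial>lborel)" for l x e
  have [measurable]: "(\<lambda>(x, e). H l x e) \<in> borel_measurable (borel \<Otimes>\<^sub>M env)" for l
    unfolding H_def by measurable
  have sum_H: "(\<Sum>l. H l x e) = ennreal x" if "0 \<le> x" for x e
  proof -
    have "(\<Sum>l. of_bool (0 \<le> t \<and> t < x \<and> arrivals e t = l) :: ennreal) = indicator {0..<x} t" for t
    proof -
      have "(\<Sum>l. of_bool (0 \<le> t \<and> t < x \<and> arrivals e t = l) :: ennreal) =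
          (\<Sum>l. if l = arrivals e t then of_bool (0 \<le> t \<and> t < x) else 0)"
        by (intro suminf_cong) auto
      then show ?thesis by (auto simp: suminf_single)
    qed
    then have "(\<Sum>l. H l x e) = (\<integral>\<^sup>+t. indicator {0..<x} t \<partial>lborel)"
      unfolding H_def by (subst nn_integral_suminf[symmetric]) auto
    then show ?thesis using that by simp
  qed
  have "(\<Sum>l. service_occupation l) = (\<Sum>l. \<integral>\<^sup>+x. \<integral>\<^sup>+e. H l x e \<partial>env \<partial>F)"
    by (simp add: service_occupation_def H_def)
  also have "\<dots> = (\<integral>\<^sup>+x. (\<Sum>l. \<integral>\<^sup>+e. H l x e \<partial>env) \<partial>F)"
    by (rule nn_integral_suminf[symmetric]) measurable
  also have "\<dots> = (\<integral>\<^sup>+x. \<integral>\<^sup>+e. (\<Sum>l. H l x e) \<partial>env \<partial>F)"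
    by (intro nn_integral_cong nn_integral_suminf[symmetric]) measurable
  also have "\<dots> = mean_service"
    unfolding mean_service_def using service_nonneg
    by (intro nn_integral_cong_AE) (auto simp: sum_H E.emeasure_space_1)
  finally show ?thesis .
qed

lemma nn_integral_sum_arrival_prob:
  "(\<integral>\<^sup>+x. (\<Sum>l. arrival_prob x l * K l) \<partial>F) = (\<Sum>l. service_arrival_prob l * K l)"
proof -
  have [measurable]: "(\<lambda>x. arrival_prob x l) \<in> borel_measurable F" for l
    by simp
  have "(\<integral>\<^sup>+x. (\<Sum>l. arrival_prob x l * K l) \<partial>F) = (\<Sum>l. \<integral>\<^sup>+x. arrival_prob x l * K l \<partial>F)"
    by (rule nn_integral_suminf) simp
  also have "\<dots> = (\<Sum>l. service_arrival_prob l * K l)"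
    by (simp add: service_arrival_prob_def nn_integral_multc)
  finally show ?thesis .
qed

text \<open>Splitting off the service \<open>s 0\<close> leaves fresh services, and
  \<open>restart\<close> at that length leaves a fresh arrival sequence, independent of the number
  \<open>l\<close> of arrivals.\<close>

lemma nn_integral_killed:
  assumes [measurable]: "f \<in> borel_measurable state_space"
  shows "(\<integral>\<^sup>+s. \<integral>\<^sup>+e. killed f (Suc n, e, s) \<partial>env \<partial>services) =
    (\<Sum>l. service_arrival_prob l * (\<integral>\<^sup>+s. \<integral>\<^sup>+e. f (n + l, e, s) \<partial>env \<partial>services))"
proof -
  interpret E: prob_space env by (rule prob_env)
  interpret S: prob_space services by (rule prob_services)
  have [measurable]: "(\<lambda>s. \<lambda>k. s (Suc k)) \<in> service_space \<rightarrow>\<^sub>M service_space"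
    by (rule measurable_PiM_single') auto
  have [measurable]: "(\<lambda>s. \<integral>\<^sup>+e. killed f (Suc n, e, s) \<partial>env) \<in> borel_measurable services"
    by measurable
  define G where "G l s = (\<integral>\<^sup>+e. f (n + l, e, s) \<partial>env)" for l s
  define K where "K l = (\<integral>\<^sup>+s. G l s \<partial>services)" for l
  have [measurable]: "G l \<in> borel_measurable services" for l
    unfolding G_def by measurable
  have "(\<integral>\<^sup>+s. \<integral>\<^sup>+e. killed f (Suc n, e, s) \<partial>env \<partial>services) =
      (\<integral>\<^sup>+x. \<integral>\<^sup>+s. \<integral>\<^sup>+e. f (n + arrivals e x, rest e x, s) \<partial>env \<partial>services \<partial>F)"
    by (subst nn_integral_services_iter) (simp_all add: killed_def advance_def)
  also have "\<dots> = (\<integral>\<^sup>+x. \<integral>\<^sup>+s. (\<Sum>l. arrival_prob x l * (\<integral>\<^sup>+e. f (n + l, e, s) \<partial>env)) \<partial>services \<partial>F)"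
  proof (intro nn_integral_cong_AE)
    show "AE x in F. (\<integral>\<^sup>+s. \<integral>\<^sup>+e. f (n + arrivals e x, rest e x, s) \<partial>env \<partial>services) =
      (\<integral>\<^sup>+s. (\<Sum>l. arrival_prob x l * (\<integral>\<^sup>+e. f (n + l, e, s) \<partial>env)) \<partial>services)"
      using service_nonneg
    proof eventually_elim
      case (elim x)
      show ?case
      proof (intro nn_integral_cong)
        fix s assume s: "s \<in> space services"
        have [simp]: "s \<in> space service_space"
          by (simp add: space_PiM)
        have [measurable]: "(\<lambda>e. f (n + l, e, s)) \<in> borel_measurable env" for l
          by measurable
        show "(\<integral>\<^sup>+e. f (n + arrivals e x, rest e x, s) \<partial>env) =
            (\<Sum>l. arrival_prob x l * (\<integral>\<^sup>+e. f (n + l, e, s) \<partial>env))"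
          by (rule restart[of "\<lambda>l e. f (n + l, e, s)"]) (use elim in auto)
      qed
    qed
  qed
  also have "\<dots> = (\<integral>\<^sup>+x. \<integral>\<^sup>+s. (\<Sum>l. arrival_prob x l * G l s) \<partial>services \<partial>F)"
    by (simp add: G_def)
  also have "\<dots> = (\<integral>\<^sup>+x. (\<Sum>l. arrival_prob x l * K l) \<partial>F)"
    unfolding K_def
    by (intro nn_integral_cong) (subst nn_integral_suminf, measurable, subst nn_integral_cmult, measurable)
  also have "\<dots> = (\<Sum>l. service_arrival_prob l * K l)"
    by (rule nn_integral_sum_arrival_prob)
  finally show ?thesis by (simp add: G_def K_def)
qed

text \<open>Moves the step from the function to the initial weights. Iterated, it reduces path
  expectations to a recursion for weights on the integers.\<close>

lemma weighted_killed:
  assumes [measurable]: "f \<in> borel_measurable state_space"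
  shows "weighted p (killed f) = weighted (after_service p) f"
proof -
  define J where "J n = (\<integral>\<^sup>+s. \<integral>\<^sup>+e. f (n, e, s) \<partial>env \<partial>services)" for n
  have "weighted p (killed f) = (\<Sum>n. p (Suc n) * (\<Sum>l. service_arrival_prob l * J (n + l)))"
    unfolding weighted_def J_def
    by (subst suminf_offset[of _ 1]) (simp_all add: nn_integral_killed, simp add: killed_def)
  also have "\<dots> = (\<Sum>n. \<Sum>l. p (Suc n) * service_arrival_prob l * J (n + l))"
    by (simp add: mult.assoc)
  also have "\<dots> = (\<Sum>w. \<Sum>v\<le>w. p (Suc v) * service_arrival_prob (w - v) * J (v + (w - v)))"
    by (rule suminf_diagonal_ennreal)
  also have "\<dots> = weighted (after_service p) f"
    unfolding weighted_def after_service_def J_def[symmetric] by (simp add: sum_distrib_right)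
  finally show ?thesis .
qed

lemma weighted_killed_pow:
  assumes "f \<in> borel_measurable state_space"
  shows "weighted p ((killed ^^ k) f) = weighted ((after_service ^^ k) p) f"
proof (induction k arbitrary: p)
  case (Suc k)
  have "weighted p ((killed ^^ Suc k) f) = weighted (after_service p) ((killed ^^ k) f)"
    using assms by (simp add: weighted_killed measurable_killed_pow)
  then show ?case
    by (simp add: Suc.IH funpow_swap1)
qed simp

lemma nn_integral_services_0:
  assumes [measurable]: "h \<in> borel_measurable borel"
  shows "(\<integral>\<^sup>+s. h (s 0) \<partial>services) = (\<integral>\<^sup>+x. h x \<partial>F)"
proof -
  interpret S: prob_space services by (rule prob_services)
  show ?thesis
    by (subst nn_integral_services_iter) (auto simp: S.emeasure_space_1)
qed

lemma weighted_alive: "weighted p alive = busy_mass p"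
proof -
  interpret E: prob_space env by (rule prob_env)
  interpret S: prob_space services by (rule prob_services)
  show ?thesis
    unfolding weighted_def busy_mass_def
    by (subst suminf_offset[of _ 1]) (auto simp: alive_def E.emeasure_space_1 S.emeasure_space_1)
qed

lemma weighted_first_service: "weighted p first_service = busy_mass p * mean_service"
proof -
  interpret E: prob_space env by (rule prob_env)
  show ?thesis
    unfolding weighted_def busy_mass_def
    by (subst suminf_offset[of _ 1])
      (auto simp: first_service_def E.emeasure_space_1 nn_integral_services_0 mean_service_def)
qed

lemma weighted_first_service_time:
  "weighted p (first_service_time j) = (\<Sum>n=1..j. p n * service_occupation (j - n))"
proof -
  interpret E: prob_space env by (rule prob_env)
  have [measurable]: "(\<lambda>x. \<integral>\<^sup>+e. \<integral>\<^sup>+t. of_bool (0 \<le> t \<and> t < x \<and> n + arrivals e t = j) \<partial>lborel \<partial>env) \<in> borel_measurable borel"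
    for n by measurable
  have "(\<integral>\<^sup>+s. \<integral>\<^sup>+e. first_service_time j (n, e, s) \<partial>env \<partial>services) =
      (if 1 \<le> n \<and> n \<le> j then service_occupation (j - n) else 0)" for n
  proof -
    have "(\<integral>\<^sup>+s. \<integral>\<^sup>+e. first_service_time j (n, e, s) \<partial>env \<partial>services) =
      (if n = 0 then 0 else \<integral>\<^sup>+x. \<integral>\<^sup>+e. \<integral>\<^sup>+t. of_bool (0 \<le> t \<and> t < x \<and> n + arrivals e t = j) \<partial>lborel \<partial>env \<partial>F)"
      using nn_integral_services_0[of "\<lambda>x. \<integral>\<^sup>+e. \<integral>\<^sup>+t. of_bool (0 \<le> t \<and> t < x \<and> n + arrivals e t = j) \<partial>lborel \<partial>env"]
      by (simp add: first_service_time_eq)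
    moreover have "n + a = j \<longleftrightarrow> n \<le> j \<and> a = j - n" for a
      by auto
    ultimately show ?thesis
      by (auto simp: service_occupation_def)
  qed
  then have "weighted p (first_service_time j) =
      (\<Sum>n. p n * (if 1 \<le> n \<and> n \<le> j then service_occupation (j - n) else 0))"
    by (simp add: weighted_def)
  also have "\<dots> = (\<Sum>n=1..j. p n * service_occupation (j - n))"
    by (subst suminf_finite[of "{1..j}"]) auto
  finally show ?thesis .
qed

lemma sum_after_service: "(\<Sum>w. after_service p w) = busy_mass p"
  unfolding after_service_def busy_mass_def
  by (subst suminf_diagonal_ennreal[symmetric]) (simp add: sum_service_arrival_prob)

text \<open>A service conserves mass, and what leaves the busy states is what arrives at
  \<open>0\<close>. Stated additively to avoid subtraction in \<open>ennreal\<close>.\<close>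

lemma after_service_0: "after_service p 0 + busy_mass (after_service p) = busy_mass p"
proof -
  have "(\<Sum>w. after_service p w) = (\<Sum>w. after_service p (w + 1)) + (\<Sum>w<1. after_service p w)"
    by (rule suminf_offset) simp
  then show ?thesis
    unfolding sum_after_service by (simp add: busy_mass_def[of "after_service p"] add.commute)
qed

text \<open>Drift of one service: each unit of busy mass loses one customer and gains
  \<open>\<rho>\<close> in the mean. Again both sides are kept free of subtraction, as the terms may
  be infinite.\<close>

lemma weighted_mean_after:
  "weighted_mean (after_service p) + busy_mass p =
     weighted_mean p + ennreal r * mean_service * mean_batch * busy_mass p"
proof -
  have "weighted_mean (after_service p) = (\<Sum>w. \<Sum>v\<le>w. of_nat (v + (w - v)) * (p (Suc v) * service_arrival_prob (w - v)))"
    unfolding weighted_mean_def after_service_def by (simp add: sum_distrib_left)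
  also have "\<dots> = (\<Sum>v. \<Sum>l. of_nat (v + l) * (p (Suc v) * service_arrival_prob l))"
    by (rule suminf_diagonal_ennreal[symmetric])
  also have "\<dots> = (\<Sum>v. \<Sum>l. (of_nat v * p (Suc v)) * service_arrival_prob l +
      p (Suc v) * (of_nat l * service_arrival_prob l))"
    by (simp add: algebra_simps)
  also have "\<dots> = (\<Sum>v. of_nat v * p (Suc v)) + ennreal r * mean_service * mean_batch * busy_mass p"
    by (simp add: suminf_add[symmetric] sum_service_arrival_prob mean_service_arrivals
      busy_mass_def mult.commute)
  finally have 1: "weighted_mean (after_service p) = (\<Sum>v. of_nat v * p (Suc v)) + ennreal r * mean_service * mean_batch * busy_mass p" .
  have "weighted_mean p = (\<Sum>v. of_nat (Suc v) * p (Suc v))"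
    unfolding weighted_mean_def by (subst suminf_offset[of _ 1]) auto
  also have "\<dots> = (\<Sum>v. of_nat v * p (Suc v) + p (Suc v))"
    by (simp add: algebra_simps)
  also have "\<dots> = (\<Sum>v. of_nat v * p (Suc v)) + busy_mass p"
    by (simp add: suminf_add[symmetric] busy_mass_def)
  finally show ?thesis
    unfolding 1 by (simp add: ac_simps)
qed

section \<open>Expected number of services by queue length\<close>

definition law :: "nat pmf \<Rightarrow> state measure" where
  "law p = measure_pmf p \<Otimes>\<^sub>M (env \<Otimes>\<^sub>M services)"

lemma sets_law [measurable_cong]: "sets (law p) = sets state_space"
  unfolding law_def by (intro sets_pair_measure_cong sets_env sets_services) simp

lemma nn_integral_law:
  assumes [measurable]: "f \<in> borel_measurable state_space"
  shows "(\<integral>\<^sup>+z. f z \<partial>law p) = weighted (\<lambda>n. ennreal (pmf p n)) f"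
proof -
  interpret E: prob_space env by (rule prob_env)
  interpret S: prob_space services by (rule prob_services)
  interpret ES: pair_sigma_finite env services ..
  have "(\<integral>\<^sup>+z. f z \<partial>law p) = (\<integral>\<^sup>+n. \<integral>\<^sup>+y. f (n, y) \<partial>(env \<Otimes>\<^sub>M services) \<partial>measure_pmf p)"
    unfolding law_def by (subst ES.P.nn_integral_fst[symmetric]) auto
  also have "\<dots> = (\<integral>\<^sup>+n. \<integral>\<^sup>+s. \<integral>\<^sup>+e. f (n, e, s) \<partial>env \<partial>services \<partial>measure_pmf p)"
  proof (rule nn_integral_cong)
    fix n
    have [measurable]: "(\<lambda>y. f (n, y)) \<in> borel_measurable (env \<Otimes>\<^sub>M services)"
      by measurable
    show "(\<integral>\<^sup>+y. f (n, y) \<partial>(env \<Otimes>\<^sub>M services)) = (\<integral>\<^sup>+s. \<integral>\<^sup>+e. f (n, e, s) \<partial>env \<partial>services)"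
      by (subst ES.nn_integral_snd[symmetric]) auto
  qed
  also have "\<dots> = weighted (\<lambda>n. ennreal (pmf p n)) f"
    by (simp add: nn_integral_measure_pmf nn_integral_count_space_nat weighted_def)
  finally show ?thesis .
qed

lemma AE_law_regular_path: "AE z in law p. regular_path z"
proof -
  interpret E: prob_space env by (rule prob_env)
  interpret S: prob_space services by (rule prob_services)
  interpret ES: pair_sigma_finite env services ..
  \<comment> \<open>A measurable null set covering the improper paths is carried to the product law
    in place of the exceptional set itself.\<close>
  obtain N where N: "{e \<in> space env. \<not> proper e} \<subseteq> N" "N \<in> sets env" "emeasure env N = 0"
    by (rule AE_E[OF AE_proper])
  have [measurable]: "N \<in> sets env_space" using N(2) by (simp only: sets_env)
  have [measurable]: "(\<lambda>z. indicator N (fst (snd z)) :: ennreal) \<in> borel_measurable state_space"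
    by measurable
  have "(\<integral>\<^sup>+e. indicator N e \<partial>env) = 0"
    using N by simp
  then have "weighted (\<lambda>n. ennreal (pmf p n)) (\<lambda>z. indicator N (fst (snd z))) = 0"
    by (simp add: weighted_def)
  then have "(\<integral>\<^sup>+z. indicator N (fst (snd z)) \<partial>law p) = 0"
    by (subst nn_integral_law) auto
  then have A1: "AE z in law p. indicator N (fst (snd z)) = (0::ennreal)"
    by (subst (asm) nn_integral_0_iff_AE) auto
  have "(\<integral>\<^sup>+z. of_bool (\<not> (\<forall>k. 0 \<le> snd (snd z) k)) \<partial>law p) = 0"
  proof (subst nn_integral_law)
    have "(\<integral>\<^sup>+s. of_bool (\<not> (\<forall>k. 0 \<le> s k)) \<partial>services) = (\<integral>\<^sup>+s. 0 \<partial>services)"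
      using AE_service_nonneg by (intro nn_integral_cong_AE) auto
    then show "weighted (\<lambda>n. ennreal (pmf p n)) (\<lambda>z. of_bool (\<not> (\<forall>k. 0 \<le> snd (snd z) k))) = 0"
      by (simp add: weighted_def E.emeasure_space_1)
  qed measurable
  then have A2: "AE z in law p. of_bool (\<not> (\<forall>k. 0 \<le> snd (snd z) k)) = (0::ennreal)"
    by (subst (asm) nn_integral_0_iff_AE) auto
  have space: "space env = UNIV"
    using sets_eq_imp_space_eq[OF sets_env] by (simp add: space_PiM space_pair_measure)
  from A1 A2 show ?thesis
  proof eventually_elim
    case (elim z)
    then show ?case
      using N(1) space by (cases z) (auto simp: regular_path_def)
  qed
qed

definition iterate :: "(nat \<Rightarrow> ennreal) \<Rightarrow> nat \<Rightarrow> nat \<Rightarrow> ennreal" where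
  "iterate p k = (after_service ^^ k) p"

text \<open>The potential of the killed walk. For \<open>w > 0\<close> it is the expected number of
  services started with \<open>w\<close> customers.\<close>

definition green :: "(nat \<Rightarrow> ennreal) \<Rightarrow> nat \<Rightarrow> ennreal" where
  "green p w = (\<Sum>k. iterate p k w)"

lemma iterate_0: "iterate p 0 = p" and iterate_Suc: "iterate p (Suc k) = after_service (iterate p k)"
  by (simp_all add: iterate_def)

lemma busy_mass_iterate_le: "busy_mass (iterate p k) \<le> busy_mass p"
proof (induction k)
  case (Suc k)
  have "busy_mass (iterate p (Suc k)) \<le> busy_mass (iterate p k)"
    unfolding iterate_Suc after_service_0[of "iterate p k", symmetric] by simp
  with Suc show ?case by simp
qed (simp add: iterate_0)

lemma weighted_mean_iterate:
  "weighted_mean (iterate p K) + (\<Sum>k<K. busy_mass (iterate p k)) =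
     weighted_mean p + ennreal r * mean_service * mean_batch * (\<Sum>k<K. busy_mass (iterate p k))"
proof (induction K)
  case (Suc K)
  have "weighted_mean (iterate p (Suc K)) + (\<Sum>k<Suc K. busy_mass (iterate p k)) =
      (weighted_mean (iterate p (Suc K)) + busy_mass (iterate p K)) + (\<Sum>k<K. busy_mass (iterate p k))"
    by (simp add: ac_simps)
  also have "\<dots> = (weighted_mean (iterate p K) + (\<Sum>k<K. busy_mass (iterate p k))) +
      ennreal r * mean_service * mean_batch * busy_mass (iterate p K)"
    unfolding iterate_Suc weighted_mean_after by (simp add: ac_simps)
  finally show ?case
    unfolding Suc.IH by (simp add: algebra_simps)
qed (simp add: iterate_0)

lemma green_Suc_sum: "(\<Sum>v. green p (Suc v)) = (\<Sum>k. busy_mass (iterate p k))"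
  unfolding green_def busy_mass_def by (rule suminf_swap_ennreal)

text \<open>A visit to \<open>w\<close> is either the start or the outcome of a service begun with
  \<open>v + 1\<close> customers, of whom one leaves while \<open>w - v\<close> arrive.\<close>

lemma green_eq: "green p w = p w + (\<Sum>v\<le>w. green p (Suc v) * service_arrival_prob (w - v))"
proof -
  have "green p w = (\<Sum>k. after_service (iterate p k) w) + p w"
    unfolding green_def by (subst suminf_offset[of _ 1]) (simp_all add: iterate_0 iterate_Suc)
  also have "(\<Sum>k. after_service (iterate p k) w) =
      (\<Sum>v\<le>w. \<Sum>k. iterate p k (Suc v) * service_arrival_prob (w - v))"
    unfolding after_service_def by (rule suminf_sum) simp
  also have "\<dots> = (\<Sum>v\<le>w. green p (Suc v) * service_arrival_prob (w - v))"
    by (simp add: green_def)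
  finally show ?thesis by (simp add: add.commute)
qed

text \<open>All busy mass is eventually absorbed at \<open>0\<close>, and absorption happens only
  from one customer without arrivals. The mass balances telescope, and finiteness of the series
  permits the cancellation of \<open>A\<close>.\<close>

lemma green_1:
  assumes "(\<Sum>k. busy_mass (iterate p k)) \<noteq> \<infinity>"
  shows "green p 1 * service_arrival_prob 0 = busy_mass p"
proof -
  define A where "A = (\<Sum>k. busy_mass (iterate p (Suc k)))"
  have B: "(\<Sum>k. busy_mass (iterate p k)) = A + busy_mass p"
    unfolding A_def by (subst suminf_offset[of _ 1]) (simp_all add: iterate_0)
  have "A + busy_mass p = (\<Sum>k. after_service (iterate p k) 0 + busy_mass (iterate p (Suc k)))"
    unfolding B[symmetric] iterate_Suc after_service_0 ..
  also have "\<dots> = (\<Sum>k. after_service (iterate p k) 0) + A"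
    unfolding A_def by (rule suminf_add[symmetric]) auto
  also have "(\<Sum>k. after_service (iterate p k) 0) = green p 1 * service_arrival_prob 0"
    by (simp add: after_service_def green_def)
  finally show ?thesis
    using assms unfolding B by (simp add: add.commute)
qed

end

section \<open>Stability and finiteness of the expected number of services\<close>

locale stable_queue = queue_law +
  assumes integrable_batch: "integrable (measure_pmf b) real"
    and integrable_service: "integrable F (\<lambda>s. s)"
    and stable: "traffic_intensity r b F < 1"
begin

abbreviation "\<rho> \<equiv> traffic_intensity r b F"

lemma mean_service_eq: "mean_service = ennreal (\<integral>s. s \<partial>F)"
  unfolding mean_service_def using integrable_service service_nonneg by (rule nn_integral_eq_integral)

lemma mean_service_nonneg: "0 \<le> (\<integral>s. s \<partial>F)"
  using service_nonneg by (rule integral_nonneg_AE)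

lemma mean_batch_eq: "mean_batch = ennreal (measure_pmf.expectation b real)"
  unfolding mean_batch_def ennreal_of_nat_eq_real_of_nat
  using integrable_batch by (intro nn_integral_eq_integral) auto

lemma mean_service_arrivals_eq: "ennreal r * mean_service * mean_batch = ennreal \<rho>"
  using rate_pos mean_service_nonneg
  by (simp add: mean_service_eq mean_batch_eq traffic_intensity_def ennreal_mult)

lemma \<rho>_nonneg: "0 \<le> \<rho>"
  using rate_pos mean_service_nonneg by (simp add: traffic_intensity_def)

text \<open>For the first \<open>K\<close> services the summed drift gives
  \<open>s <= m + \<rho> * s\<close>. Partial sums are finite, so this can be solved for
  \<open>s\<close> in the reals, with a bound independent of \<open>K\<close>.\<close>

lemma sum_busy_mass_le:
  assumes m: "weighted_mean p = ennreal m" "0 \<le> m" and "busy_mass p \<noteq> \<infinity>"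
  shows "(\<Sum>k. busy_mass (iterate p k)) \<le> ennreal (m / (1 - \<rho>))"
proof (rule suminf_le_const)
  fix K
  define s where "s = (\<Sum>k<K. busy_mass (iterate p k))"
  have "busy_mass (iterate p k) < top" for k
    by (rule le_less_trans[OF busy_mass_iterate_le]) (use assms(3) in \<open>simp add: less_top[symmetric]\<close>)
  then have "s < top"
    unfolding s_def by simp
  then obtain \<sigma> where \<sigma>: "s = ennreal \<sigma>" "0 \<le> \<sigma>"
    by (cases s rule: ennreal_cases) auto
  have "s \<le> weighted_mean (iterate p K) + s"
    by simp
  also have "\<dots> = ennreal m + ennreal \<rho> * s"
    unfolding s_def weighted_mean_iterate mean_service_arrivals_eq m(1) ..
  also have "\<dots> = ennreal (m + \<rho> * \<sigma>)"
    using m(2) \<rho>_nonneg \<sigma> by (simp add: ennreal_mult)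
  finally have "\<sigma> \<le> m + \<rho> * \<sigma>"
    unfolding \<sigma>(1) by (subst (asm) ennreal_le_iff) (use \<sigma>(2) m(2) \<rho>_nonneg in simp)
  then have "\<sigma> \<le> m / (1 - \<rho>)"
    using stable by (simp add: field_simps)
  then show "(\<Sum>k<K. busy_mass (iterate p k)) \<le> ennreal (m / (1 - \<rho>))"
    using \<sigma> by (simp add: s_def[symmetric] ennreal_leI)
qed simp

end

lemma ennreal_suminf_eqD:
  assumes "(\<Sum>i. f i) = ennreal x" "0 \<le> x"
  shows "f i = ennreal (enn2real (f i))" "(\<lambda>i. enn2real (f i)) sums x"
proof -
  have fin: "f i < top" for i
    using sum_le_suminf[of f "{i}"] assms(1) by (auto intro: le_less_trans)
  then show f: "f i = ennreal (enn2real (f i))" for i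
    by simp
  have eq: "(\<Sum>i. ennreal (enn2real (f i))) = ennreal x"
    using assms(1) f by simp
  have s: "summable (\<lambda>i. enn2real (f i))"
    using eq by (intro summable_suminf_not_top) auto
  have "ennreal (\<Sum>i. enn2real (f i)) = ennreal x"
    using suminf_ennreal2[OF _ s] eq by simp
  then show "(\<lambda>i. enn2real (f i)) sums x"
    using s assms(2) suminf_nonneg[OF s] by (simp add: sums_iff)
qed

abbreviation pmf_weight :: "nat pmf \<Rightarrow> nat \<Rightarrow> ennreal" where
  "pmf_weight p \<equiv> \<lambda>n. ennreal (pmf p n)"

section \<open>Generating functions of visits and occupation times\<close>

context stable_queue
begin

definition arrival_weight :: "nat \<Rightarrow> real" where
  "arrival_weight l = enn2real (service_arrival_prob l)"

definition occupation_weight :: "nat \<Rightarrow> real" where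
  "occupation_weight l = enn2real (service_occupation l)"

text \<open>The index is shifted: \<open>visits p v\<close> counts the services started with \<open>v + 1\<close> customers.\<close>

definition visits :: "nat pmf \<Rightarrow> nat \<Rightarrow> real" where
  "visits p v = enn2real (green (pmf_weight p) (Suc v))"

definition expected_occupation :: "nat pmf \<Rightarrow> nat \<Rightarrow> ennreal" where
  "expected_occupation p j = (\<Sum>n=1..j. green (pmf_weight p) n * service_occupation (j - n))"

lemma expected_occupation_0: "expected_occupation p 0 = 0"
  by (simp add: expected_occupation_def)

lemma arrival_weight: "service_arrival_prob l = ennreal (arrival_weight l)" "0 \<le> arrival_weight l"
    "arrival_weight sums 1"
  using ennreal_suminf_eqD[of service_arrival_prob 1] sum_service_arrival_prob
  by (simp_all add: arrival_weight_def[abs_def])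

lemma mean_arrival_weight: "(\<lambda>l. real l * arrival_weight l) sums \<rho>"
proof -
  have "(\<Sum>l. of_nat l * service_arrival_prob l) = ennreal \<rho>"
    by (simp add: mean_service_arrivals mean_service_arrivals_eq)
  from ennreal_suminf_eqD(2)[OF this \<rho>_nonneg] show ?thesis
    by (simp add: enn2real_mult arrival_weight_def)
qed

lemma occupation_weight: "service_occupation l = ennreal (occupation_weight l)" "0 \<le> occupation_weight l"
    "occupation_weight sums (\<integral>s. s \<partial>F)"
  using ennreal_suminf_eqD[of service_occupation "\<integral>s. s \<partial>F"] sum_service_occupation mean_service_nonneg
  by (simp_all add: occupation_weight_def[abs_def] mean_service_eq)

context
  fixes p :: "nat pmf"
  assumes p0: "0 \<notin> set_pmf p" and p_int: "integrable (measure_pmf p) real"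
begin

abbreviation "\<mu> \<equiv> measure_pmf.expectation p real"

lemma pmf_0: "pmf p 0 = 0"
  using p0 by (simp add: set_pmf_iff)

lemma busy_mass_pmf: "busy_mass (pmf_weight p) = 1"
proof -
  have "(\<lambda>n. pmf p (Suc n)) sums 1"
    using pmf_sums[of p] pmf_0 by (simp add: sums_Suc_iff)
  then show ?thesis
    unfolding busy_mass_def by (subst suminf_ennreal_eq) auto
qed

lemma weighted_mean_pmf: "weighted_mean (pmf_weight p) = ennreal \<mu>"
proof -
  have "weighted_mean (pmf_weight p) = (\<Sum>n. ennreal (real n * pmf p n))"
    by (simp add: weighted_mean_def ennreal_of_nat_eq_real_of_nat ennreal_mult)
  also have "\<dots> = ennreal \<mu>"
    by (rule suminf_ennreal_eq[OF _ pmf_expectation_sums[OF p_int]]) simp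
  finally show ?thesis .
qed

lemma sum_busy_mass_finite: "(\<Sum>k. busy_mass (iterate (pmf_weight p) k)) < top"
proof -
  have "(\<Sum>k. busy_mass (iterate (pmf_weight p) k)) \<le> ennreal (\<mu> / (1 - \<rho>))"
    by (rule sum_busy_mass_le) (auto simp: weighted_mean_pmf busy_mass_pmf)
  then show ?thesis
    by (rule le_less_trans) simp
qed

lemma visits: "green (pmf_weight p) (Suc v) = ennreal (visits p v)" "0 \<le> visits p v" "summable (visits p)"
proof -
  obtain x where x: "(\<Sum>v. green (pmf_weight p) (Suc v)) = ennreal x" "0 \<le> x"
    using sum_busy_mass_finite unfolding green_Suc_sum
    by (cases "\<Sum>k. busy_mass (iterate (pmf_weight p) k)" rule: ennreal_cases) auto
  show "green (pmf_weight p) (Suc v) = ennreal (visits p v)" "summable (visits p)"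
    using ennreal_suminf_eqD[OF x] by (simp_all add: visits_def[abs_def] sums_iff)
qed (simp add: visits_def)

text \<open>A working period ends exactly once, by a service started with a single customer and
  without arrivals. This is the boundary condition of the cut equation.\<close>

lemma visits_0: "visits p 0 * arrival_weight 0 = 1"
proof -
  have "ennreal (visits p 0 * arrival_weight 0) = green (pmf_weight p) 1 * service_arrival_prob 0"
    by (simp add: visits arrival_weight ennreal_mult)
  also have "\<dots> = 1"
    using sum_busy_mass_finite by (subst green_1) (auto simp: busy_mass_pmf)
  finally show ?thesis
    by (simp add: ennreal_eq_1)
qed

lemma visits_renewal:
  "visits p w = pmf p (Suc w) + (\<Sum>v\<le>Suc w. visits p v * arrival_weight (Suc w - v))"
proof -
  have "ennreal (visits p w) = green (pmf_weight p) (Suc w)"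
    by (simp add: visits)
  also have "\<dots> = ennreal (pmf p (Suc w)) + (\<Sum>v\<le>Suc w. ennreal (visits p v) * ennreal (arrival_weight (Suc w - v)))"
    by (subst green_eq) (simp only: visits arrival_weight)
  also have "\<dots> = ennreal (pmf p (Suc w)) + (\<Sum>v\<le>Suc w. ennreal (visits p v * arrival_weight (Suc w - v)))"
    by (simp only: ennreal_mult visits arrival_weight)
  also have "(\<Sum>v\<le>Suc w. ennreal (visits p v * arrival_weight (Suc w - v))) =
      ennreal (\<Sum>v\<le>Suc w. visits p v * arrival_weight (Suc w - v))"
    by (rule sum_ennreal) (simp add: visits arrival_weight)
  also have "ennreal (pmf p (Suc w)) + \<dots> =
      ennreal (pmf p (Suc w) + (\<Sum>v\<le>Suc w. visits p v * arrival_weight (Suc w - v)))"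
    by (rule ennreal_plus[symmetric]) (auto intro!: sum_nonneg mult_nonneg_nonneg simp: visits arrival_weight
        simp del: sum.atMost_Suc)
  finally show ?thesis
    by (subst (asm) ennreal_inj)
      (auto intro!: sum_nonneg add_nonneg_nonneg mult_nonneg_nonneg simp: visits arrival_weight
        simp del: sum.atMost_Suc)
qed

lemma pgf_visits:
  assumes "norm z \<le> 1"
  shows "pgf (visits p) z * (1 - pgf (tail arrival_weight) z) = of_real \<mu> * equilibrium_pgf p z"
proof -
  have "pgf (visits p) z * (1 - pgf (tail arrival_weight) z) = pgf (tail (pmf p)) z"
    by (rule pgf_renewal[OF pmf_nonneg pmf_sums pmf_expectation_sums[OF p_int] pmf_0
          arrival_weight(2,3) mean_arrival_weight visits(2,3) visits_0 visits_renewal assms])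
  then show ?thesis
    using pgf_tail_pmf[OF p0 p_int assms] by simp
qed

text \<open>The generating function identity at \<open>z = 1\<close>, where the two tail series have
  the sums \<open>\<rho>\<close> and \<open>\<mu>\<close>.\<close>

lemma sums_visits: "visits p sums (\<mu> / (1 - \<rho>))"
proof -
  have t: "tail arrival_weight sums \<rho>" "tail (pmf p) sums \<mu>"
    using tail_sums[OF arrival_weight(2,3) mean_arrival_weight]
      tail_sums[OF pmf_nonneg pmf_sums pmf_expectation_sums[OF p_int]] by auto
  have "pgf (visits p) 1 * (1 - pgf (tail arrival_weight) 1) = pgf (tail (pmf p)) 1"
    using pgf_visits[of 1] pgf_tail_pmf[OF p0 p_int, of 1] by simp
  then have "complex_of_real (suminf (visits p) * (1 - \<rho>)) = complex_of_real \<mu>"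
    using t visits(3) by (simp add: pgf_one sums_iff)
  then have "suminf (visits p) * (1 - \<rho>) = \<mu>"
    using of_real_eq_iff by blast
  then show ?thesis
    using visits(3) stable by (simp add: sums_iff field_simps)
qed

lemma expected_occupation_Suc:
  "expected_occupation p (Suc j) = ennreal (\<Sum>v\<le>j. visits p v * occupation_weight (j - v))"
proof -
  have "expected_occupation p (Suc j) = (\<Sum>v\<le>j. green (pmf_weight p) (Suc v) * service_occupation (j - v))"
    unfolding expected_occupation_def
    by (rule sum.reindex_bij_witness[of _ Suc "\<lambda>n. n - 1"]) auto
  also have "\<dots> = (\<Sum>v\<le>j. ennreal (visits p v * occupation_weight (j - v)))"
    by (simp only: ennreal_mult visits occupation_weight)
  also have "\<dots> = ennreal (\<Sum>v\<le>j. visits p v * occupation_weight (j - v))"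
    by (rule sum_ennreal) (simp add: visits occupation_weight)
  finally show ?thesis .
qed

lemma enn2real_expected_occupation_Suc:
  "enn2real (expected_occupation p (Suc j)) = (\<Sum>v\<le>j. visits p v * occupation_weight (j - v))"
  unfolding expected_occupation_Suc
  by (rule enn2real_ennreal) (auto intro!: sum_nonneg mult_nonneg_nonneg simp: visits occupation_weight)

lemma expected_occupation_Suc_sums:
  "(\<lambda>j. enn2real (expected_occupation p (Suc j))) sums (\<mu> * (\<integral>s. s \<partial>F) / (1 - \<rho>))"
proof -
  have "(\<lambda>j. \<Sum>v\<le>j. visits p v * occupation_weight (j - v)) sums (suminf (visits p) * suminf occupation_weight)"
    using visits occupation_weight by (intro Cauchy_product_sums) (auto simp: sums_iff)
  moreover have "suminf (visits p) * suminf occupation_weight = \<mu> * (\<integral>s. s \<partial>F) / (1 - \<rho>)"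
    using sums_visits occupation_weight(3) by (simp add: sums_iff)
  ultimately show ?thesis
    by (simp add: enn2real_expected_occupation_Suc)
qed

lemma summable_expected_occupation: "summable (\<lambda>j. enn2real (expected_occupation p j))"
  using expected_occupation_Suc_sums by (subst summable_Suc_iff[symmetric]) (simp add: sums_iff)

text \<open>The factor \<open>z\<close> undoes the index shift in \<open>visits\<close>.\<close>

lemma pgf_expected_occupation:
  assumes z: "norm z \<le> 1"
  shows "pgf (\<lambda>j. enn2real (expected_occupation p j)) z = z * (pgf (visits p) z * pgf occupation_weight z)"
proof -
  have "pgf (\<lambda>j. enn2real (expected_occupation p j)) z =
      z * pgf (\<lambda>j. enn2real (expected_occupation p (Suc j))) z"
    by (subst pgf_shift[OF _ summable_expected_occupation z]) (auto simp: expected_occupation_0)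
  also have "pgf (\<lambda>j. enn2real (expected_occupation p (Suc j))) z = pgf (visits p) z * pgf occupation_weight z"
    unfolding enn2real_expected_occupation_Suc
    using visits occupation_weight z by (intro pgf_mult[symmetric]) (auto simp: sums_iff)
  finally show ?thesis .
qed

text \<open>The division is legitimate because the tail series of \<open>arrival_weight\<close> is
  bounded by its value \<open>\<rho> < 1\<close> at \<open>1\<close>. The last factor does not
  depend on \<open>p\<close>, which is what the comparison of the two queues exploits.\<close>

lemma pgf_expected_occupation_eq:
  assumes z: "norm z < 1"
  shows "pgf (\<lambda>j. enn2real (expected_occupation p j)) z =
    of_real \<mu> * equilibrium_pgf p z * (z * pgf occupation_weight z / (1 - pgf (tail arrival_weight) z))"
proof -
  have "norm (pgf (tail arrival_weight) z) \<le> \<rho>"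
    using norm_pgf_le[of "tail arrival_weight" z, OF tail_nonneg[OF arrival_weight(2,3)]]
      tail_sums[OF arrival_weight(2,3) mean_arrival_weight] z by (simp add: sums_iff)
  then have "1 - pgf (tail arrival_weight) z \<noteq> 0"
    using stable by auto
  then have "pgf (visits p) z = of_real \<mu> * equilibrium_pgf p z / (1 - pgf (tail arrival_weight) z)"
    using pgf_visits[of z] z by (simp add: field_simps)
  then show ?thesis
    using z by (simp add: pgf_expected_occupation)
qed

text \<open>The series of the \<open>alive\<close> terms counts the services. Its expectation is
  finite, so almost surely not all of its terms, each \<open>0\<close> or \<open>1\<close>, equal
  \<open>1\<close>.\<close>

lemma AE_law_dead: "AE z in law p. \<exists>k. (killed ^^ k) alive z = 0"
proof -
  have "(\<integral>\<^sup>+z. (\<Sum>k. (killed ^^ k) alive z) \<partial>law p) = (\<Sum>k. \<integral>\<^sup>+z. (killed ^^ k) alive z \<partial>law p)"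
    by (rule nn_integral_suminf) (auto intro: measurable_killed_pow)
  also have "\<dots> = (\<Sum>k. busy_mass (iterate (pmf_weight p) k))"
    by (simp add: nn_integral_law weighted_killed_pow weighted_alive iterate_def)
  finally have "(\<integral>\<^sup>+z. (\<Sum>k. (killed ^^ k) alive z) \<partial>law p) \<noteq> \<infinity>"
    using sum_busy_mass_finite by simp
  then have "AE z in law p. (\<Sum>k. (killed ^^ k) alive z) \<noteq> \<infinity>"
    by (intro nn_integral_PInf_AE) auto
  then show ?thesis
  proof eventually_elim
    case (elim z)
    show ?case
    proof (rule ccontr)
      assume "\<nexists>k. (killed ^^ k) alive z = 0"
      then have "(\<lambda>k. (killed ^^ k) alive z) = (\<lambda>_. 1)"
        using killed_pow_alive_01[of _ z] by (auto simp: fun_eq_iff)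
      then show False
        using elim by (simp add: nn_integral_count_space_nat[symmetric])
    qed
  qed
qed

lemma nn_integral_law_occupation:
  "(\<integral>\<^sup>+z. (\<Sum>k. (killed ^^ k) (first_service_time j) z) \<partial>law p) = expected_occupation p j"
proof -
  have "(\<integral>\<^sup>+z. (\<Sum>k. (killed ^^ k) (first_service_time j) z) \<partial>law p) =
      (\<Sum>k. \<integral>\<^sup>+z. (killed ^^ k) (first_service_time j) z \<partial>law p)"
    by (rule nn_integral_suminf) (auto intro: measurable_killed_pow)
  also have "\<dots> = (\<Sum>k. \<Sum>n=1..j. iterate (pmf_weight p) k n * service_occupation (j - n))"
    by (simp add: nn_integral_law weighted_killed_pow weighted_first_service_time iterate_def)
  also have "\<dots> = (\<Sum>n=1..j. \<Sum>k. iterate (pmf_weight p) k n * service_occupation (j - n))"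
    by (rule suminf_sum) simp
  also have "\<dots> = expected_occupation p j"
    by (simp add: expected_occupation_def green_def)
  finally show ?thesis .
qed

text \<open>Whether a service takes place is decided before its length is drawn, so each service
  contributes \<open>mean_service\<close>.\<close>

lemma nn_integral_law_emptying:
  "(\<integral>\<^sup>+z. (\<Sum>k. (killed ^^ k) first_service z) \<partial>law p) = ennreal (\<mu> * (\<integral>s. s \<partial>F) / (1 - \<rho>))"
proof -
  have "(\<integral>\<^sup>+z. (\<Sum>k. (killed ^^ k) first_service z) \<partial>law p) =
      (\<Sum>k. \<integral>\<^sup>+z. (killed ^^ k) first_service z \<partial>law p)"
    by (rule nn_integral_suminf) (auto intro: measurable_killed_pow)
  also have "\<dots> = (\<Sum>k. busy_mass (iterate (pmf_weight p) k)) * mean_service"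
    by (simp add: nn_integral_law weighted_killed_pow weighted_first_service iterate_def)
  also have "(\<Sum>k. busy_mass (iterate (pmf_weight p) k)) = (\<Sum>v. ennreal (visits p v))"
    unfolding green_Suc_sum[symmetric] by (simp add: visits)
  also have "\<dots> = ennreal (\<mu> / (1 - \<rho>))"
    by (rule suminf_ennreal_eq[OF visits(2) sums_visits])
  also have "\<dots> * mean_service = ennreal (\<mu> * (\<integral>s. s \<partial>F) / (1 - \<rho>))"
    using mean_service_nonneg stable by (simp add: mean_service_eq ennreal_mult[symmetric])
  finally show ?thesis .
qed

end

section \<open>Laws of the initial states\<close>

context
  fixes p :: "nat pmf" and N :: "'a measure" and Z :: "'a \<Rightarrow> state"
  assumes p0: "0 \<notin> set_pmf p" and p_int: "integrable (measure_pmf p) real"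
    and Z [measurable]: "Z \<in> N \<rightarrow>\<^sub>M state_space" and Z_law: "distr N state_space Z = law p"
begin

lemma AE_dead_path: "AE \<omega> in N. regular_path (Z \<omega>) \<and> (\<exists>k. (killed ^^ k) alive (Z \<omega>) = 0)"
proof -
  have "AE z in law p. regular_path z \<and> (\<exists>k. (killed ^^ k) alive z = 0)"
    using AE_law_regular_path AE_law_dead[OF p0 p_int] by eventually_elim auto
  then show ?thesis
    using AE_distrD[OF Z] unfolding Z_law[symmetric] by blast
qed

lemma AE_occupation_measurable: "AE \<omega> in N. occupation j (Z \<omega>) \<in> sets lborel"
  using AE_dead_path by eventually_elim (use occupation_eq_sum in blast)

lemma nn_integral_occupation:
  "(\<integral>\<^sup>+\<omega>. emeasure lborel (occupation j (Z \<omega>)) \<partial>N) = expected_occupation p j"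
proof -
  have "(\<integral>\<^sup>+\<omega>. emeasure lborel (occupation j (Z \<omega>)) \<partial>N) =
      (\<integral>\<^sup>+\<omega>. (\<Sum>k. (killed ^^ k) (first_service_time j) (Z \<omega>)) \<partial>N)"
    using AE_dead_path by (intro nn_integral_cong_AE, eventually_elim) (auto intro: occupation_eq_suminf)
  also have "\<dots> = (\<integral>\<^sup>+z. (\<Sum>k. (killed ^^ k) (first_service_time j) z) \<partial>law p)"
    unfolding Z_law[symmetric] by (subst nn_integral_distr) (auto intro!: measurable_killed_pow)
  finally show ?thesis
    by (simp add: nn_integral_law_occupation[OF p0 p_int])
qed

text \<open>The additional \<open>W\<close> is the vacation or the idle period preceding the busy
  one. The sum is split only after \<open>emptying\<close> has been replaced almost everywhere by
  the measurable series \<open>E\<close>.\<close>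

lemma nn_integral_add_emptying:
  assumes [measurable]: "W \<in> borel_measurable N"
  shows "(\<integral>\<^sup>+\<omega>. W \<omega> + emptying (Z \<omega>) \<partial>N) =
    (\<integral>\<^sup>+\<omega>. W \<omega> \<partial>N) + ennreal (measure_pmf.expectation p real * (\<integral>s. s \<partial>F) / (1 - \<rho>))"
proof -
  define E where "E z = (\<Sum>k. (killed ^^ k) first_service z)" for z
  have [measurable]: "E \<in> borel_measurable state_space"
    unfolding E_def by (auto intro!: borel_measurable_suminf measurable_killed_pow)
  have "(\<integral>\<^sup>+\<omega>. W \<omega> + emptying (Z \<omega>) \<partial>N) = (\<integral>\<^sup>+\<omega>. W \<omega> + E (Z \<omega>) \<partial>N)"
    using AE_dead_path by (intro nn_integral_cong_AE, eventually_elim) (auto simp: E_def emptying_eq_suminf)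
  also have "\<dots> = (\<integral>\<^sup>+\<omega>. W \<omega> \<partial>N) + (\<integral>\<^sup>+\<omega>. E (Z \<omega>) \<partial>N)"
    by (rule nn_integral_add) auto
  also have "(\<integral>\<^sup>+\<omega>. E (Z \<omega>) \<partial>N) = (\<integral>\<^sup>+z. E z \<partial>law p)"
    unfolding Z_law[symmetric] by (subst nn_integral_distr) auto
  finally show ?thesis
    by (simp add: E_def nn_integral_law_emptying[OF p0 p_int])
qed

end

end

text \<open>Independence is given for one real-valued family indexed by \<open>source\<close>.
  Decoding recovers the pairs from it, and the floor inverts the embedding of batch sizes into the
  reals.\<close>

definition decode_env :: "(source \<Rightarrow> real) \<Rightarrow> nat \<Rightarrow> real \<times> nat" where
  "decode_env g k = (g (Gap k), nat \<lfloor>g (Batch k)\<rfloor>)"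

definition decode_services :: "(source \<Rightarrow> real) \<Rightarrow> nat \<Rightarrow> real" where
  "decode_services g k = g (Service k)"

lemma measurable_decode_env:
  assumes "range Gap \<union> range Batch \<subseteq> I"
  shows "decode_env \<in> (\<Pi>\<^sub>M i\<in>I. borel) \<rightarrow>\<^sub>M env_space"
proof (rule measurable_PiM_single')
  fix k
  have [measurable]: "(\<lambda>g. g (Gap k)) \<in> borel_measurable (\<Pi>\<^sub>M i\<in>I. (borel :: real measure))"
      "(\<lambda>g. g (Batch k)) \<in> borel_measurable (\<Pi>\<^sub>M i\<in>I. (borel :: real measure))"
    using assms by (auto intro!: measurable_component_singleton)
  show "(\<lambda>g. decode_env g k) \<in> (\<Pi>\<^sub>M i\<in>I. borel) \<rightarrow>\<^sub>M borel \<Otimes>\<^sub>M count_space UNIV"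
    unfolding decode_env_def by measurable
qed (auto simp: space_pair_measure)

lemma measurable_decode_services:
  assumes "range Service \<subseteq> I"
  shows "decode_services \<in> (\<Pi>\<^sub>M i\<in>I. borel) \<rightarrow>\<^sub>M service_space"
  using assms by (intro measurable_PiM_single')
    (auto simp: decode_services_def intro!: measurable_component_singleton)

text \<open>Turns independence of two blocks of the input into a product law for functions of the
  blocks.\<close>

lemma (in prob_space) indep_var_distr_pair:
  assumes "indep_var S X T Y" and f[measurable]: "f \<in> S \<rightarrow>\<^sub>M S'" and g[measurable]: "g \<in> T \<rightarrow>\<^sub>M T'"
  shows "distr M (S' \<Otimes>\<^sub>M T') (\<lambda>\<omega>. (f (X \<omega>), g (Y \<omega>))) =
    distr M S' (\<lambda>\<omega>. f (X \<omega>)) \<Otimes>\<^sub>M distr M T' (\<lambda>\<omega>. g (Y \<omega>))"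
proof -
  have [measurable]: "X \<in> M \<rightarrow>\<^sub>M S" "Y \<in> M \<rightarrow>\<^sub>M T"
    and eq: "distr M S X \<Otimes>\<^sub>M distr M T Y = distr M (S \<Otimes>\<^sub>M T) (\<lambda>\<omega>. (X \<omega>, Y \<omega>))"
    using assms(1) by (auto simp: indep_var_distribution_eq)
  have sf: "sigma_finite_measure (distr (distr M T Y) T' g)"
    by (intro prob_space_imp_sigma_finite prob_space.prob_space_distr prob_space_distr) auto
  have "distr M S' (\<lambda>\<omega>. f (X \<omega>)) \<Otimes>\<^sub>M distr M T' (\<lambda>\<omega>. g (Y \<omega>)) =
      distr (distr M S X) S' f \<Otimes>\<^sub>M distr (distr M T Y) T' g"
    by (simp add: distr_distr comp_def)
  also have "\<dots> = distr (distr M S X \<Otimes>\<^sub>M distr M T Y) (S' \<Otimes>\<^sub>M T') (\<lambda>(x, y). (f x, g y))"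
    using sf by (intro pair_measure_distr) auto
  also have "\<dots> = distr M (S' \<Otimes>\<^sub>M T') (\<lambda>\<omega>. (f (X \<omega>), g (Y \<omega>)))"
    unfolding eq by (subst distr_distr) (auto simp: comp_def)
  finally show ?thesis ..
qed

section \<open>Joint law of the input and of the first busy period\<close>

context MXG1_input
begin

lemma queue_law: "queue_law r b F"
proof (rule queue_law.intro)
  show "prob_space F"
    using prob_space_distr[OF service_measurable] service_law by metis
  show "sets F = sets borel"
    using sets_distr[of M borel "S 0"] service_law[of 0] by simp
qed (use rate_pos batch_pos service_nonneg in auto)

interpretation Q: queue_law r b F by (rule queue_law)

definition env_of :: "'a \<Rightarrow> nat \<Rightarrow> real \<times> nat" where
  "env_of \<omega> k = (X k \<omega>, B k \<omega>)"

definition services_of :: "'a \<Rightarrow> nat \<Rightarrow> real" where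
  "services_of \<omega> k = S k \<omega>"

lemma decode_input: "decode_env (\<lambda>i. input X B S i \<omega>) = env_of \<omega>"
    "decode_services (\<lambda>i. input X B S i \<omega>) = services_of \<omega>"
  by (auto simp: decode_env_def decode_services_def env_of_def services_of_def)

lemma gap_measurable [measurable]: "X k \<in> borel_measurable M"
  using distributed_measurable[OF gap_law[of k]] by simp

lemmas [measurable] = batch_measurable service_measurable

lemma measurable_env_of [measurable]: "env_of \<in> M \<rightarrow>\<^sub>M env_space"
  by (rule measurable_PiM_single') (auto simp: env_of_def space_pair_measure)

lemma measurable_services_of [measurable]: "services_of \<in> M \<rightarrow>\<^sub>M service_space"
  by (rule measurable_PiM_single') (auto simp: services_of_def)

lemma distr_services_of: "distr M service_space services_of = Q.services"
proof -
  have "indep_vars (\<lambda>k. \<Pi>\<^sub>M i\<in>{Service k}. borel) (\<lambda>k \<omega>. restrict (\<lambda>i. input X B S i \<omega>) {Service k}) UNIV"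
    by (rule indep_vars_restrict[OF input_indep]) (auto simp: disjoint_family_on_def)
  from indep_vars_compose2[OF this, of "\<lambda>k g. g (Service k)" "\<lambda>_. borel"]
  have "indep_vars (\<lambda>_. borel) S UNIV"
    by (simp add: measurable_component_singleton)
  then have "distr M service_space (\<lambda>\<omega>. \<lambda>k\<in>UNIV. S k \<omega>) = (\<Pi>\<^sub>M k\<in>UNIV. distr M borel (S k))"
    by (subst (asm) indep_vars_iff_distr_eq_PiM') auto
  then show ?thesis
    by (simp add: service_law Q.services_def services_of_def[abs_def] restrict_def)
qed

lemma distr_gap_batch: "distr M (borel \<Otimes>\<^sub>M count_space UNIV) (\<lambda>\<omega>. (X k \<omega>, B k \<omega>)) = Q.gap_batch"
proof -
  have "indep_var (\<Pi>\<^sub>M i\<in>{Gap k}. borel) (\<lambda>\<omega>. restrict (\<lambda>i. input X B S i \<omega>) {Gap k})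
      (\<Pi>\<^sub>M i\<in>{Batch k}. borel) (\<lambda>\<omega>. restrict (\<lambda>i. input X B S i \<omega>) {Batch k})"
    by (rule indep_var_restrict[OF input_indep]) auto
  from indep_var_distr_pair[OF this, of "\<lambda>g. g (Gap k)" borel "\<lambda>g. nat \<lfloor>g (Batch k)\<rfloor>" "count_space UNIV"]
  have "distr M borel (X k) \<Otimes>\<^sub>M distr M (count_space UNIV) (B k) =
      distr M (borel \<Otimes>\<^sub>M count_space UNIV) (\<lambda>\<omega>. (X k \<omega>, B k \<omega>))"
    by simp
  moreover have "distr M borel (X k) = Q.gap"
  proof -
    have "distr M borel (X k) = distr M lborel (X k)"
      by (rule distr_cong) auto
    then show ?thesis
      using distributed_distr_eq_density[OF gap_law] by (simp add: Q.gap_def)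
  qed
  ultimately show ?thesis
    by (simp add: batch_law Q.gap_batch_def)
qed

lemma distr_env_of: "distr M env_space env_of = Q.env"
proof -
  have "indep_vars (\<lambda>k. \<Pi>\<^sub>M i\<in>{Gap k, Batch k}. borel)
      (\<lambda>k \<omega>. restrict (\<lambda>i. input X B S i \<omega>) {Gap k, Batch k}) UNIV"
    by (rule indep_vars_restrict[OF input_indep]) (auto simp: disjoint_family_on_def)
  from indep_vars_compose2[OF this, of "\<lambda>k g. (g (Gap k), nat \<lfloor>g (Batch k)\<rfloor>)" "\<lambda>_. borel \<Otimes>\<^sub>M count_space UNIV"]
  have "indep_vars (\<lambda>_. borel \<Otimes>\<^sub>M count_space UNIV) (\<lambda>k \<omega>. (X k \<omega>, B k \<omega>)) UNIV"
    by simp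
  then have "distr M env_space (\<lambda>\<omega>. \<lambda>k\<in>UNIV. (X k \<omega>, B k \<omega>)) =
      (\<Pi>\<^sub>M k\<in>UNIV. distr M (borel \<Otimes>\<^sub>M count_space UNIV) (\<lambda>\<omega>. (X k \<omega>, B k \<omega>)))"
    by (subst (asm) indep_vars_iff_distr_eq_PiM') auto
  then show ?thesis
    by (simp add: distr_gap_batch Q.env_def env_of_def[abs_def] restrict_def)
qed

lemma distr_env_services: "distr M (env_space \<Otimes>\<^sub>M service_space) (\<lambda>\<omega>. (env_of \<omega>, services_of \<omega>)) = Q.env \<Otimes>\<^sub>M Q.services"
proof -
  define I where "I = range Gap \<union> range Batch"
  have "indep_var (\<Pi>\<^sub>M i\<in>I. borel) (\<lambda>\<omega>. restrict (\<lambda>i. input X B S i \<omega>) I)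
      (\<Pi>\<^sub>M i\<in>range Service. borel) (\<lambda>\<omega>. restrict (\<lambda>i. input X B S i \<omega>) (range Service))"
    by (rule indep_var_restrict[OF input_indep]) (auto simp: I_def)
  from indep_var_distr_pair[OF this measurable_decode_env[of I] measurable_decode_services[OF order.refl]]
  have "distr M (env_space \<Otimes>\<^sub>M service_space) (\<lambda>\<omega>. (decode_env (restrict (\<lambda>i. input X B S i \<omega>) I),
        decode_services (restrict (\<lambda>i. input X B S i \<omega>) (range Service)))) =
      distr M env_space (\<lambda>\<omega>. decode_env (restrict (\<lambda>i. input X B S i \<omega>) I)) \<Otimes>\<^sub>M
      distr M service_space (\<lambda>\<omega>. decode_services (restrict (\<lambda>i. input X B S i \<omega>) (range Service)))"
    by (simp add: I_def[symmetric])
  moreover have "decode_env (restrict (\<lambda>i. input X B S i \<omega>) I) = env_of \<omega>"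
      "decode_services (restrict (\<lambda>i. input X B S i \<omega>) (range Service)) = services_of \<omega>" for \<omega>
    by (auto simp: decode_env_def decode_services_def env_of_def services_of_def I_def)
  ultimately show ?thesis
    by (simp add: distr_env_of distr_services_of)
qed

lemma measurable_env_tail: "(\<lambda>e. \<lambda>k. e (Suc k)) \<in> env_space \<rightarrow>\<^sub>M env_space"
  by (rule measurable_PiM_single') (auto simp: space_pair_measure)

text \<open>The regular queue seen from its first arrival: the first pair is used up, its batch
  being the initial customers, while no service has begun.\<close>

definition regular_state :: "'a \<Rightarrow> state" where
  "regular_state \<omega> = (B 0 \<omega>, \<lambda>k. env_of \<omega> (Suc k), services_of \<omega>)"

lemma measurable_regular_state [measurable]: "regular_state \<in> M \<rightarrow>\<^sub>M state_space"
proof -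
  note [measurable] = measurable_env_tail
  show ?thesis unfolding regular_state_def by measurable
qed

text \<open>The first batch size is independent of everything that follows, so a busy period of the
  regular queue is a working mode started with law \<open>b\<close>. The measures are compared
  through integrals of test functions.\<close>

lemma distr_regular_state: "distr M state_space regular_state = Q.law b"
proof -
  note [measurable] = measurable_env_tail
  interpret E: prob_space Q.env by (rule Q.prob_env)
  interpret S: prob_space Q.services by (rule Q.prob_services)
  interpret ES: pair_sigma_finite Q.env Q.services ..
  have nn: "(\<integral>\<^sup>+z. f z \<partial>distr M state_space regular_state) =
      (\<integral>\<^sup>+z. f z \<partial>Q.law b)" if [measurable]: "f \<in> borel_measurable state_space" for f
  proof -
    define G where "G n s = (\<integral>\<^sup>+e. f (n, e, s) \<partial>Q.env)" for n s
    have G [measurable]: "G n \<in> borel_measurable Q.services" for n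
      unfolding G_def by measurable
    define h where "h y = f (snd (fst y 0), \<lambda>k. fst y (Suc k), snd y)" for y :: "(nat \<Rightarrow> real \<times> nat) \<times> (nat \<Rightarrow> real)"
    have [measurable]: "h \<in> borel_measurable (env_space \<Otimes>\<^sub>M service_space)"
      unfolding h_def by measurable
    have "(\<integral>\<^sup>+z. f z \<partial>distr M state_space regular_state) =
        (\<integral>\<^sup>+\<omega>. f (regular_state \<omega>) \<partial>M)"
      by (rule nn_integral_distr[OF measurable_regular_state]) simp
    also have "\<dots> = (\<integral>\<^sup>+\<omega>. h (env_of \<omega>, services_of \<omega>) \<partial>M)"
      by (simp add: h_def env_of_def regular_state_def)
    also have "\<dots> = (\<integral>\<^sup>+y. h y \<partial>(Q.env \<Otimes>\<^sub>M Q.services))"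
      unfolding distr_env_services[symmetric] by (rule nn_integral_distr[symmetric]) measurable
    also have "\<dots> = (\<integral>\<^sup>+s. \<integral>\<^sup>+e. h (e, s) \<partial>Q.env \<partial>Q.services)"
      by (rule ES.nn_integral_snd[symmetric]) auto
    also have "\<dots> = (\<integral>\<^sup>+s. \<integral>\<^sup>+x. \<integral>\<^sup>+k. \<integral>\<^sup>+e. f (k, e, s) \<partial>Q.env \<partial>measure_pmf b \<partial>Q.gap \<partial>Q.services)"
    proof (rule nn_integral_cong)
      fix s
      have [simp]: "s \<in> space service_space"
        by (simp add: space_PiM)
      have "(\<lambda>e. h (e, s)) \<in> borel_measurable Q.env"
        by measurable
      from Q.nn_integral_env_iter[OF this]
      show "(\<integral>\<^sup>+e. h (e, s) \<partial>Q.env) =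
          (\<integral>\<^sup>+x. \<integral>\<^sup>+k. \<integral>\<^sup>+e. f (k, e, s) \<partial>Q.env \<partial>measure_pmf b \<partial>Q.gap)"
        by (simp add: h_def)
    qed
    \<comment> \<open>The integrand is free of the first gap, whose law has mass one.\<close>
    also have "\<dots> = (\<integral>\<^sup>+s. \<integral>\<^sup>+k. G k s \<partial>measure_pmf b \<partial>Q.services)"
      using prob_space.emeasure_space_1[OF Q.prob_gap] by (simp add: G_def)
    also have "\<dots> = (\<integral>\<^sup>+s. (\<Sum>n. ennreal (pmf b n) * G n s) \<partial>Q.services)"
      by (simp add: nn_integral_measure_pmf nn_integral_count_space_nat)
    also have "\<dots> = (\<Sum>n. \<integral>\<^sup>+s. ennreal (pmf b n) * G n s \<partial>Q.services)"
      by (rule nn_integral_suminf) simp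
    also have "\<dots> = (\<Sum>n. ennreal (pmf b n) * (\<integral>\<^sup>+s. G n s \<partial>Q.services))"
      by (intro suminf_cong nn_integral_cmult G)
    also have "\<dots> = Q.weighted (\<lambda>n. ennreal (pmf b n)) f"
      by (simp add: Q.weighted_def G_def)
    finally show ?thesis
      by (simp add: Q.nn_integral_law)
  qed
  show ?thesis
  proof (rule measure_eqI)
    fix A assume "A \<in> sets (distr M state_space regular_state)"
    then have A: "A \<in> sets state_space" by simp
    then show "emeasure (distr M state_space regular_state) A = emeasure (Q.law b) A"
      using nn[of "indicator A"] by (simp add: Q.sets_law)
  qed (simp add: Q.sets_law)
qed

end


section \<open>Steady state of both queues\<close>

text \<open>Before the infimum of the empty times no time is empty; so state \<open>0\<close>
  contributes nothing to a working or busy period.\<close>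

lemma occupation_0: "occupation 0 z = {}"
proof -
  have "emptying z \<le> ennreal t" if "0 \<le> t" "present z t = 0" for t
    unfolding emptying_eq using that by (intro INF_lower) auto
  then show ?thesis
    by (auto simp: occupation_def not_less[symmetric])
qed

text \<open>For \<open>y = 0\<close> the quotient in \<open>ennreal\<close> is \<open>0\<close> or \<open>\<infinity>\<close>, and both are sent to \<open>0\<close>.\<close>

lemma enn2real_divide_ennreal:
  assumes "0 \<le> x" "0 \<le> y"
  shows "enn2real (ennreal x / ennreal y) = x / y"
proof (cases "y = 0")
  case True
  then show ?thesis
    using assms by (cases "x = 0") (auto simp: ennreal_divide_zero)
qed (use assms in \<open>simp add: divide_ennreal\<close>)

text \<open>Up to the first batch epoch nothing has arrived; from then on, arrivals and departures
  are those of a queue started with the first batch, delayed by \<open>x\<close>.\<close>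

lemma idle_period:
  assumes e: "proper e" and s: "\<forall>k. 0 \<le> s k"
  defines "x \<equiv> fst (e 0)" and "z \<equiv> (snd (e 0), \<lambda>k. e (Suc k), s)"
  shows customers_idle: "0 \<le> t \<Longrightarrow> t < x \<Longrightarrow> present (0, e, s) t = 0"
    and customers_after_idle: "0 \<le> t \<Longrightarrow> present (0, e, s) (x + t) = present z t"
proof -
  define e' where "e' k = e (Suc k)" for k
  have e_eq: "e = case_nat (e 0) e'"
    by (auto simp: e'_def split: nat.split)
  have ep: "epoch e (Suc m) = x + epoch e' m" for m
    by (subst e_eq) (simp add: epoch_case_nat x_def)
  have e': "proper e'"
    unfolding proper_def
  proof (intro conjI allI)
    fix t
    obtain m where "x + t < epoch e m"
      using e unfolding proper_def by blast
    also have "\<dots> \<le> epoch e (Suc m)"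
      using e by (intro epoch_mono) auto
    finally show "\<exists>m. t < epoch e' m"
      unfolding ep by auto
  qed (use e in \<open>auto simp: proper_def e'_def\<close>)
  have x: "0 < x"
    using e by (simp add: x_def proper_def)
  have arrivals: "arrivals e (x + t) = snd (e 0) + arrivals e' t" if "0 \<le> t" for t
  proof -
    have "batches e (x + t) = Suc (batches e' t)"
      using epoch_batches_le[OF that, of e'] less_epoch_batches[OF e', of t]
      by (intro batches_eqI[OF e]) (auto simp: ep)
    then show ?thesis
      by (simp add: arrivals_def sum.lessThan_Suc_shift e'_def del: sum.lessThan_Suc)
  qed
  define a d a' d' where "a = arrival 0 (\<lambda>k. fst (e k)) (\<lambda>k. snd (e k))"
    and "d = departure 0 (\<lambda>k. fst (e k)) (\<lambda>k. snd (e k)) s"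
    and "a' = arrival (snd (e 0)) (\<lambda>k. fst (e' k)) (\<lambda>k. snd (e' k))"
    and "d' = departure (snd (e 0)) (\<lambda>k. fst (e' k)) (\<lambda>k. snd (e' k)) s"
  have a_ge: "x \<le> a i" for i
    using epoch_nonneg[OF e'] by (simp add: a_def arrival_def batch_epoch_eq ep)
  have a: "a i = x + a' i" for i
  proof -
    have "a i \<le> x + t \<longleftrightarrow> a' i \<le> t" if "0 \<le> t" for t
      using arrival_le_iff[OF e, of "x + t" 0 i] arrival_le_iff[OF e' that, of "snd (e 0)" i] arrivals[OF that] that x
      by (simp add: a_def a'_def)
    \<comment> \<open>Each of the two numbers is tested as an upper bound of the other, which gives
      both inequalities.\<close>
    from this[of "a' i"] this[of "a i - x"] show ?thesis
      using a_ge[of i] arrival_nonneg[OF e', of "snd (e 0)" i] by (simp add: a'_def)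
  qed
  have d: "d i = x + d' i" for i
  proof (induction i)
    case 0
    then show ?case using a[of 0] by (simp add: d_def d'_def a_def a'_def)
  next
    case (Suc i)
    then show ?case using a[of "Suc i"] by (simp add: d_def d'_def a_def a'_def)
  qed
  show "present (0, e, s) t = 0" if "0 \<le> t" "t < x"
  proof -
    have "{i. a i \<le> t \<and> t < d i} = {}"
      using a_ge that by (auto simp: not_le intro: less_le_trans)
    then show ?thesis
      by (simp only: present_def customers_def prod.case a_def d_def card.empty)
  qed
  show "present (0, e, s) (x + t) = present z t" if "0 \<le> t"
  proof -
    have "{i. a i \<le> x + t \<and> x + t < d i} = {i. a' i \<le> t \<and> t < d' i}"
      by (auto simp: a d)
    then show ?thesis
      by (simp add: present_def customers_def z_def a_def d_def a'_def d'_def e'_def)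
  qed
qed

section \<open>Steady state of the regular queue\<close>

context MXG1_input
begin

interpretation Q: queue_law r b F by (rule queue_law)

lemma AE_proper_path: "AE \<omega> in M. proper (env_of \<omega>) \<and> (\<forall>k. 0 \<le> services_of \<omega> k)"
proof -
  have "AE \<omega> in M. proper (env_of \<omega>)"
    using Q.AE_proper AE_distrD[OF measurable_env_of] unfolding distr_env_of[symmetric] by blast
  moreover have "AE \<omega> in M. \<forall>k. 0 \<le> services_of \<omega> k"
    using Q.AE_service_nonneg AE_distrD[OF measurable_services_of]
    unfolding distr_services_of[symmetric] by blast
  ultimately show ?thesis by eventually_elim auto
qed

lemma regular_customers_eq: "regular_customers X B S t \<omega> = present (0, env_of \<omega>, services_of \<omega>) t"
  by (simp add: regular_customers_def present_def env_of_def services_of_def[abs_def])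

lemma regular_cycle_eq:
  assumes "proper (env_of \<omega>)" "\<forall>k. 0 \<le> services_of \<omega> k"
  shows "regular_cycle X B S \<omega> = ennreal (X 0 \<omega>) + emptying (regular_state \<omega>)"
proof -
  have x: "0 < X 0 \<omega>"
    using assms(1) by (auto simp: proper_def env_of_def)
  define A where "A = {t. 0 \<le> t \<and> present (regular_state \<omega>) t = 0}"
  have idle: "present (0, env_of \<omega>, services_of \<omega>) (X 0 \<omega> + t) = present (regular_state \<omega>) t" if "0 \<le> t" for t
    using customers_after_idle[OF assms that] by (simp add: regular_state_def env_of_def)
  have "{t. X 0 \<omega> \<le> t \<and> present (0, env_of \<omega>, services_of \<omega>) t = 0} = (\<lambda>t. X 0 \<omega> + t) ` A"
  proof (intro equalityI subsetI)
    fix t assume "t \<in> {t. X 0 \<omega> \<le> t \<and> present (0, env_of \<omega>, services_of \<omega>) t = 0}"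
    then have "t - X 0 \<omega> \<in> A" "t = X 0 \<omega> + (t - X 0 \<omega>)"
      using idle[of "t - X 0 \<omega>"] by (auto simp: A_def)
    then show "t \<in> (\<lambda>t. X 0 \<omega> + t) ` A" by blast
  qed (auto simp: A_def idle)
  then have "regular_cycle X B S \<omega> = (INF t\<in>(\<lambda>t. X 0 \<omega> + t) ` A. ennreal t)"
    by (simp add: regular_cycle_def empty_time_def present_def env_of_def services_of_def[abs_def])
  also have "\<dots> = (INF t\<in>A. ennreal (X 0 \<omega>) + ennreal t)"
    unfolding image_image using x by (intro INF_cong) (auto simp: A_def ennreal_plus)
  also have "\<dots> = ennreal (X 0 \<omega>) + emptying (regular_state \<omega>)"
    unfolding INF_add_left_ennreal emptying_eq A_def ..
  finally show ?thesis .
qed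

text \<open>A cycle consists of the idle interval, spent in state \<open>0\<close>, and a translated
  busy period, which avoids state \<open>0\<close>.\<close>

lemma regular_occupation:
  assumes "proper (env_of \<omega>)" "\<forall>k. 0 \<le> services_of \<omega> k"
    and meas: "occupation j (regular_state \<omega>) \<in> sets lborel"
  shows "emeasure lborel {t. 0 \<le> t \<and> ennreal t < regular_cycle X B S \<omega> \<and> regular_customers X B S t \<omega> = j} =
    (if j = 0 then ennreal (X 0 \<omega>) else 0) + emeasure lborel (occupation j (regular_state \<omega>))"
proof -
  define x O' where "x = X 0 \<omega>" and "O' = occupation j (regular_state \<omega>)"
  have x: "0 < x"
    using assms(1) by (auto simp: proper_def env_of_def x_def)
  have idle: "present (0, env_of \<omega>, services_of \<omega>) t = 0" if "0 \<le> t" "t < x" for t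
    using customers_idle[OF assms(1,2) that(1)] that by (simp add: x_def env_of_def)
  have busy: "present (0, env_of \<omega>, services_of \<omega>) (x + t) = present (regular_state \<omega>) t" if "0 \<le> t" for t
    using customers_after_idle[OF assms(1,2) that] by (simp add: regular_state_def env_of_def x_def)
  note cyc = regular_cycle_eq[OF assms(1,2), folded x_def]
  have "{t. 0 \<le> t \<and> ennreal t < regular_cycle X B S \<omega> \<and> regular_customers X B S t \<omega> = j} =
      (if j = 0 then {0..<x} else {}) \<union> (\<lambda>t. x + t) ` O'" (is "?A = ?I \<union> ?B")
  proof (intro equalityI subsetI)
    fix t assume t: "t \<in> ?A"
    show "t \<in> ?I \<union> ?B"
    proof (cases "t < x")
      case True
      then show ?thesis using t idle by (auto simp: regular_customers_eq)
    next
      case False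
      define u where "u = t - x"
      have u: "0 \<le> u" "t = x + u" using False by (auto simp: u_def)
      have "ennreal x + ennreal u < ennreal x + emptying (regular_state \<omega>)"
        using t u x by (simp add: cyc)
      then have "u \<in> O'"
        using t u busy[of u] by (auto simp: O'_def occupation_def regular_customers_eq ennreal_add_left_cancel_less)
      then show ?thesis using u by blast
    qed
  next
    fix t assume "t \<in> ?I \<union> ?B"
    then show "t \<in> ?A"
    proof
      assume "t \<in> ?I"
      then have t: "j = 0" "0 \<le> t" "t < x" by (auto split: if_splits)
      then have "ennreal t < ennreal x" by (simp add: ennreal_lessI)
      also have "\<dots> \<le> regular_cycle X B S \<omega>" by (simp add: cyc)
      finally show ?thesis using t idle by (simp add: regular_customers_eq)
    next
      assume "t \<in> ?B"
      then obtain u where u: "t = x + u" "u \<in> O'" by blast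
      then have "ennreal t < regular_cycle X B S \<omega>"
        using x by (simp add: cyc O'_def occupation_def ennreal_add_left_cancel_less)
      then show ?thesis
        using u x busy[of u] by (auto simp: O'_def occupation_def regular_customers_eq)
    qed
  qed
  moreover have "emeasure lborel (?I \<union> ?B) = emeasure lborel ?I + emeasure lborel ?B"
  proof (rule plus_emeasure[symmetric])
    show "?B \<in> sets lborel"
      using meas by (intro image_plus_measurable) (simp add: O'_def)
    show "?I \<inter> ?B = {}"
      by (auto simp: O'_def occupation_def)
  qed simp
  moreover have "emeasure lborel ?B = emeasure lborel O'"
    using meas by (intro image_plus_measurable) (simp add: O'_def)
  ultimately show ?thesis
    using x by (simp add: O'_def x_def)
qed

lemma nn_integral_first_gap: "(\<integral>\<^sup>+\<omega>. ennreal (X 0 \<omega>) \<partial>M) = ennreal (1 / r)"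
proof -
  have "(\<integral>\<^sup>+\<omega>. ennreal (X 0 \<omega>) \<partial>M) = (\<integral>\<^sup>+x. ennreal (exponential_density r x) * ennreal x \<partial>lborel)"
    by (rule distributed_nn_integral[OF gap_law, symmetric]) simp
  also have "\<dots> = (\<integral>\<^sup>+x. ennreal (erlang_density 0 r x * x ^ 1) \<partial>lborel)"
    using rate_pos by (intro nn_integral_cong)
      (auto simp: erlang_density_def exponential_density_def ennreal_mult[symmetric])
  also have "\<dots> = ennreal (1 / r)"
    by (subst nn_integral_erlang_ith_moment[OF rate_pos]) simp
  finally show ?thesis .
qed

text \<open>The mean cycle is \<open>1 / (r * (1 - \<rho>))\<close>. The idle part
  \<open>1 / r\<close> thus has probability \<open>1 - \<rho>\<close>, exactly the term removed in
  \<open>regular_busy_pgf\<close>, and only the busy occupation remains.\<close>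

lemma regular_busy_pgf_eq:
  assumes Q: "stable_queue r b F" and z: "norm z < 1"
  shows "regular_busy_pgf M r b F X B S z =
    of_real (r * (1 - traffic_intensity r b F) / traffic_intensity r b F) *
      pgf (\<lambda>j. enn2real (stable_queue.expected_occupation r b F b j)) z"
proof -
  interpret Q: stable_queue r b F by fact
  define occ where "occ j = enn2real (Q.expected_occupation b j)" for j
  define q where "q j = (if j = 0 then 1 / r else 0) + occ j" for j
  define ES EB where "ES = (\<integral>s. s \<partial>F)" and "EB = measure_pmf.expectation b real"
  have nonneg: "0 \<le> ES" "0 \<le> EB"
    using Q.mean_service_nonneg by (simp_all add: ES_def EB_def)
  note st = Q.batch_pos Q.integrable_batch measurable_regular_state distr_regular_state
  have occ_nonneg: "0 \<le> occ j" for j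
    by (simp add: occ_def)
  have occ_fin: "Q.expected_occupation b j = ennreal (occ j)" for j
    unfolding occ_def using Q.batch_pos Q.integrable_batch
    by (cases j) (simp_all add: Q.expected_occupation_0 Q.expected_occupation_Suc
        Q.enn2real_expected_occupation_Suc del: sum.atMost_Suc)
  have time: "expected_time M (regular_cycle X B S) (regular_customers X B S) j = ennreal (q j)" for j
  proof -
    have "expected_time M (regular_cycle X B S) (regular_customers X B S) j =
        (\<integral>\<^sup>+\<omega>. (if j = 0 then ennreal (X 0 \<omega>) else 0) + emeasure lborel (occupation j (regular_state \<omega>)) \<partial>M)"
      unfolding expected_time_def
      using AE_proper_path Q.AE_occupation_measurable[OF st, of j]
      by (intro nn_integral_cong_AE, eventually_elim) (auto simp: regular_occupation)
    also have "\<dots> = (if j = 0 then ennreal (1 / r) else 0) + Q.expected_occupation b j"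
      using Q.nn_integral_occupation[OF st]
      by (cases "j = 0")
        (simp_all add: occupation_0 nn_integral_first_gap
          Q.expected_occupation_0)
    also have "\<dots> = ennreal (q j)"
      using rate_pos occ_nonneg[of j] by (simp add: q_def occ_fin)
    finally show ?thesis .
  qed
  have cycle: "(\<integral>\<^sup>+\<omega>. regular_cycle X B S \<omega> \<partial>M) = ennreal (1 / (r * (1 - Q.\<rho>)))"
  proof -
    have "(\<integral>\<^sup>+\<omega>. regular_cycle X B S \<omega> \<partial>M) = (\<integral>\<^sup>+\<omega>. ennreal (X 0 \<omega>) + emptying (regular_state \<omega>) \<partial>M)"
      using AE_proper_path by (intro nn_integral_cong_AE, eventually_elim) (auto simp: regular_cycle_eq)
    also have "\<dots> = ennreal (1 / r) + ennreal (EB * ES / (1 - Q.\<rho>))"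
      by (subst Q.nn_integral_add_emptying[OF st]) (simp_all add: nn_integral_first_gap EB_def ES_def)
    also have "\<dots> = ennreal (1 / r + EB * ES / (1 - Q.\<rho>))"
      using rate_pos Q.stable nonneg by (intro ennreal_plus[symmetric]) auto
    \<comment> \<open>By \<open>\<rho> = r * ES * EB\<close> the second summand equals
      \<open>\<rho> / (r * (1 - \<rho>))\<close>.\<close>
    also have "1 / r + EB * ES / (1 - Q.\<rho>) = 1 / (r * (1 - Q.\<rho>))"
    proof -
      have "Q.\<rho> = r * ES * EB" by (simp add: traffic_intensity_def ES_def EB_def)
      then show ?thesis using rate_pos Q.stable by (simp add: field_simps)
    qed
    finally show ?thesis .
  qed
  have "steady_state_prob M (regular_cycle X B S) (regular_customers X B S) j = r * (1 - Q.\<rho>) * q j" for j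
  proof -
    have "0 \<le> q j" using rate_pos by (simp add: q_def occ_def)
    then show ?thesis
      unfolding steady_state_prob_def time cycle
      using rate_pos Q.stable by (subst enn2real_divide_ennreal) auto
  qed
  then have "steady_state_prob M (regular_cycle X B S) (regular_customers X B S) = (\<lambda>j. r * (1 - Q.\<rho>) * q j)"
    by (rule ext)
  then have "regular_pgf M X B S z = pgf (\<lambda>j. r * (1 - Q.\<rho>) * q j) z"
    by (simp only: regular_pgf_def)
  also have "\<dots> = of_real (r * (1 - Q.\<rho>)) * pgf q z"
  proof (rule pgf_cmult)
    have "summable occ"
      unfolding occ_def by (rule Q.summable_expected_occupation[OF Q.batch_pos Q.integrable_batch])
    moreover have "summable (\<lambda>j. if j = 0 then 1 / r else 0)"
      by (rule summable_finite[of "{0}"]) auto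
    ultimately show "summable q"
      unfolding q_def by (intro summable_add)
  qed (use rate_pos z in \<open>auto simp: q_def occ_def\<close>)
  also have "pgf q z = of_real (1 / r) + pgf occ z"
  proof -
    have occ0: "occ 0 = 0" and so: "summable occ"
      using Q.summable_expected_occupation[OF Q.batch_pos Q.integrable_batch]
      by (auto simp: occ_def[abs_def] Q.expected_occupation_0)
    have "summable (\<lambda>n. of_real (occ n) * z ^ n)"
      using so z by (intro summable_pgf) (auto simp: occ_nonneg)
    moreover have "(\<lambda>n. of_real (if n = 0 then 1 / r else 0) * z ^ n) sums of_real (1 / r)"
      using sums_finite[of "{0}" "\<lambda>n. of_real (if n = 0 then 1 / r else 0) * z ^ n"] by simp
    ultimately have "(\<lambda>n. of_real (if n = 0 then 1 / r else 0) * z ^ n + of_real (occ n) * z ^ n)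
        sums (of_real (1 / r) + pgf occ z)"
      unfolding pgf_def by (intro sums_add) (auto simp: summable_sums)
    then show ?thesis
      by (simp add: pgf_def[of q] q_def sums_iff distrib_right)
  qed
  finally have "regular_pgf M X B S z = of_real (1 - Q.\<rho>) + of_real (r * (1 - Q.\<rho>)) * pgf occ z"
    using rate_pos by (simp add: distrib_left)
  then show ?thesis
    by (simp add: regular_busy_pgf_def Let_def occ_def[abs_def])
qed

end

section \<open>Steady state of the working mode\<close>

context vacation_queue
begin

interpretation Q: queue_law r b F by (rule queue_law)

definition working_start :: "'a \<Rightarrow> state" where
  "working_start \<omega> = (L (V \<omega>) \<omega>, env_of \<omega>, services_of \<omega>)"

lemma transfer_measurable_M [measurable]: "(\<lambda>\<omega>. L (V \<omega>) \<omega>) \<in> M \<rightarrow>\<^sub>M count_space UNIV"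
  using vacation_info transfer_measurable by (rule measurable_from_subalg)

lemma measurable_working_start [measurable]: "working_start \<in> M \<rightarrow>\<^sub>M state_space"
  unfolding working_start_def by measurable

text \<open>The transferred number is measurable with respect to \<open>H\<close>, which is
  independent of the whole input; hence it and the input have a product law, and decoding acts on
  the second factor alone.\<close>

lemma distr_working_start: "distr M state_space working_start = Q.law \<psi>"
proof -
  define P where "P = (\<Pi>\<^sub>M i\<in>(UNIV::source set). (borel :: real measure))"
  define Y I where "Y \<omega> = L (V \<omega>) \<omega>" and "I \<omega> = (\<lambda>i. input X B S i \<omega>)" for \<omega>
  have [measurable]: "input X B S i \<in> borel_measurable M" for i
    by (cases i) auto
  have I [measurable]: "I \<in> M \<rightarrow>\<^sub>M P"
    unfolding I_def P_def by (rule measurable_PiM_single') auto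
  have Y [measurable]: "Y \<in> M \<rightarrow>\<^sub>M count_space UNIV"
    unfolding Y_def by measurable
  have spH: "space H = space M"
    using vacation_info by (simp add: subalgebra_def)
  define dec where "dec g = (decode_env g, decode_services g)" for g
  have dec [measurable]: "dec \<in> P \<rightarrow>\<^sub>M env_space \<Otimes>\<^sub>M service_space"
    unfolding dec_def P_def using measurable_decode_env[of UNIV] measurable_decode_services[of UNIV]
    by (intro measurable_Pair) auto
  \<comment> \<open>Product measures are determined by rectangles, and on these the claim is the
    independence of the two sigma-algebras.\<close>
  have indep: "measure_pmf \<psi> \<Otimes>\<^sub>M distr M P I = distr M (count_space UNIV \<Otimes>\<^sub>M P) (\<lambda>\<omega>. (Y \<omega>, I \<omega>))"
  proof (rule pair_measure_eqI)
    show "sigma_finite_measure (measure_pmf \<psi>)" "sigma_finite_measure (distr M P I)"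
      by (intro prob_space_imp_sigma_finite measure_pmf.prob_space_axioms prob_space_distr I)+
    show "sets (measure_pmf \<psi> \<Otimes>\<^sub>M distr M P I) = sets (distr M (count_space UNIV \<Otimes>\<^sub>M P) (\<lambda>\<omega>. (Y \<omega>, I \<omega>)))"
      unfolding sets_distr by (intro sets_pair_measure_cong) simp_all
  next
    fix A :: "nat set" and A' assume "A' \<in> sets (distr M P I)"
    then have A' [measurable]: "A' \<in> sets P" by simp
    have 1: "Y -` A \<inter> space M \<in> sets H"
      using measurable_sets[OF transfer_measurable, of A] by (simp add: Y_def[abs_def] spH)
    have 2: "I -` A' \<inter> space M \<in>
        sets (vimage_algebra (space M) (\<lambda>\<omega> i. input X B S i \<omega>) (\<Pi>\<^sub>M i\<in>UNIV. borel))"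
      using A' in_vimage_algebra[of A' P I "space M"] by (simp add: I_def[abs_def] P_def)
    have "prob ((Y -` A \<inter> space M) \<inter> (I -` A' \<inter> space M)) = prob (Y -` A \<inter> space M) * prob (I -` A' \<inter> space M)"
      by (rule indep_setD[OF vacation_indep 1 2])
    moreover have "(\<lambda>\<omega>. (Y \<omega>, I \<omega>)) -` (A \<times> A') \<inter> space M = (Y -` A \<inter> space M) \<inter> (I -` A' \<inter> space M)"
      by auto
    moreover have "emeasure (measure_pmf \<psi>) A = emeasure M (Y -` A \<inter> space M)"
      unfolding transfer_law[symmetric] by (subst emeasure_distr) (auto simp: Y_def[abs_def])
    ultimately show "emeasure (measure_pmf \<psi>) A * emeasure (distr M P I) A' =
        emeasure (distr M (count_space UNIV \<Otimes>\<^sub>M P) (\<lambda>\<omega>. (Y \<omega>, I \<omega>))) (A \<times> A')"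
      by (simp add: emeasure_distr emeasure_eq_measure ennreal_mult[symmetric])
  qed
  have law_I: "distr (distr M P I) (env_space \<Otimes>\<^sub>M service_space) dec = Q.env \<Otimes>\<^sub>M Q.services"
    unfolding distr_env_services[symmetric] by (subst distr_distr) (auto simp: comp_def dec_def I_def decode_input)
  interpret ES: prob_space "Q.env \<Otimes>\<^sub>M Q.services"
    by (intro prob_space_pair Q.prob_env Q.prob_services)
  have "Q.law \<psi> = distr (measure_pmf \<psi>) (count_space UNIV) (\<lambda>n. n) \<Otimes>\<^sub>M
      distr (distr M P I) (env_space \<Otimes>\<^sub>M service_space) dec"
    unfolding law_I Q.law_def by (subst distr_id2) auto
  also have "\<dots> = distr (measure_pmf \<psi> \<Otimes>\<^sub>M distr M P I) state_space (\<lambda>(n, g). (n, dec g))"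
    using ES.sigma_finite_measure_axioms by (intro pair_measure_distr) (auto simp: law_I)
  also have "\<dots> = distr M state_space (\<lambda>\<omega>. (Y \<omega>, dec (I \<omega>)))"
    unfolding indep by (subst distr_distr) (auto simp: comp_def)
  also have "\<dots> = distr M state_space working_start"
    by (simp add: working_start_def[abs_def] Y_def I_def dec_def decode_input)
  finally show ?thesis ..
qed

lemma vacation_cycle_eq: "vacation_cycle X B S V L \<omega> = ennreal (V \<omega>) + emptying (working_start \<omega>)"
  by (simp add: vacation_cycle_def emptying_def working_start_def env_of_def services_of_def[abs_def])

text \<open>The input of the working mode is timed from its own beginning, so the whole occupation
  set is merely translated by \<open>V \<omega>\<close>.\<close>

lemma working_occupation:
  assumes V: "0 \<le> V \<omega>"
  shows "{t. 0 \<le> t \<and> ennreal t < vacation_cycle X B S V L \<omega> \<and> vacation_state X B S V L t \<omega> = (Working, j)} =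
    (\<lambda>t. V \<omega> + t) ` occupation j (working_start \<omega>)" (is "?A = _ ` ?O")
proof (intro equalityI subsetI)
  fix t assume t: "t \<in> ?A"
  then have "V \<omega> \<le> t"
    by (auto simp: vacation_state_def split: if_splits)
  define u where "u = t - V \<omega>"
  have u: "0 \<le> u" "t = V \<omega> + u"
    using \<open>V \<omega> \<le> t\<close> by (auto simp: u_def)
  then have "ennreal (V \<omega>) + ennreal u < ennreal (V \<omega>) + emptying (working_start \<omega>)"
    using t V by (simp add: vacation_cycle_eq)
  then have "u \<in> ?O"
    using t u by (auto simp: occupation_def vacation_state_def present_def working_start_def
        env_of_def services_of_def[abs_def] ennreal_add_left_cancel_less)
  then show "t \<in> (\<lambda>t. V \<omega> + t) ` ?O"
    using u by blast
next
  fix t assume "t \<in> (\<lambda>t. V \<omega> + t) ` ?O"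
  then obtain u where "t = V \<omega> + u" "u \<in> ?O" by blast
  then show "t \<in> ?A"
    using V by (auto simp: occupation_def vacation_state_def present_def working_start_def
        env_of_def services_of_def[abs_def] vacation_cycle_eq ennreal_add_left_cancel_less)
qed

text \<open>The vacation affects the expected time in a working state only through the number it
  transfers; its length enters the mean cycle alone.\<close>

lemma working_prob_eq:
  assumes Q: "stable_queue r b F" and V: "integrable M V" and \<psi>: "integrable (measure_pmf \<psi>) real"
  shows "working_prob M X B S V L j =
    enn2real (stable_queue.expected_occupation r b F \<psi> j) /
      (expectation V + measure_pmf.expectation \<psi> real * (\<integral>s. s \<partial>F) / (1 - traffic_intensity r b F))"
proof -
  interpret Q: stable_queue r b F by fact
  note st = transfer_pos \<psi> measurable_working_start distr_working_start
  define W where "W = measure_pmf.expectation \<psi> real * (\<integral>s. s \<partial>F) / (1 - Q.\<rho>)"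
  have W: "0 \<le> W"
    using Q.mean_service_nonneg Q.stable by (simp add: W_def)
  have V0: "0 \<le> expectation V"
    using vacation_length_nonneg by (rule integral_nonneg_AE)
  have time: "expected_time M (vacation_cycle X B S V L) (vacation_state X B S V L) (Working, j) =
      Q.expected_occupation \<psi> j"
    unfolding expected_time_def Q.nn_integral_occupation[OF st, symmetric]
    using vacation_length_nonneg Q.AE_occupation_measurable[OF st, of j]
    by (intro nn_integral_cong_AE, eventually_elim) (simp add: working_occupation image_plus_measurable)
  have "(\<integral>\<^sup>+\<omega>. vacation_cycle X B S V L \<omega> \<partial>M) = (\<integral>\<^sup>+\<omega>. ennreal (V \<omega>) \<partial>M) + ennreal W"
    unfolding vacation_cycle_eq W_def using V by (intro Q.nn_integral_add_emptying[OF st]) auto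
  also have "(\<integral>\<^sup>+\<omega>. ennreal (V \<omega>) \<partial>M) = ennreal (expectation V)"
    using V vacation_length_nonneg by (rule nn_integral_eq_integral)
  finally have cycle: "(\<integral>\<^sup>+\<omega>. vacation_cycle X B S V L \<omega> \<partial>M) = ennreal (expectation V + W)"
    using V0 W by simp
  have "Q.expected_occupation \<psi> j = ennreal (enn2real (Q.expected_occupation \<psi> j))"
    using transfer_pos \<psi>
    by (cases j) (simp_all add: Q.expected_occupation_0 Q.expected_occupation_Suc
        Q.enn2real_expected_occupation_Suc del: sum.atMost_Suc)
  then have "working_prob M X B S V L j =
      enn2real (ennreal (enn2real (Q.expected_occupation \<psi> j)) / ennreal (expectation V + W))"
    by (simp add: working_prob_def steady_state_prob_def time cycle)
  also have "\<dots> = enn2real (Q.expected_occupation \<psi> j) / (expectation V + W)"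
    using V0 W by (intro enn2real_divide_ennreal) auto
  finally show ?thesis
    by (simp only: W_def)
qed

text \<open>Conditioning on the working mode cancels the mean cycle length \<open>\<tau>\<close>,
  and with it the length of the vacation.\<close>

lemma conditional_working_pgf_eq:
  assumes Q: "stable_queue r b F" and V: "integrable M V" and \<psi>: "integrable (measure_pmf \<psi>) real"
    and z: "norm z < 1"
  shows "conditional_working_pgf M X B S V L z =
    pgf (\<lambda>j. enn2real (stable_queue.expected_occupation r b F \<psi> j)) z /
      of_real (measure_pmf.expectation \<psi> real * (\<integral>s. s \<partial>F) / (1 - traffic_intensity r b F))"
proof -
  interpret Q: stable_queue r b F by fact
  define W where "W = measure_pmf.expectation \<psi> real * (\<integral>s. s \<partial>F) / (1 - Q.\<rho>)"
  define \<tau> where "\<tau> = expectation V + W"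
  define occ where "occ j = enn2real (Q.expected_occupation \<psi> j)" for j
  have wp: "working_prob M X B S V L j = inverse \<tau> * occ j" for j
    unfolding working_prob_eq[OF Q V \<psi>] by (simp add: \<tau>_def W_def occ_def divide_inverse)
  have occ0: "occ 0 = 0"
    by (simp add: occ_def Q.expected_occupation_0)
  have so: "summable occ"
    unfolding occ_def by (rule Q.summable_expected_occupation[OF transfer_pos \<psi>])
  have "(\<lambda>j. if j = 0 then 0 else working_prob M X B S V L j) = (\<lambda>j. inverse \<tau> * occ j)"
    by (auto simp: wp occ0)
  then have "working_pgf M X B S V L z = of_real (inverse \<tau>) * pgf occ z"
    unfolding working_pgf_def using so z by (simp add: pgf_cmult occ_def[abs_def])
  moreover have "(\<Sum>j. working_prob M X B S V L (Suc j)) = inverse \<tau> * W"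
  proof -
    have "(\<lambda>j. occ (Suc j)) sums W"
      unfolding occ_def W_def by (rule Q.expected_occupation_Suc_sums[OF transfer_pos \<psi>])
    then show ?thesis
      unfolding wp by (simp add: sums_iff suminf_mult)
  qed
  \<comment> \<open>If the mean cycle is zero, so is the mean working period, and both sides are
    \<open>0\<close> by the convention for division by zero.\<close>
  moreover have "W = 0" if "\<tau> = 0"
  proof -
    have "0 \<le> expectation V"
      using vacation_length_nonneg by (rule integral_nonneg_AE)
    moreover have "0 \<le> W"
      using Q.mean_service_nonneg Q.stable by (simp add: W_def)
    ultimately show ?thesis
      using that by (simp add: \<tau>_def)
  qed
  ultimately have "conditional_working_pgf M X B S V L z = pgf occ z / of_real W"
    by (cases "\<tau> = 0") (auto simp: conditional_working_pgf_def)
  then show ?thesis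
    by (simp add: W_def occ_def[abs_def])
qed

end

text \<open>The regular queue may live on another probability space \<open>M'\<close>: the
  comparison uses only the shared \<open>r\<close>, \<open>b\<close> and \<open>F\<close>.\<close>

theorem theorem1:
  fixes M :: "'a measure" and M' :: "'b measure"
    and r :: real and b \<psi> :: "nat pmf" and F :: "real measure"
    and X S :: "nat \<Rightarrow> 'a \<Rightarrow> real" and B :: "nat \<Rightarrow> 'a \<Rightarrow> nat"
    and H :: "'a measure" and V :: "'a \<Rightarrow> real" and L :: "real \<Rightarrow> 'a \<Rightarrow> nat"
    and X' S' :: "nat \<Rightarrow> 'b \<Rightarrow> real" and B' :: "nat \<Rightarrow> 'b \<Rightarrow> nat"
    and z :: complex
  assumes "vacation_queue M r b F X B S H V L \<psi>"
    and "MXG1_input M' r b F X' B' S'"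
    and "integrable M V"
    and "integrable (measure_pmf \<psi>) real"
    and "integrable (measure_pmf b) real"
    and "integrable F (\<lambda>s. s)"
    and "traffic_intensity r b F < 1"
    and "norm z < 1"
  shows "conditional_working_pgf M X B S V L z =
           regular_busy_pgf M' r b F X' B' S' z * inverse (equilibrium_pgf b z) * equilibrium_pgf \<psi> z"
proof -
  have "stable_queue r b F"
    by (intro stable_queue.intro stable_queue_axioms.intro MXG1_input.queue_law[OF assms(2)] assms(5-7))
  then interpret Q: stable_queue r b F .
  interpret G: vacation_queue M r b F X B S H V L \<psi> by fact
  define ES \<rho> EB E\<psi> where "ES = (\<integral>s. s \<partial>F)" and "\<rho> = traffic_intensity r b F"
    and "EB = measure_pmf.expectation b real" and "E\<psi> = measure_pmf.expectation \<psi> real"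
  have pos: "0 < EB" "0 < E\<psi>" "0 < r" "0 < 1 - \<rho>"
    using expectation_pos[OF Q.batch_pos assms(5)] expectation_pos[OF G.transfer_pos assms(4)]
      Q.rate_pos assms(7) by (simp_all add: EB_def E\<psi>_def \<rho>_def)
  have \<rho>: "\<rho> = r * ES * EB"
    by (simp add: \<rho>_def traffic_intensity_def ES_def EB_def)
  \<comment> \<open>The common factor of both queues, determined by the arrivals and the time during
    one service and independent of the initial law.\<close>
  define K where "K = z * pgf Q.occupation_weight z / (1 - pgf (tail Q.arrival_weight) z)"
  have lhs: "conditional_working_pgf M X B S V L z =
      of_real E\<psi> * equilibrium_pgf \<psi> z * K / of_real (E\<psi> * ES / (1 - \<rho>))"
    unfolding G.conditional_working_pgf_eq[OF Q.stable_queue_axioms assms(3,4,8)]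
      Q.pgf_expected_occupation_eq[OF G.transfer_pos assms(4,8)] K_def E\<psi>_def ES_def \<rho>_def ..
  have rhs: "regular_busy_pgf M' r b F X' B' S' z =
      of_real (r * (1 - \<rho>) / \<rho>) * (of_real EB * equilibrium_pgf b z * K)"
    unfolding MXG1_input.regular_busy_pgf_eq[OF assms(2) Q.stable_queue_axioms assms(8)]
      Q.pgf_expected_occupation_eq[OF Q.batch_pos assms(5,8)] K_def EB_def \<rho>_def ..
  \<comment> \<open>Needed to cancel \<open>equilibrium_pgf b z\<close> against the
    \<open>inverse\<close> in the claim.\<close>
  have Be: "equilibrium_pgf b z \<noteq> 0"
  proof
    assume "equilibrium_pgf b z = 0"
    then have "pgf (tail (pmf b)) z = 0"
      using assms(8) by (simp add: pgf_tail_pmf[OF Q.batch_pos assms(5)])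
    then show False
      using pgf_tail_nonzero[OF pmf_nonneg pmf_sums pmf_expectation_sums[OF assms(5)] _ assms(8)] Q.batch_pos
      by (simp add: set_pmf_iff)
  qed
  show ?thesis
  \<comment> \<open>With vanishing services \<open>\<rho> = 0\<close>, and both sides contain a
    division by zero, hence are \<open>0\<close>.\<close>
  proof (cases "ES = 0")
    case True
    then show ?thesis
      by (simp add: lhs rhs \<rho>)
  next
    case False
    \<comment> \<open>Both normalisations reduce to \<open>(1 - \<rho>) / ES\<close>: the mean batch
      size cancels here through \<open>\<rho> = r * ES * EB\<close>, and the mean transfer cancels
      in the next equation.\<close>
    have "of_real (r * (1 - \<rho>) / \<rho>) * of_real EB = (of_real ((1 - \<rho>) / ES) :: complex)"
      using pos False unfolding of_real_mult[symmetric] by (subst (2) \<rho>) simp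
    moreover have "of_real E\<psi> / of_real (E\<psi> * ES / (1 - \<rho>)) = (of_real ((1 - \<rho>) / ES) :: complex)"
      using pos False by simp
    moreover have "a * y * K / w = (a / w) * (y * K)"
      "c * (d * x * K) * inverse x * y = (c * d) * (y * K)" if "x \<noteq> 0" for a c d w x y :: complex
      using that by (simp_all add: field_simps)
    ultimately show ?thesis
      unfolding lhs rhs using Be by metis
  qed
qed

end
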